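(* Let $r$ be an $\mathcal A$-stable rational approximation of order $q\in\mathbb N$ to the exponential $e^{-z}$, with $r^{(q+1)}(0)\neq(-1)^{q+1}$. If $-A$ generates a bounded $C_0$-semigroup on a Hilbert space $X$, and $i\mathbb R_+\subset\sigma(A)$, then there exist $C=C(r)>0$ and $n_0=n_0(r)\in\mathbb N$ such that for every $s\in(0,q+1]$, $$\|\Delta_{r,n,s}(tA)\|\ge\frac{C\,t^s}{n^{sq/(q+1)}},\qquad n\ge n_0,\quad t\ge0.$$
   Context: $\mathbb N=\{1,2,\dots\}$, $\mathbb R_+=[0,\infty)$, $\mathbb C_+=\{z\in\mathbb C:\mathrm{Re}\,z>0\}$; $\sigma(A)$ is the spectrum of $A$. A rational function $r$ is $\mathcal A$-stable if it is holomorphic in $\mathbb C_+$ and $\sup_{z\in\mathbb C_+}|r(z)|\le1$. It is a rational approximation of order $q$ to $e^{-z}$ if $e^{-z}-r(z)=O(|z|^{q+1})$ as $z\to0$. The notation $C(r)$, $n_0(r)$ means that these constants depend only on $r$ and on parameters associated exclusively with $r$ (such as $q$). For $n\in\mathbb N$ and $s\in[0,q+1]$, $$\Delta_{r,n,s}(z):=z^{-s}\bigl(e^{-z}-r^n(z/n)\bigr),\qquad z\in\mathbb C_+,$$ where $r^n(z/n)=(r(z/n))^n$. This function extends continuously to $\overline{\mathbb C}_+$, and it is the Laplace transform $\widehat\nu(z)=\int_0^\infty e^{-zu}\,d\nu(u)$ of a bounded Borel measure $\nu=\nu_{r,n,s}$ on $[0,\infty)$; the operator $\Delta_{r,n,s}(tA)$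 is defined by the Hille–Phillips calculus, $\Delta_{r,n,s}(tA)x=\int_0^\infty e^{-utA}x\,d\nu(u)$, $x\in X$, where $(e^{-tA})_{t\ge0}$ is the semigroup generated by $-A$.
   Formalization: The printed bound fails as t→∞ (‖Δ(tA)‖ stays bounded in t), so what is proved is t^s‖Δ_{r,n,s}(tA)‖ ≥ C t^s/n^{sq/(q+1)}; C and n_0 serve all Hilbert spaces that are closed subspaces of one arbitrary ambient Hilbert space. *)

theory Defs
  imports
    "HOL-Complex_Analysis.Complex_Analysis"
    "HOL-Library.Landau_Symbols"
begin

section \<open>Rational approximations of the exponential\<close>

text \<open>A rational function is represented by the pointwise quotient of coprime polynomials. At a
  pole the quotient takes the junk value 0 and is not continuous there, so holomorphy of the
  quotient on a set does exclude poles in that set.\<close>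

definition rational_function :: "(complex \<Rightarrow> complex) \<Rightarrow> bool" where
  "rational_function r \<longleftrightarrow>
     (\<exists>p d. d \<noteq> 0 \<and> coprime p d \<and> r = (\<lambda>z. poly p z / poly d z))"

definition A_stable :: "(complex \<Rightarrow> complex) \<Rightarrow> bool" where
  "A_stable r \<longleftrightarrow>
     r holomorphic_on {z. Re z > 0} \<and> (\<forall>z. Re z > 0 \<longrightarrow> cmod (r z) \<le> 1)"

definition rational_approximation_of_order :: "nat \<Rightarrow> (complex \<Rightarrow> complex) \<Rightarrow> bool" where
  "rational_approximation_of_order q r \<longleftrightarrow> rational_function r \<and>
     (\<lambda>z. cmod (exp (- z) - r z)) \<in> O[at 0](\<lambda>z. cmod z ^ (q + 1))"

text \<open>Only used on the open right half-plane, where \<open>powr\<close> is the principal branch. The factor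
  \<open>z\<^sup>-\<^sup>s\<close> scales with the argument, so the unscaled error \<open>A\<^sup>-\<^sup>s (e\<^sup>-\<^sup>t\<^sup>A - r\<^sup>n(tA/n))\<close>
  is \<open>t\<^sup>s\<close> times \<open>Delta r n s\<close> evaluated at \<open>tA\<close>. For a bounded semigroup the latter operator
  is bounded uniformly in \<open>t\<close>, so only the former can grow like \<open>t\<^sup>s\<close>.\<close>

definition Delta :: "(complex \<Rightarrow> complex) \<Rightarrow> nat \<Rightarrow> real \<Rightarrow> complex \<Rightarrow> complex" where
  "Delta r n s z = z powr (- of_real s) * (exp (- z) - r (z / of_nat n) ^ n)"


section \<open>Complex Hilbert spaces\<close>

class scaleC =
  fixes scaleC :: "complex \<Rightarrow> 'a \<Rightarrow> 'a" (infixr \<open>*\<^sub>C\<close> 75)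

class complex_hilbert = banach + scaleC +
  fixes cinner :: "'a \<Rightarrow> 'a \<Rightarrow> complex"
  assumes scaleC_add_right: "c *\<^sub>C (x + y) = c *\<^sub>C x + c *\<^sub>C y"
    and scaleC_add_left: "(b + c) *\<^sub>C x = b *\<^sub>C x + c *\<^sub>C x"
    and scaleC_scaleC: "b *\<^sub>C c *\<^sub>C x = (b * c) *\<^sub>C x"
    and scaleR_scaleC: "a *\<^sub>R x = of_real a *\<^sub>C x"
    and cinner_commute: "cinner x y = cnj (cinner y x)"
    and cinner_add_left: "cinner (x + y) z = cinner x z + cinner y z"
    and cinner_scaleC_left: "cinner (c *\<^sub>C x) y = c * cinner x y"
    and cinner_self: "cinner x x = of_real ((norm x)\<^sup>2)"

text \<open>The Hilbert spaces under consideration are the closed complex subspaces \<open>X\<close> of an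
  arbitrary ambient Hilbert space type. The ambient space itself is an instance; the
  relativisation to \<open>X\<close> is there because types cannot be quantified inside a formula, whereas
  constants that do not depend on the Hilbert space have to be chosen before it.\<close>

definition closed_csubspace :: "'a::complex_hilbert set \<Rightarrow> bool" where
  "closed_csubspace X \<longleftrightarrow> closed X \<and> 0 \<in> X \<and>
     (\<forall>x\<in>X. \<forall>y\<in>X. x + y \<in> X) \<and> (\<forall>c. \<forall>x\<in>X. c *\<^sub>C x \<in> X)"

definition bounded_clinear_on :: "'a::complex_hilbert set \<Rightarrow> ('a \<Rightarrow> 'a) \<Rightarrow> bool" where
  "bounded_clinear_on X B \<longleftrightarrow> (\<forall>x\<in>X. B x \<in> X) \<and>
     (\<forall>x\<in>X. \<forall>y\<in>X. B (x + y) = B x + B y) \<and>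
     (\<forall>c. \<forall>x\<in>X. B (c *\<^sub>C x) = c *\<^sub>C B x) \<and>
     (\<exists>K. \<forall>x\<in>X. norm (B x) \<le> K * norm x)"

definition onorm_on :: "'a::complex_hilbert set \<Rightarrow> ('a \<Rightarrow> 'a) \<Rightarrow> real" where
  "onorm_on X B = (SUP x\<in>X. norm (B x) / norm x)"


section \<open>Semigroups, generators and spectra\<close>

definition bounded_C0_semigroup ::
    "'a::complex_hilbert set \<Rightarrow> (real \<Rightarrow> 'a \<Rightarrow> 'a) \<Rightarrow> bool" where
  "bounded_C0_semigroup X T \<longleftrightarrow>
     (\<forall>t\<ge>0. bounded_clinear_on X (T t)) \<and>
     (\<forall>x\<in>X. T 0 x = x) \<and>
     (\<forall>t\<ge>0. \<forall>u\<ge>0. \<forall>x\<in>X. T (t + u) x = T t (T u x)) \<and>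
     (\<forall>x\<in>X. ((\<lambda>t. T t x) \<longlongrightarrow> x) (at_right 0)) \<and>
     (\<exists>M. \<forall>t\<ge>0. \<forall>x\<in>X. norm (T t x) \<le> M * norm x)"

text \<open>The unbounded operator \<open>A\<close> with domain \<open>D\<close> is the negative of the generator of \<open>T\<close>,
  that is, \<open>T t\<close> is \<open>e\<^sup>-\<^sup>t\<^sup>A\<close>.\<close>

definition neg_generates ::
    "'a::complex_hilbert set \<Rightarrow> 'a set \<Rightarrow> ('a \<Rightarrow> 'a) \<Rightarrow> (real \<Rightarrow> 'a \<Rightarrow> 'a) \<Rightarrow> bool" where
  "neg_generates X D A T \<longleftrightarrow>
     D = {x\<in>X. \<exists>y. ((\<lambda>h. (T h x - x) /\<^sub>R h) \<longlongrightarrow> y) (at_right 0)} \<and>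
     (\<forall>x\<in>D. ((\<lambda>h. (T h x - x) /\<^sub>R h) \<longlongrightarrow> - A x) (at_right 0))"

definition resolvent_set ::
    "'a::complex_hilbert set \<Rightarrow> 'a set \<Rightarrow> ('a \<Rightarrow> 'a) \<Rightarrow> complex set" where
  "resolvent_set X D A = {z. bij_betw (\<lambda>x. z *\<^sub>C x - A x) D X \<and>
     (\<exists>K. \<forall>x\<in>D. norm x \<le> K * norm (z *\<^sub>C x - A x))}"

definition spectrum_on ::
    "'a::complex_hilbert set \<Rightarrow> 'a set \<Rightarrow> ('a \<Rightarrow> 'a) \<Rightarrow> complex set" where
  "spectrum_on X D A = - resolvent_set X D A"


section \<open>Hille--Phillips calculus\<close>

text \<open>A bounded complex Borel measure \<open>\<nu>\<close> on \<open>[0,\<infinity>)\<close> is encoded by a finite positive measure \<open>\<mu>\<close>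
  and a \<open>\<mu>\<close>-integrable density \<open>h\<close>, meaning \<open>d\<nu> = h d\<mu>\<close>. Every such measure arises in this way,
  by polar decomposition with respect to its total variation.\<close>

type_synonym complex_measure = "real measure \<times> (real \<Rightarrow> complex)"

definition bounded_borel_measure :: "complex_measure \<Rightarrow> bool" where
  "bounded_borel_measure = (\<lambda>(\<mu>, h).
     finite_measure \<mu> \<and> sets \<mu> = sets borel \<and> emeasure \<mu> {..<0} = 0 \<and> integrable \<mu> h)"

definition is_laplace_transform_of :: "(complex \<Rightarrow> complex) \<Rightarrow> complex_measure \<Rightarrow> bool" where
  "is_laplace_transform_of f = (\<lambda>(\<mu>, h).
     \<forall>z. Re z > 0 \<longrightarrow> f z = (\<integral>u. exp (- z * of_real u) * h u \<partial>\<mu>))"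

text \<open>By uniqueness of Laplace transforms the choice only concerns the encoding \<open>(\<mu>, h)\<close>.\<close>

definition representing_measure :: "(complex \<Rightarrow> complex) \<Rightarrow> complex_measure" where
  "representing_measure f =
     (SOME \<nu>. bounded_borel_measure \<nu> \<and> is_laplace_transform_of f \<nu>)"

text \<open>This is \<open>has_bochner_integral\<close> without its restriction to second countable (that is,
  separable) target spaces.\<close>

definition has_vector_integral ::
    "'m measure \<Rightarrow> ('m \<Rightarrow> 'a::complex_hilbert) \<Rightarrow> 'a \<Rightarrow> bool" where
  "has_vector_integral M f v \<longleftrightarrow> f \<in> borel_measurable M \<and>
     (\<exists>g. (\<forall>i. Bochner_Integration.simple_bochner_integrable M (g i)) \<and>
          (\<lambda>i. \<integral>\<^sup>+u. ennreal (norm (f u - g i u)) \<partial>M) \<longlonglongrightarrow> 0 \<and>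
          (\<lambda>i::nat. Bochner_Integration.simple_bochner_integral M (g i)) \<longlonglongrightarrow> v)"

text \<open>\<open>f(tA)x = \<integral> e\<^sup>-\<^sup>u\<^sup>t\<^sup>A x d\<nu>(u)\<close> for \<open>f\<close> the Laplace transform of \<open>\<nu>\<close> and
  \<open>T\<close> the semigroup generated by \<open>-A\<close>. The integrand is cut off on the \<open>\<mu>\<close>-null set of negative
  \<open>u\<close>, where \<open>T\<close> is unspecified.\<close>

definition hille_phillips ::
    "(complex \<Rightarrow> complex) \<Rightarrow> (real \<Rightarrow> 'a \<Rightarrow> 'a) \<Rightarrow> real \<Rightarrow> 'a \<Rightarrow> 'a::complex_hilbert" where
  "hille_phillips f T t x = (case representing_measure f of (\<mu>, h) \<Rightarrow>
     THE v. has_vector_integral \<mu> (\<lambda>u. if u < 0 then 0 else h u *\<^sub>C T (u * t) x) v)"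

end

theory Submission
  imports Defs "HOL-Real_Asymp.Real_Asymp"
begin

text \<open>A single step of the scheme has error of exact order \<open>|z|\<^sup>q\<^sup>+\<^sup>1\<close>, so \<open>n\<close> steps evaluated at the
  frequency \<open>\<tau> = a n\<^sup>q\<^sup>/\<^sup>(\<^sup>q\<^sup>+\<^sup>1\<^sup>)\<close> of the imaginary axis accumulate an error bounded below by a
  constant, whence \<open>|\<Delta>(\<i>\<tau>)| \<ge> C \<tau>\<^sup>-\<^sup>s\<close>. As the spectrum lies in the closed right half-plane, each of its
  imaginary points is an approximate eigenvalue; on approximate eigenvectors for \<open>\<i>\<tau>/t\<close> the operator
  \<open>\<Delta>(tA)\<close> acts almost as multiplication by \<open>\<Delta>(\<i>\<tau>)\<close>, so its norm is at least \<open>|\<Delta>(\<i>\<tau>)|\<close>.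

  That the measure behind \<open>\<Delta>(tA)\<close> exists is shown by writing \<open>s = j + \<theta>\<close> with \<open>0 < \<theta> \<le> 1\<close>. The measure
  of \<open>e\<^sup>-\<^sup>z - r\<^sup>n(z/n)\<close> has exponential moments, and its moments of order at most \<open>q\<close> vanish; hence it can
  be integrated \<open>j\<close> times, and then once more fractionally, without losing integrability.\<close>

section \<open>Rational approximations near the origin\<close>

text \<open>\<open>representing_measure\<close> is a SOME-choice, so nothing can be said about
  \<open>hille_phillips\<close> before a measure is known to exist; this is why half of the work is
  a construction. A transform is divided by x^\<theta> by convolving with
  u^(\<theta>-1)/Gamma(\<theta>), which is not integrable at infinity. If the total mass vanishes,
  the untranslated kernel can be subtracted from every translate, and the difference is integrable.
  For \<theta> < 1 its tail is only polynomial and exponential moments are lost; hence the integer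
  divisions come first and the fractional one last. Taking \<theta> from (0,1] covers s = q + 1 with
  only q integer divisions. All of this is computed for positive real arguments, where powers are
  harmless, and carried to the half-plane by the identity theorem. The constants come from the
  behaviour of r on the imaginary axis alone; a \<le> 1 is imposed so that a^s \<le> 1 and C does
  not depend on s. The ambient Hilbert space may be non-separable, so vector integrals are handled
  by pairing them with vectors, and norm estimates by pairing a vector with itself.\<close>

lemma A_stable_rational_functionE:
  assumes "A_stable r" "rational_function r"
  obtains p d where "r = (\<lambda>z. poly p z / poly d z)" "\<And>z. Re z \<ge> 0 \<Longrightarrow> poly d z \<noteq> 0"
    "degree p \<le> degree d" "\<And>z. Re z \<ge> 0 \<Longrightarrow> cmod (r z) \<le> 1"
proof -
  from assms(2) obtain p d where d: "d \<noteq> 0" and cop: "coprime p d"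
    and r: "r = (\<lambda>z. poly p z / poly d z)"
    unfolding rational_function_def by blast
  have le: "cmod (poly p z) \<le> cmod (poly d z)" if z: "Re z \<ge> 0" for z
  proof -
    have fin: "finite {w. poly d w = 0}" by (rule poly_roots_finite[OF d])
    have "((\<lambda>e. cmod (poly d (z + of_real e)) - cmod (poly p (z + of_real e))) \<longlongrightarrow>
             cmod (poly d (z + of_real 0)) - cmod (poly p (z + of_real 0))) (at_right 0)"
      by (intro tendsto_intros)
    \<comment> \<open>The inequality is reached from inside, along z + e. The offsets e that hit a
      root of \<open>d\<close> lie in a finite set; away from it the bound on \<open>r\<close> can
      be multiplied by the denominator.\<close>
    moreover have "\<forall>\<^sub>F e in at_right (0::real).
        cmod (poly d (z + of_real e)) - cmod (poly p (z + of_real e)) \<ge> 0"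
    proof -
      have "finite ((\<lambda>w. Re (w - z)) ` {w. poly d w = 0})" using fin by simp
      then have "closed ((\<lambda>w. Re (w - z)) ` {w. poly d w = 0} - {0})"
        by (intro finite_imp_closed) auto
      then have "open (- ((\<lambda>w. Re (w - z)) ` {w. poly d w = 0} - {0}))" by (rule open_Compl)
      then have "\<forall>\<^sub>F e in nhds 0. e \<in> - ((\<lambda>w. Re (w - z)) ` {w. poly d w = 0} - {0})"
        by (rule eventually_nhds_in_open) auto
      then have "\<forall>\<^sub>F e in at_right 0. e \<in> - ((\<lambda>w. Re (w - z)) ` {w. poly d w = 0} - {0})"
        unfolding eventually_at_filter by (rule eventually_mono) blast
      moreover have "\<forall>\<^sub>F e in at_right (0::real). e > 0"
        by (simp add: eventually_at_right_less)
      ultimately show ?thesis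
      proof eventually_elim
        case (elim e)
        have "poly d (z + of_real e) \<noteq> 0"
        proof
          assume "poly d (z + of_real e) = 0"
          then have "Re (z + of_real e - z) \<in> (\<lambda>w. Re (w - z)) ` {w. poly d w = 0}" by blast
          with elim show False by auto
        qed
        moreover have "cmod (r (z + of_real e)) \<le> 1"
          using assms(1) z elim unfolding A_stable_def by auto
        ultimately show ?case by (simp add: r norm_divide field_simps)
      qed
    qed
    ultimately have "cmod (poly d (z + of_real 0)) - cmod (poly p (z + of_real 0)) \<ge> 0"
      by (intro tendsto_lowerbound) auto
    then show ?thesis by simp
  qed
  \<comment> \<open>A root of \<open>d\<close> in the closed half-plane would by \<open>le\<close>
    be a root of \<open>p\<close> too, against coprimality.\<close>
  have nz: "poly d z \<noteq> 0" if "Re z \<ge> 0" for z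
    using le[OF that] cop coprime_poly_0[of p d z] by auto
  \<comment> \<open>If \<open>p\<close> had the larger degree, |p| would exceed |d| far out on the
    positive axis, which \<open>le\<close> forbids.\<close>
  have deg: "degree p \<le> degree d"
  proof (rule ccontr)
    assume "\<not> degree p \<le> degree d"
    then have "((\<lambda>x. poly d x / poly p x) \<longlongrightarrow> 0) at_infinity"
      by (intro poly_divide_tendsto_0_at_infinity) auto
    then have "((\<lambda>x. poly d (of_real x) / poly p (of_real x)) \<longlongrightarrow> 0) at_top"
      by (rule filterlim_compose) (rule filterlim_of_real_at_infinity)
    then have "\<forall>\<^sub>F x in at_top. cmod (poly d (of_real x) / poly p (of_real x)) < 1"
      using order_tendstoD(2)[OF tendsto_norm, of _ 0 at_top 1] by auto
    moreover have "\<forall>\<^sub>F x::real in at_top. x \<ge> 0" by (rule eventually_ge_at_top)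
    moreover have "\<forall>\<^sub>F x::real in at_top. poly p (of_real x) \<noteq> 0"
    proof -
      have "p \<noteq> 0" using \<open>\<not> degree p \<le> degree d\<close> by auto
      then have "finite {w. poly p w = 0}" by (rule poly_roots_finite)
      then have "bounded {w. poly p w = 0}" by (rule finite_imp_bounded)
      then obtain B where B: "\<And>w. poly p w = 0 \<Longrightarrow> cmod w \<le> B" unfolding bounded_iff by auto
      have "\<forall>\<^sub>F x::real in at_top. x > \<bar>B\<bar>" by (rule eventually_gt_at_top)
      then show ?thesis by eventually_elim (use B in fastforce)
    qed
    ultimately have "\<forall>\<^sub>F x::real in at_top. False"
    proof eventually_elim
      case (elim x)
      then show ?case using le[of "of_real x"] by (simp add: norm_divide divide_less_eq)
    qed
    then show False by simp
  qed
  have "cmod (r z) \<le> 1" if "Re z \<ge> 0" for z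
    using le[OF that] nz[OF that] by (simp add: r norm_divide)
  with r nz deg show ?thesis by (rule that)
qed

text \<open>Write 1 - u^n = (1 - u) * (1 + u + ... + u^(n-1)). Each u^k is within k |1 - u| of 1, so
  the second factor is within n/2 of n: as long as n |1 - u| \<le> 1, the contributions of the n
  steps cannot cancel.\<close>

lemma one_minus_power_lower_bound:
  fixes u :: complex
  assumes "cmod u \<le> 1" "real n * cmod (1 - u) \<le> 1"
  shows "cmod (1 - u ^ n) \<ge> real n * cmod (1 - u) / 2"
proof -
  have 1: "cmod (1 - u ^ k) \<le> real k * cmod (1 - u)" for k
    using norm_power_diff[of 1 u k] assms by simp
  have "cmod (of_nat n - (\<Sum>k<n. u ^ k)) = cmod (\<Sum>k<n. 1 - u ^ k)"
    by (simp add: sum_subtractf)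
  also have "\<dots> \<le> (\<Sum>k<n. real k * cmod (1 - u))"
    by (rule order_trans[OF norm_sum sum_mono[OF 1]])
  also have "\<dots> = (\<Sum>k<n. real k) * cmod (1 - u)" by (simp add: sum_distrib_right)
  also have "\<dots> \<le> real n * real n / 2 * cmod (1 - u)"
  proof (rule mult_right_mono)
    have "2 * (\<Sum>k<n. real k) \<le> real n * real n"
      by (induction n) (auto simp: algebra_simps)
    then show "(\<Sum>k<n. real k) \<le> real n * real n / 2" by simp
  qed simp
  also have "\<dots> = real n / 2 * (real n * cmod (1 - u))" by simp
  also have "\<dots> \<le> real n / 2 * 1" using assms by (intro mult_left_mono) auto
  finally have "cmod (of_nat n - (\<Sum>k<n. u ^ k)) \<le> real n / 2" by simp
  moreover have "cmod (of_nat n) - cmod (\<Sum>k<n. u ^ k) \<le> cmod (of_nat n - (\<Sum>k<n. u ^ k))"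
    by (rule norm_triangle_ineq2)
  ultimately have "cmod (\<Sum>k<n. u ^ k) \<ge> real n / 2" by simp
  then have "cmod (1 - u) * cmod (\<Sum>k<n. u ^ k) \<ge> cmod (1 - u) * (real n / 2)"
    by (rule mult_left_mono) simp
  then show ?thesis by (simp add: one_diff_power_eq norm_mult mult.commute)
qed

text \<open>The O-bound forbids a zero of order below m and the derivative forbids one of order
  above m. So f = z^m g with g(0) \<noteq> 0, and near 0 the modulus of g stays between half and
  twice that of g(0).\<close>

lemma exact_order_bounds:
  assumes hol: "f holomorphic_on ball 0 \<rho>" "\<rho> > 0"
    and O: "f \<in> O[at 0](\<lambda>z. z ^ m)" and ne: "(deriv ^^ m) f 0 \<noteq> 0" and m: "m > 0"
  obtains \<delta> c K where "\<delta> > 0" "c > 0" "K > 0"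
    "\<And>z. cmod z < \<delta> \<Longrightarrow> c * cmod z ^ m \<le> cmod (f z) \<and> cmod (f z) \<le> K * cmod z ^ m"
proof -
  obtain B where "B > 0" "\<forall>\<^sub>F z in at 0. cmod (f z) \<le> B * cmod (z ^ m)"
    using landau_o.bigE[OF O] by blast
  note B = this(2)
  have lim: "(f \<longlongrightarrow> f 0) (at 0)"
    using holomorphic_on_imp_continuous_on[OF hol(1)] hol(2) by (auto simp: continuous_on_def
       dest!: bspec[of _ _ 0] simp: at_within_open[of 0 "ball 0 \<rho>"])
  have "((\<lambda>z. B * cmod (z ^ m)) \<longlongrightarrow> B * cmod (0 ^ m)) (at 0)" by (intro tendsto_intros)
  then have "(f \<longlongrightarrow> 0) (at 0)"
    using m by (intro Lim_null_comparison[OF B]) (simp add: power_0_left)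
  with lim have f0: "f 0 = 0" using LIM_unique by blast
  define k where "k = (LEAST i. (deriv ^^ i) f 0 \<noteq> 0)"
  have kne: "(deriv ^^ k) f 0 \<noteq> 0" unfolding k_def by (rule LeastI[of _ m]) (rule ne)
  have km: "k \<le> m" unfolding k_def by (rule Least_le) (rule ne)
  have kl: "(deriv ^^ i) f 0 = 0" if "i < k" for i
    using not_less_Least[of i "\<lambda>i. (deriv ^^ i) f 0 \<noteq> 0"] that unfolding k_def by auto
  have k0: "k > 0" using kne f0 by (cases k) auto
  obtain g \<delta> where g: "0 < \<delta>" "g holomorphic_on ball 0 \<delta>"
      "\<And>w. w \<in> ball 0 \<delta> \<Longrightarrow> f w - f 0 = (w - 0) ^ k * g w" "\<And>w. w \<in> ball 0 \<delta> \<Longrightarrow> g w \<noteq> 0"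
    using holomorphic_factor_order_of_zero[OF hol(1) open_ball, of 0 k] hol(2) k0 kne kl
    by (metis (no_types, lifting) centre_in_ball)
  have glim: "(g \<longlongrightarrow> g 0) (at 0)"
    using holomorphic_on_imp_continuous_on[OF g(2)] g(1) by (auto simp: continuous_on_def
       dest!: bspec[of _ _ 0] simp: at_within_open[of 0 "ball 0 \<delta>"])
  have g0: "g 0 \<noteq> 0" using g(1,4) by auto
  \<comment> \<open>Were k < m, dividing the O-bound by |w|^k would give g(w) = O(|w|^(m-k)), hence
    g(0) = 0.\<close>
  have "k = m"
  proof (rule ccontr)
    assume "k \<noteq> m"
    with km have km: "k < m" by simp
    have "\<forall>\<^sub>F w in at 0. w \<in> ball 0 \<delta> - {0}"
      using g(1) by (intro eventually_at_in_open) auto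
    with B have "\<forall>\<^sub>F w in at 0. cmod (g w) \<le> B * cmod (w ^ (m - k))"
    proof eventually_elim
      case (elim w)
      then have "cmod w ^ k * cmod (g w) \<le> cmod w ^ k * (B * cmod w ^ (m - k))"
        using g(3)[of w] f0 km by (simp add: norm_mult norm_power power_add[symmetric] mult_ac)
      then show ?case using elim by (simp add: norm_power)
    qed
    moreover have "((\<lambda>z. B * cmod (z ^ (m - k))) \<longlongrightarrow> B * cmod (0 ^ (m - k))) (at 0)"
      by (intro tendsto_intros)
    ultimately have "(g \<longlongrightarrow> 0) (at 0)"
      using km by (intro Lim_null_comparison[of g "\<lambda>z. B * cmod (z ^ (m - k))"]) (simp_all add: power_0_left)
    with glim g0 show False using LIM_unique by blast
  qed
  have "\<forall>\<^sub>F w in at 0. cmod (g w) > cmod (g 0) / 2"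
    by (rule order_tendstoD(1)[OF tendsto_norm[OF glim]]) (use g0 in simp)
  moreover have "\<forall>\<^sub>F w in at 0. cmod (g w) < 2 * cmod (g 0)"
    by (rule order_tendstoD(2)[OF tendsto_norm[OF glim]]) (use g0 in simp)
  ultimately have "\<forall>\<^sub>F w in at 0. cmod (g 0) / 2 < cmod (g w) \<and> cmod (g w) < 2 * cmod (g 0)"
    by eventually_elim auto
  then obtain \<delta>' where \<delta>': "\<delta>' > 0" "\<And>w. w \<noteq> 0 \<Longrightarrow> cmod w < \<delta>' \<Longrightarrow>
      cmod (g 0) / 2 < cmod (g w) \<and> cmod (g w) < 2 * cmod (g 0)"
    unfolding eventually_at by (auto simp: dist_norm)
  show ?thesis
  proof (rule that[of "min \<delta> \<delta>'" "cmod (g 0) / 2" "2 * cmod (g 0)"])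
    fix z assume z: "cmod z < min \<delta> \<delta>'"
    show "cmod (g 0) / 2 * cmod z ^ m \<le> cmod (f z) \<and> cmod (f z) \<le> 2 * cmod (g 0) * cmod z ^ m"
    proof (cases "z = 0")
      case True with f0 m show ?thesis by (simp add: power_0_left)
    next
      case False
      have "cmod (f z) = cmod (g z) * cmod z ^ m"
        using g(3)[of z] z f0 \<open>k = m\<close> by (simp add: norm_mult norm_power mult_ac)
      moreover have "cmod (g 0) / 2 \<le> cmod (g z)" "cmod (g z) \<le> 2 * cmod (g 0)"
        using \<delta>'(2)[OF False] z by auto
      ultimately show ?thesis by (metis mult_right_mono norm_ge_zero zero_le_power)
    qed
  qed (use g(1) \<delta>'(1) g0 in auto)
qed

text \<open>The hypothesis on r says that exp(-z) - r z has a nonzero derivative of order q + 1 at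
  0; with the order condition this makes the local error exactly of order q + 1.\<close>

lemma rational_approximation_bounds:
  assumes "A_stable r" "rational_approximation_of_order q r"
    and ne: "(deriv ^^ (q + 1)) r 0 \<noteq> (- 1) ^ (q + 1)"
  obtains \<delta> c K where "\<delta> > 0" "c > 0" "K > 0"
    "\<And>z. cmod z < \<delta> \<Longrightarrow> c * cmod z ^ (q + 1) \<le> cmod (exp (- z) - r z) \<and>
        cmod (exp (- z) - r z) \<le> K * cmod z ^ (q + 1)"
proof -
  have rat: "rational_function r" and
    O: "(\<lambda>z. cmod (exp (- z) - r z)) \<in> O[at 0](\<lambda>z. cmod z ^ (q + 1))"
    using assms(2) unfolding rational_approximation_of_order_def by auto
  obtain p d where r: "r = (\<lambda>z. poly p z / poly d z)" and nz: "\<And>z. Re z \<ge> 0 \<Longrightarrow> poly d z \<noteq> 0"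
    using A_stable_rational_functionE[OF assms(1) rat] by metis
  have "\<forall>\<^sub>F z in nhds 0. poly d z \<noteq> 0"
    using nz[of 0] by (intro tendsto_imp_eventually_ne[of _ "poly d 0"])
       (auto intro!: tendsto_eq_intros filterlim_ident)
  then obtain \<rho> where \<rho>: "\<rho> > 0" "\<And>z. z \<in> ball 0 \<rho> \<Longrightarrow> poly d z \<noteq> 0"
    unfolding eventually_nhds_metric by (auto simp: dist_commute)
  have hr: "r holomorphic_on ball 0 \<rho>"
    unfolding r using \<rho>(2) by (intro holomorphic_intros) auto
  have "(deriv ^^ n) (\<lambda>z. exp (- z)) w = (- 1) ^ n * exp (- w)" for n and w :: complex
  proof (induction n arbitrary: w)
    case (Suc n)
    have "(deriv ^^ n) (\<lambda>z. exp (- z)) = (\<lambda>w::complex. (- 1) ^ n * exp (- w))"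
      by (rule ext) (rule Suc)
    moreover have "((\<lambda>w. (- 1) ^ n * exp (- w)) has_field_derivative (- 1) ^ Suc n * exp (- w)) (at w)"
      by (auto intro!: derivative_eq_intros)
    ultimately show ?case by (simp add: DERIV_imp_deriv)
  qed simp
  then have "(deriv ^^ (q + 1)) (\<lambda>z. exp (- z) - r z) 0 = (- 1) ^ (q + 1) - (deriv ^^ (q + 1)) r 0"
    by (subst higher_deriv_diff[of _ "ball 0 \<rho>"])
       (use hr \<rho>(1) in \<open>auto intro!: holomorphic_intros simp del: funpow.simps\<close>)
  then have "(deriv ^^ (q + 1)) (\<lambda>z. exp (- z) - r z) 0 \<noteq> 0" using ne by auto
  moreover have "(\<lambda>z. exp (- z) - r z) \<in> O[at 0](\<lambda>z. z ^ (q + 1))"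
    using O by (simp add: norm_power[symmetric] del: power_Suc)
  moreover have "(\<lambda>z. exp (- z) - r z) holomorphic_on ball 0 \<rho>"
    using hr by (intro holomorphic_intros)
  ultimately show ?thesis
    using exact_order_bounds[of "\<lambda>z. exp (- z) - r z" \<rho> "q + 1"] \<rho>(1) that by auto
qed

text \<open>At \<open>z = \<i> a n\<^sup>q\<^sup>/\<^sup>(\<^sup>q\<^sup>+\<^sup>1\<^sup>)\<close> the local error of a single step is of order \<open>1/n\<close>, so after \<open>n\<close>
  steps it has accumulated to order 1.\<close>

lemma accumulated_error_lower_bound:
  assumes "A_stable r" "rational_approximation_of_order q r"
    and "(deriv ^^ (q + 1)) r 0 \<noteq> (- 1) ^ (q + 1)"
  obtains a C :: real and n0 :: nat where "0 < a" "a \<le> 1" "C > 0" "n0 \<ge> 1"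
    "\<And>n \<tau>. n \<ge> n0 \<Longrightarrow> \<tau> = a * real n powr (real q / (real q + 1)) \<Longrightarrow>
       cmod (exp (- (\<i> * of_real \<tau>)) - r (\<i> * of_real \<tau> / of_nat n) ^ n) \<ge> C"
proof -
  have rat: "rational_function r"
    using assms(2) unfolding rational_approximation_of_order_def by auto
  have r1: "cmod (r z) \<le> 1" if "Re z \<ge> 0" for z
    using A_stable_rational_functionE[OF assms(1) rat] that by metis
  obtain \<delta> c K where b: "\<delta> > 0" "c > 0" "K > 0"
    "\<And>z. cmod z < \<delta> \<Longrightarrow> c * cmod z ^ (q + 1) \<le> cmod (exp (- z) - r z) \<and>
        cmod (exp (- z) - r z) \<le> K * cmod z ^ (q + 1)"
    using rational_approximation_bounds[OF assms] by blast
  \<comment> \<open>Below, n |1 - u| \<le> K a^(q+1), so 1/K makes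
    \<open>one_minus_power_lower_bound\<close> applicable; the cap at 1 enters \<open>Ka\<close>
    and, in the theorem, bounds a^s uniformly in s.\<close>
  define a where "a = min 1 (1 / K)"
  have a: "0 < a" "a \<le> 1" using b by (auto simp: a_def)
  have Ka: "K * a ^ (q + 1) \<le> 1"
  proof -
    have "a ^ (q + 1) \<le> a ^ 1" using a by (intro power_decreasing) auto
    also have "a ^ 1 \<le> 1 / K" by (simp add: a_def)
    finally show ?thesis using b(3) by (simp add: field_simps)
  qed
  define e where "e = 1 / (real q + 1)"
  have "((\<lambda>n. a * real n powr (- e)) \<longlongrightarrow> 0) sequentially"
    unfolding e_def by (intro tendsto_mult_right_zero tendsto_neg_powr filterlim_real_sequentially) auto
  then have "\<forall>\<^sub>F n in sequentially. a * real n powr (- e) < \<delta>"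
    using b(1) by (rule order_tendstoD)
  then obtain N where N: "\<And>n. n \<ge> N \<Longrightarrow> a * real n powr (- e) < \<delta>"
    unfolding eventually_sequentially by auto
  show ?thesis
  proof (rule that[of a "c * a ^ (q + 1) / 2" "max 1 N"])
    fix n \<tau> assume n: "n \<ge> max 1 N" and \<tau>: "\<tau> = a * real n powr (real q / (real q + 1))"
    define z where "z = \<i> * of_real \<tau> / of_nat n"
    \<comment> \<open>Ratio of the numerical step to the exact one. On the imaginary axis |exp z| =
      1, so 1 - u has the size of the local error and 1 - u^n that of the error after n
      steps.\<close>
    define u where "u = r z * exp z"
    have q: "real q / (real q + 1) = 1 - e" by (simp add: e_def field_simps)
    have tn: "\<tau> / real n = a * real n powr (- e)"
      using n unfolding \<tau> q powr_diff by (simp add: powr_minus field_simps)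
    have zz: "z = \<i> * of_real (\<tau> / real n)" by (simp add: z_def)
    have cz: "cmod z = a * real n powr (- e)"
      unfolding zz tn using a by (simp add: norm_mult)
    have rz: "Re z = 0" by (simp add: zz)
    have "(real n powr (- e)) ^ (q + 1) = real n powr (- e * real (q + 1))"
      using n by (subst powr_powr[symmetric], subst powr_realpow) auto
    also have "\<dots> = 1 / real n" using n by (simp add: e_def powr_minus field_simps)
    finally have zq: "cmod z ^ (q + 1) = a ^ (q + 1) / real n"
      unfolding cz power_mult_distrib by simp
    have cu: "cmod (1 - u) = cmod (exp (- z) - r z)"
    proof -
      have "1 - u = exp z * (exp (- z) - r z)" by (simp add: u_def algebra_simps exp_minus)
      then show ?thesis using rz by (simp add: norm_mult)
    qed
    have "cmod z < \<delta>" using N[of n] n unfolding cz by simp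
    then have bz: "c * (a ^ (q + 1) / real n) \<le> cmod (1 - u)" "cmod (1 - u) \<le> K * (a ^ (q + 1) / real n)"
      using b(4)[of z] unfolding cu zq by blast+
    have u1: "cmod u \<le> 1" using r1[of z] rz by (simp add: u_def norm_mult)
    have "real n * cmod (1 - u) \<le> K * a ^ (q + 1)" using bz(2) n by (simp add: field_simps)
    then have "cmod (1 - u ^ n) \<ge> real n * cmod (1 - u) / 2"
      using Ka by (intro one_minus_power_lower_bound u1) simp
    moreover have "real n * cmod (1 - u) \<ge> c * a ^ (q + 1)" using bz(1) n by (simp add: field_simps)
    moreover have "exp (- (\<i> * of_real \<tau>)) - r z ^ n = exp (- (\<i> * of_real \<tau>)) * (1 - u ^ n)"
    proof -
      have "\<i> * of_real \<tau> = of_nat n * z" using n by (simp add: z_def)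
      then have "exp (- (\<i> * of_real \<tau>)) * u ^ n = r z ^ n"
        by (simp add: u_def power_mult_distrib exp_of_nat_mult[symmetric] exp_minus)
      then show ?thesis by (simp add: algebra_simps)
    qed
    ultimately show "cmod (exp (- (\<i> * of_real \<tau>)) - r (\<i> * of_real \<tau> / of_nat n) ^ n) \<ge> c * a ^ (q + 1) / 2"
      unfolding z_def[symmetric] by (simp add: norm_mult)
  qed (use a b in auto)
qed

section \<open>Orbit integrals in Hilbert space\<close>

lemma scaleC_zero_right [simp]: "c *\<^sub>C (0::'a::complex_hilbert) = 0"
  using scaleC_add_right[of c 0 "0::'a"] by simp

lemma scaleC_zero_left [simp]: "0 *\<^sub>C (x::'a::complex_hilbert) = 0"
  using scaleC_add_left[of 0 0 x] by simp

lemma scaleC_one [simp]: "1 *\<^sub>C (x::'a::complex_hilbert) = x"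
  using scaleR_scaleC[of 1 x] by simp

lemma scaleC_minus1: "(- 1) *\<^sub>C (x::'a::complex_hilbert) = - x"
  using scaleR_scaleC[of "-1" x] by simp

lemma scaleC_minus_right: "c *\<^sub>C (- x) = - (c *\<^sub>C (x::'a::complex_hilbert))"
  using scaleC_add_right[of c x "- x"] by (simp add: eq_neg_iff_add_eq_0 add.commute)

lemma scaleC_diff_right: "c *\<^sub>C (x - y) = c *\<^sub>C x - c *\<^sub>C (y::'a::complex_hilbert)"
  using scaleC_add_right[of c x "- y"] by (simp add: scaleC_minus_right)

lemma scaleC_diff_left: "(b - c) *\<^sub>C x = b *\<^sub>C x - c *\<^sub>C (x::'a::complex_hilbert)"
  using scaleC_add_left[of "b - c" c x] by (simp add: algebra_simps)

lemma cinner_zero_left [simp]: "cinner (0::'a::complex_hilbert) y = 0"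
  using cinner_scaleC_left[of 0 0 y] by simp

lemma cinner_diff_left: "cinner (x - y) z = cinner x z - cinner (y::'a::complex_hilbert) z"
  using cinner_add_left[of "x - y" y z] by simp

lemma cinner_add_right: "cinner z (x + y) = cinner z x + cinner (z::'a::complex_hilbert) y"
  by (metis cinner_add_left cinner_commute complex_cnj_add)

lemma cinner_diff_right: "cinner z (x - y) = cinner z x - cinner (z::'a::complex_hilbert) y"
  using cinner_add_right[of z "x - y" y] by simp

lemma cinner_scaleC_right: "cinner x (c *\<^sub>C y) = cnj c * cinner (x::'a::complex_hilbert) y"
  by (metis cinner_scaleC_left cinner_commute complex_cnj_mult)

lemma mult_cnj_eq_cmod: "z * cnj z = (complex_of_real (cmod z))\<^sup>2"
  by (simp add: complex_norm_square[symmetric])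

lemma norm_scaleC [simp]: "norm (c *\<^sub>C x) = cmod c * norm (x::'a::complex_hilbert)"
proof -
  have "complex_of_real ((norm (c *\<^sub>C x))\<^sup>2) = of_real ((cmod c * norm x)\<^sup>2)"
    unfolding cinner_self[symmetric] cinner_scaleC_left cinner_scaleC_right
    by (simp add: cinner_self power_mult_distrib mult_cnj_eq_cmod flip: mult.assoc)
       (simp add: mult.commute[of "cnj c"] mult_cnj_eq_cmod)
  then have "(norm (c *\<^sub>C x))\<^sup>2 = (cmod c * norm x)\<^sup>2" by (simp only: of_real_eq_iff)
  then show ?thesis by (simp add: power2_eq_iff_nonneg)
qed

lemma cinner_Cauchy_Schwarz: "cmod (cinner x y) \<le> norm x * norm (y::'a::complex_hilbert)"
proof (cases "y = 0")
  case True
  then show ?thesis using cinner_scaleC_right[of x 0 y] by simp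
next
  case False
  then have ny: "norm y > 0" by simp
  define c where "c = cinner x y / of_real ((norm y)\<^sup>2)"
  have "complex_of_real ((norm (x - c *\<^sub>C y))\<^sup>2) =
      cinner x x - cnj c * cinner x y - c * cinner y x + c * cnj c * cinner y y"
    unfolding cinner_self[symmetric]
    by (simp add: cinner_diff_left cinner_diff_right cinner_scaleC_left cinner_scaleC_right algebra_simps)
  also have "cnj c * cinner x y = of_real ((cmod (cinner x y))\<^sup>2 / (norm y)\<^sup>2)"
    by (simp add: c_def mult_cnj_eq_cmod mult.commute[of "cnj _"])
  also have "c * cinner y x = of_real ((cmod (cinner x y))\<^sup>2 / (norm y)\<^sup>2)"
    by (simp add: c_def mult_cnj_eq_cmod cinner_commute[of y x])
  also have "c * cnj c * cinner y y = of_real ((cmod (cinner x y))\<^sup>2 / (norm y)\<^sup>2)"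
  proof -
    have "c * cnj c * cinner y y = of_real ((cmod c)\<^sup>2 * (norm y)\<^sup>2)"
      by (simp add: mult_cnj_eq_cmod cinner_self)
    also have "cmod c = cmod (cinner x y) / (norm y)\<^sup>2" by (simp add: c_def norm_divide norm_power)
    also have "(cmod (cinner x y) / (norm y)\<^sup>2)\<^sup>2 * (norm y)\<^sup>2 = (cmod (cinner x y))\<^sup>2 / (norm y)\<^sup>2"
      using ny by (simp add: power2_eq_square field_simps)
    finally show ?thesis .
  qed
  finally have "complex_of_real ((norm (x - c *\<^sub>C y))\<^sup>2) =
      of_real ((norm x)\<^sup>2 - (cmod (cinner x y))\<^sup>2 / (norm y)\<^sup>2)"
    by (simp add: cinner_self)
  then have "(norm (x - c *\<^sub>C y))\<^sup>2 = (norm x)\<^sup>2 - (cmod (cinner x y))\<^sup>2 / (norm y)\<^sup>2"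
    by (simp only: of_real_eq_iff)
  then have "(cmod (cinner x y))\<^sup>2 / (norm y)\<^sup>2 \<le> (norm x)\<^sup>2"
    by (metis diff_ge_0_iff_ge zero_le_power2)
  then have "(cmod (cinner x y))\<^sup>2 \<le> (norm x * norm y)\<^sup>2"
    using ny by (simp add: field_simps power_mult_distrib)
  then show ?thesis by (rule power2_le_imp_le) simp
qed

lemma bounded_bilinear_scaleC: "bounded_bilinear (scaleC :: complex \<Rightarrow> 'a \<Rightarrow> 'a::complex_hilbert)"
proof
  show "\<exists>K. \<forall>c x. norm (c *\<^sub>C (x::'a)) \<le> cmod c * norm x * K" by (rule exI[of _ 1]) simp
qed (auto simp: scaleC_add_left scaleC_add_right scaleR_scaleC scaleC_scaleC scaleR_conv_of_real
       mult.commute)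

lemmas tendsto_scaleC [tendsto_intros] = bounded_bilinear.tendsto[OF bounded_bilinear_scaleC]

lemma bounded_linear_cinner_left: "bounded_linear (\<lambda>x. cinner x (w::'a::complex_hilbert))"
  by (rule bounded_linear_intro[of _ "norm w"])
     (auto simp: cinner_add_left scaleR_scaleC cinner_scaleC_left scaleR_conv_of_real cinner_Cauchy_Schwarz)

lemma closed_csubspaceD:
  assumes "closed_csubspace X"
  shows "closed X" "0 \<in> X" "\<And>x y. x \<in> X \<Longrightarrow> y \<in> X \<Longrightarrow> x + y \<in> X" "\<And>c x. x \<in> X \<Longrightarrow> c *\<^sub>C x \<in> X"
    "\<And>x. x \<in> X \<Longrightarrow> - x \<in> X" "\<And>x y. x \<in> X \<Longrightarrow> y \<in> X \<Longrightarrow> x - y \<in> X"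
    "\<And>f J. (\<And>k. k \<in> J \<Longrightarrow> f k \<in> X) \<Longrightarrow> sum f J \<in> X"
proof -
  show *: "closed X" "0 \<in> X" "\<And>x y. x \<in> X \<Longrightarrow> y \<in> X \<Longrightarrow> x + y \<in> X" "\<And>c x. x \<in> X \<Longrightarrow> c *\<^sub>C x \<in> X"
    using assms unfolding closed_csubspace_def by auto
  show m: "\<And>x. x \<in> X \<Longrightarrow> - x \<in> X" using *(4)[of _ "-1"] by (simp add: scaleC_minus1)
  show "\<And>x y. x \<in> X \<Longrightarrow> y \<in> X \<Longrightarrow> x - y \<in> X" using *(3)[OF _ m] by (metis diff_conv_add_uminus)
  show "sum f J \<in> X" if "\<And>k. k \<in> J \<Longrightarrow> f k \<in> X" for f and J :: "'b set"
    using that by (induction J rule: infinite_finite_induct) (auto intro: *)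
qed

lemma bounded_clinear_onD:
  assumes "closed_csubspace X" "bounded_clinear_on X B"
  shows "\<And>x. x \<in> X \<Longrightarrow> B x \<in> X" "\<And>x y. x \<in> X \<Longrightarrow> y \<in> X \<Longrightarrow> B (x + y) = B x + B y"
    "\<And>c x. x \<in> X \<Longrightarrow> B (c *\<^sub>C x) = c *\<^sub>C B x" "B 0 = 0"
    "\<And>x y. x \<in> X \<Longrightarrow> y \<in> X \<Longrightarrow> B (x - y) = B x - B y"
    "\<And>f J. (\<And>k. k \<in> J \<Longrightarrow> f k \<in> X) \<Longrightarrow> B (sum f J) = (\<Sum>k\<in>J. B (f k))"
    "continuous_on X B"
proof -
  note X = closed_csubspaceD[OF assms(1)]
  show *: "\<And>x. x \<in> X \<Longrightarrow> B x \<in> X" "\<And>x y. x \<in> X \<Longrightarrow> y \<in> X \<Longrightarrow> B (x + y) = B x + B y"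
    "\<And>c x. x \<in> X \<Longrightarrow> B (c *\<^sub>C x) = c *\<^sub>C B x"
    using assms(2) unfolding bounded_clinear_on_def by auto
  show z: "B 0 = 0" using *(3)[of 0 0] X(2) by simp
  show d: "B (x - y) = B x - B y" if "x \<in> X" "y \<in> X" for x y
    using *(2)[of "x - y" y] that X(6)[of x y] by simp
  show "B (sum f J) = (\<Sum>k\<in>J. B (f k))" if "\<And>k. k \<in> J \<Longrightarrow> f k \<in> X" for f and J :: "'b set"
    using that by (induction J rule: infinite_finite_induct) (auto simp: z *(2) X(7))
  obtain K where K: "\<And>x. x \<in> X \<Longrightarrow> norm (B x) \<le> K * norm x"
    using assms(2) unfolding bounded_clinear_on_def by metis
  have "\<bar>K\<bar>-lipschitz_on X B"
  proof (rule lipschitz_onI)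
    fix x y assume "x \<in> X" "y \<in> X"
    then have "norm (B x - B y) \<le> K * norm (x - y)" using K[of "x - y"] X(6) d by simp
    also have "\<dots> \<le> \<bar>K\<bar> * norm (x - y)" by (intro mult_right_mono) auto
    finally show "dist (B x) (B y) \<le> \<bar>K\<bar> * dist x y" by (simp add: dist_norm)
  qed simp
  then show "continuous_on X B" by (rule lipschitz_on_continuous_on)
qed

section \<open>Measurability and vector integrals without separability\<close>

text \<open>In a non-separable space the difference of two Borel functions may fail to be Borel.
  Here \<open>s\<close> has finitely many values, and on each of its level sets the difference is
  \<open>f\<close> followed by a translation.\<close>

lemma borel_measurable_diff_simple_function:
  fixes f :: "'m \<Rightarrow> 'a::real_normed_vector"
  assumes "f \<in> borel_measurable M" "simple_function M s"
  shows "(\<lambda>u. f u - s u) \<in> borel_measurable M"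
proof (rule measurable_compose_countable'[of "s ` space M" "\<lambda>y u. f u - y"])
  show "(\<lambda>u. f u - y) \<in> borel_measurable M" for y
  proof -
    have "(\<lambda>x::'a. x - y) \<in> borel_measurable borel"
      by (intro borel_measurable_continuous_onI continuous_intros)
    then show ?thesis using assms(1) by (rule measurable_compose_rev)
  qed
  show "s \<in> M \<rightarrow>\<^sub>M count_space (s ` space M)"
    using assms(2) by (subst measurable_count_space_eq2) (auto simp: simple_function_def)
qed (use assms(2) in \<open>auto simp: simple_function_def countable_finite\<close>)

text \<open>Pairing with a fixed w maps the simple functions that approximate a vector integral to
  those of a scalar one, and by Cauchy-Schwarz the L1 error grows at most by the factor
  \<open>norm w\<close>. This gives access to Fubini, substitution and uniqueness for scalar
  integrals.\<close>

lemma has_vector_integral_cinner: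
  assumes "has_vector_integral M f v"
  shows "has_bochner_integral M (\<lambda>u. cinner (f u) w) (cinner v w)"
proof -
  from assms obtain g where f: "f \<in> borel_measurable M"
    and g: "\<And>i. Bochner_Integration.simple_bochner_integrable M (g i)"
    and lim: "(\<lambda>i. \<integral>\<^sup>+u. ennreal (norm (f u - g i u)) \<partial>M) \<longlonglongrightarrow> 0"
    and v: "(\<lambda>i. Bochner_Integration.simple_bochner_integral M (g i)) \<longlonglongrightarrow> v"
    unfolding has_vector_integral_def by auto
  interpret T: bounded_linear "\<lambda>x. cinner x w" by (rule bounded_linear_cinner_left)
  have sf: "simple_function M (g i)" for i using g[of i] by (rule simple_bochner_integrable.cases)
  have m: "(\<lambda>u. norm (f u - g i u)) \<in> borel_measurable M" for i
    by (rule measurable_compose[OF borel_measurable_diff_simple_function[OF f sf]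
          borel_measurable_continuous_onI[OF continuous_on_norm_id]])
  have cs: "cmod (cinner x w) \<le> norm w * norm x" for x
    using cinner_Cauchy_Schwarz[of x w] by (simp add: mult.commute)
  show ?thesis
  proof (rule has_bochner_integral.intros)
    have "(\<lambda>x. cinner x w) \<in> borel_measurable borel"
      by (intro borel_measurable_continuous_onI T.continuous_on continuous_on_id)
    then show "(\<lambda>u. cinner (f u) w) \<in> borel_measurable M"
      by (rule measurable_compose[OF f])
    show "Bochner_Integration.simple_bochner_integrable M (\<lambda>u. cinner (g i u) w)" for i
      using g[of i] by (intro simple_bochner_integrable_compose2[where p = "\<lambda>x y. cinner x w"]) auto
    have "(\<lambda>i. Bochner_Integration.simple_bochner_integral M (\<lambda>u. cinner (g i u) w)) =
        (\<lambda>i. cinner (Bochner_Integration.simple_bochner_integral M (g i)) w)"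
      by (intro ext simple_bochner_integral_linear T.linear g)
    then show "(\<lambda>i. Bochner_Integration.simple_bochner_integral M (\<lambda>u. cinner (g i u) w)) \<longlonglongrightarrow> cinner v w"
      using T.tendsto[OF v] by simp
    show "(\<lambda>i. \<integral>\<^sup>+u. ennreal (norm (cinner (f u) w - cinner (g i u) w)) \<partial>M) \<longlonglongrightarrow> 0"
    proof (rule tendsto_sandwich[of "\<lambda>_. 0"])
      show "\<forall>\<^sub>F i in sequentially. (\<integral>\<^sup>+u. ennreal (norm (cinner (f u) w - cinner (g i u) w)) \<partial>M)
          \<le> norm w * (\<integral>\<^sup>+u. ennreal (norm (f u - g i u)) \<partial>M)"
      proof (intro always_eventually allI)
        fix i
        have "(\<integral>\<^sup>+u. ennreal (norm (cinner (f u) w - cinner (g i u) w)) \<partial>M) \<le>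
            (\<integral>\<^sup>+u. ennreal (norm w) * ennreal (norm (f u - g i u)) \<partial>M)"
          by (intro nn_integral_mono)
             (auto simp: cs simp flip: ennreal_mult cinner_diff_left)
        also have "\<dots> = norm w * (\<integral>\<^sup>+u. ennreal (norm (f u - g i u)) \<partial>M)"
          using m[of i] by (intro nn_integral_cmult) auto
        finally show "(\<integral>\<^sup>+u. ennreal (norm (cinner (f u) w - cinner (g i u) w)) \<partial>M)
          \<le> norm w * (\<integral>\<^sup>+u. ennreal (norm (f u - g i u)) \<partial>M)" .
      qed
      show "(\<lambda>i. norm w * (\<integral>\<^sup>+u. ennreal (norm (f u - g i u)) \<partial>M)) \<longlonglongrightarrow> 0"
        using ennreal_tendsto_cmult[OF _ lim] by simp
    qed auto
  qed
qed

lemma cinner_eqI: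
  assumes "\<And>w. cinner x w = cinner y w"
  shows "x = (y::'a::complex_hilbert)"
proof -
  have "complex_of_real ((norm (x - y))\<^sup>2) = 0"
    unfolding cinner_self[symmetric] using assms by (simp add: cinner_diff_left)
  then have "(norm (x - y))\<^sup>2 = 0" by (simp only: of_real_eq_0_iff)
  then show ?thesis by simp
qed

text \<open>Scalar integrals are unique, and the pairings with all w determine a vector.\<close>

lemma has_vector_integral_unique:
  assumes "has_vector_integral M f v" "has_vector_integral M f v'"
  shows "v = v'"
  using has_vector_integral_cinner[OF assms(1)] has_vector_integral_cinner[OF assms(2)]
  by (intro cinner_eqI has_bochner_integral_eq)

text \<open>The approximating sums use the same nodes and weights for all orbits, so that bounded
  operators pass through the integral.\<close>

lemma orbit_integral_approximation:
  fixes h :: "real \<Rightarrow> complex"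
  assumes "bounded_borel_measure (\<mu>, h)"
  obtains J :: "nat \<Rightarrow> (complex \<times> int) set" and c :: "nat \<Rightarrow> complex \<times> int \<Rightarrow> complex"
    and t :: "nat \<Rightarrow> complex \<times> int \<Rightarrow> real"
  where "\<And>i k. k \<in> J i \<Longrightarrow> t i k \<ge> 0"
    "\<forall>(g :: real \<Rightarrow> 'a::complex_hilbert) K. continuous_on {0..} g \<and> (\<forall>u\<ge>0. norm (g u) \<le> K) \<longrightarrow>
       (\<exists>v. has_vector_integral \<mu> (\<lambda>u. if u < 0 then 0 else h u *\<^sub>C g u) v \<and>
         (\<lambda>i. \<Sum>k\<in>J i. c i k *\<^sub>C g (t i k)) \<longlonglongrightarrow> v)"
proof -
  from assms have fin: "finite_measure \<mu>" and sets [measurable_cong]: "sets \<mu> = sets borel"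
    and int: "integrable \<mu> h"
    unfolding bounded_borel_measure_def by auto
  interpret finite_measure \<mu> by (rule fin)
  have sp [simp]: "space \<mu> = UNIV" using sets_eq_imp_space_eq[OF sets] by simp
  have hm [measurable]: "h \<in> borel_measurable \<mu>" using int by simp
  from borel_measurable_implies_sequence_metric[OF hm, of 0]
  obtain s where s: "\<And>i. simple_function \<mu> (s i)" "\<And>u. (\<lambda>i. s i u) \<longlonglongrightarrow> h u"
      "\<And>i u. cmod (s i u) \<le> 2 * cmod (h u)"
    by auto
  \<comment> \<open>Index of the grid point of mesh 1/(i+1) at or just below u; clipping u to [0,i]
    leaves finitely many indices.\<close>
  define m where "m i u = \<lfloor>(real i + 1) * min (max u 0) (real i)\<rfloor>" for i and u :: real
  define \<tau> where "\<tau> i k = real_of_int (snd k) / (real i + 1)" for i and k :: "complex \<times> int"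
  \<comment> \<open>Cut off outside [0,i), where the clipped grid index no longer approximates
    u.\<close>
  define a where "a i u = (if 0 \<le> u \<and> u < real i then s i u else 0)" for i u
  \<comment> \<open>The integrand with h replaced by a simple function and the argument of g rounded
    down to the grid. It depends on u only through the pair (a i u, m i u), whose finitely many
    values make up \<open>J\<close> and do not involve g.\<close>
  define G where "G i g u = a i u *\<^sub>C g (\<tau> i (a i u, m i u))" for i and g :: "real \<Rightarrow> 'a" and u
  have am: "simple_function \<mu> (\<lambda>u. (a i u, m i u))" for i
  proof -
    have "m i \<in> measurable \<mu> (count_space UNIV)" unfolding m_def by measurable
    moreover have "m i u \<in> {0..\<lfloor>(real i + 1) * real i\<rfloor>}" for u
      unfolding m_def by (auto intro!: floor_mono mult_left_mono)
    then have "finite (range (m i))"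
      by (intro finite_subset[of "range (m i)" "{0..\<lfloor>(real i + 1) * real i\<rfloor>}"]) auto
    ultimately have 1: "simple_function \<mu> (m i)" by (simp add: simple_function_eq_measurable)
    have "simple_function \<mu> (\<lambda>u. if u \<in> {0..<real i} then s i u else 0)"
      by (rule simple_function_If_set) (use s(1) in \<open>auto simp: sets\<close>)
    then have 2: "simple_function \<mu> (a i)" by (simp add: a_def[abs_def])
    from 1 2 show ?thesis by (intro simple_function_Pair)
  qed
  have sfG: "simple_function \<mu> (G i g)" for i g
    unfolding G_def by (rule simple_function_compose1[OF am, of "\<lambda>k. fst k *\<^sub>C g (\<tau> i k)", simplified])
  have G: "Bochner_Integration.simple_bochner_integrable \<mu> (G i g)" for i g
    by (rule simple_bochner_integrable.intros[OF sfG]) (simp add: emeasure_eq_measure)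
  define J where "J i = (\<lambda>u. (a i u, m i u)) ` space \<mu>" for i
  define c where "c i k = of_real (measure \<mu> {u \<in> space \<mu>. (a i u, m i u) = k}) * fst k" for i k
  have sG: "Bochner_Integration.simple_bochner_integral \<mu> (G i g) = (\<Sum>k\<in>J i. c i k *\<^sub>C g (\<tau> i k))" for i g
    unfolding J_def c_def scaleC_scaleC[symmetric] scaleR_scaleC[symmetric]
    by (rule simple_bochner_integral_partition[OF G am]) (auto simp: G_def)
  have "\<exists>v. has_vector_integral \<mu> (\<lambda>u. if u < 0 then 0 else h u *\<^sub>C g u) v \<and>
         (\<lambda>i. \<Sum>k\<in>J i. c i k *\<^sub>C g (\<tau> i k)) \<longlonglongrightarrow> v"
    if g: "continuous_on {0..} g" and K: "\<And>u. u \<ge> 0 \<Longrightarrow> norm (g u) \<le> K" for g :: "real \<Rightarrow> 'a" and K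
  proof -
    have K0: "K \<ge> 0" using K[of 0] norm_ge_zero order_trans by blast
    define f where "f u = (if u < 0 then 0 else h u *\<^sub>C g u)" for u
    have lim: "(\<lambda>i. G i g u) \<longlonglongrightarrow> f u" for u
    proof (cases "u < 0")
      case True
      then show ?thesis by (simp add: G_def a_def f_def)
    next
      case False
      then have u: "u \<ge> 0" by simp
      have "(\<lambda>i. real_of_int \<lfloor>(real i + 1) * u\<rfloor> / (real i + 1)) \<longlonglongrightarrow> u"
      proof (rule tendsto_sandwich[of "\<lambda>i. u - 1 / (real i + 1)" _ _ "\<lambda>i. u"])
        have "(\<lambda>i. 1 / (real i + 1)) \<longlonglongrightarrow> 0" by real_asymp
        from tendsto_diff[OF tendsto_const[of u] this]
        show "(\<lambda>i. u - 1 / (real i + 1)) \<longlonglongrightarrow> u" by simp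
        show "\<forall>\<^sub>F i in sequentially. u - 1 / (real i + 1) \<le> real_of_int \<lfloor>(real i + 1) * u\<rfloor> / (real i + 1)"
        proof (intro always_eventually allI)
          fix i show "u - 1 / (real i + 1) \<le> real_of_int \<lfloor>(real i + 1) * u\<rfloor> / (real i + 1)"
          proof -
            have "u - 1 / (real i + 1) = ((real i + 1) * u - 1) / (real i + 1)"
              by (simp add: field_simps)
            also have "\<dots> \<le> real_of_int \<lfloor>(real i + 1) * u\<rfloor> / (real i + 1)"
              using real_of_int_floor_gt_diff_one[of "(real i + 1) * u"] by (intro divide_right_mono) auto
            finally show ?thesis .
          qed
        qed
        show "\<forall>\<^sub>F i in sequentially. real_of_int \<lfloor>(real i + 1) * u\<rfloor> / (real i + 1) \<le> u"
        proof (intro always_eventually allI)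
          fix i show "real_of_int \<lfloor>(real i + 1) * u\<rfloor> / (real i + 1) \<le> u"
            using of_int_floor_le[of "(real i + 1) * u"] by (simp add: field_simps)
        qed
      qed simp
      then have "(\<lambda>i. g (real_of_int \<lfloor>(real i + 1) * u\<rfloor> / (real i + 1))) \<longlonglongrightarrow> g u"
        using u by (intro continuous_on_tendsto_compose[OF g]) auto
      from tendsto_scaleC[OF s(2)[of u] this]
      have "(\<lambda>i. s i u *\<^sub>C g (real_of_int \<lfloor>(real i + 1) * u\<rfloor> / (real i + 1))) \<longlonglongrightarrow> f u"
        using False by (simp add: f_def)
      moreover have "\<forall>\<^sub>F i in sequentially. real i > u"
        using eventually_gt_at_top filterlim_real_sequentially unfolding filterlim_at_top_dense by blast
      then have "\<forall>\<^sub>F i in sequentially. s i u *\<^sub>C g (real_of_int \<lfloor>(real i + 1) * u\<rfloor> / (real i + 1)) = G i g u"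
        by eventually_elim (use u in \<open>simp add: G_def a_def \<tau>_def m_def\<close>)
      ultimately show ?thesis by (rule Lim_transform_eventually)
    qed
    have nG: "norm (G i g u) \<le> 2 * K * cmod (h u)" for i u
    proof -
      have "norm (G i g u) = cmod (a i u) * norm (g (\<tau> i (a i u, m i u)))" by (simp add: G_def)
      also have "\<dots> \<le> (2 * cmod (h u)) * K"
        using s(3) K0 by (intro mult_mono K) (auto simp: a_def \<tau>_def m_def)
      finally show ?thesis by (simp add: mult_ac)
    qed
    have nf: "norm (f u) \<le> K * cmod (h u)" for u
      using K[of u] K0 by (auto simp: f_def mult.commute intro!: mult_right_mono)
    have fm: "f \<in> borel_measurable \<mu>"
      by (rule borel_measurable_LIMSEQ_metric[of "\<lambda>i. G i g", OF borel_measurable_simple_function[OF sfG] lim])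
    have mfG: "(\<lambda>u. norm (f u - G i g u)) \<in> borel_measurable \<mu>" for i
      by (rule measurable_compose[OF borel_measurable_diff_simple_function[OF fm sfG]
          borel_measurable_continuous_onI[OF continuous_on_norm_id]])
    have mfG': "(\<lambda>u. ennreal (norm (f u - G i g u))) \<in> borel_measurable \<mu>" for i
      by (rule measurable_compose[OF mfG measurable_ennreal])
    have e: "(\<lambda>i. \<integral>\<^sup>+u. ennreal (norm (f u - G i g u)) \<partial>\<mu>) \<longlonglongrightarrow> (\<integral>\<^sup>+u. 0 \<partial>\<mu>)"
    proof (rule nn_integral_dominated_convergence[of _ _ _ "\<lambda>u. ennreal (3 * K * cmod (h u))"])
      show "AE u in \<mu>. ennreal (norm (f u - G i g u)) \<le> ennreal (3 * K * cmod (h u))" for i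
      proof (intro AE_I2 ennreal_leI)
        fix u
        have "norm (f u - G i g u) \<le> norm (f u) + norm (G i g u)" by (rule norm_triangle_ineq4)
        also have "\<dots> \<le> K * cmod (h u) + 2 * K * cmod (h u)" by (intro add_mono nf nG)
        finally show "norm (f u - G i g u) \<le> 3 * K * cmod (h u)" by simp
      qed
      have "integrable \<mu> (\<lambda>u. 3 * K * cmod (h u))" using int by auto
      then show "(\<integral>\<^sup>+u. ennreal (3 * K * cmod (h u)) \<partial>\<mu>) < \<infinity>"
        by (subst nn_integral_eq_integral) (use K0 in auto)
      show "AE u in \<mu>. (\<lambda>i. ennreal (norm (f u - G i g u))) \<longlonglongrightarrow> 0"
      proof (intro AE_I2)
        fix u
        have "(\<lambda>i. f u - G i g u) \<longlonglongrightarrow> 0" using tendsto_diff[OF tendsto_const lim[of u], of "f u"] by simp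
        from tendsto_ennrealI[OF tendsto_norm[OF this]]
        show "(\<lambda>i. ennreal (norm (f u - G i g u))) \<longlonglongrightarrow> 0" by simp
      qed
      show "(\<lambda>u. ennreal (3 * K * cmod (h u))) \<in> borel_measurable \<mu>" by measurable
    qed (simp_all only: mfG' borel_measurable_const)
    define e where "e i = (\<integral>\<^sup>+u. ennreal (norm (f u - G i g u)) \<partial>\<mu>)" for i
    have e0: "e \<longlonglongrightarrow> 0" using e unfolding e_def by simp
    have dist: "ennreal (norm (Bochner_Integration.simple_bochner_integral \<mu> (G i g) - Bochner_Integration.simple_bochner_integral \<mu> (G j g))) \<le> e i + e j"
      for i j
    proof -
      have "ennreal (norm (Bochner_Integration.simple_bochner_integral \<mu> (G i g) - Bochner_Integration.simple_bochner_integral \<mu> (G j g))) =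
          norm (Bochner_Integration.simple_bochner_integral \<mu> (\<lambda>u. G i g u - G j g u))"
        by (subst simple_bochner_integral_diff[OF G G]) simp
      also have "\<dots> \<le> ennreal (Bochner_Integration.simple_bochner_integral \<mu> (\<lambda>u. norm (G i g u - G j g u)))"
        by (intro ennreal_leI simple_bochner_integral_norm_bound
              simple_bochner_integrable_compose2[where p = "\<lambda>x y. x - y"] G) simp
      also have "\<dots> = (\<integral>\<^sup>+u. norm (G i g u - G j g u) \<partial>\<mu>)"
        using simple_bochner_integrable_compose2[of "\<lambda>x y. norm (x - y)", OF _ G G]
        by (intro simple_bochner_integral_eq_nn_integral) auto
      also have "\<dots> \<le> (\<integral>\<^sup>+u. ennreal (norm (f u - G i g u)) + ennreal (norm (f u - G j g u)) \<partial>\<mu>)"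
      proof (intro nn_integral_mono)
        fix u
        have "norm (G i g u - G j g u) \<le> norm (f u - G i g u) + norm (f u - G j g u)"
          by (metis dual_order.refl norm_diff_triangle_le norm_minus_commute)
        then show "ennreal (norm (G i g u - G j g u)) \<le> ennreal (norm (f u - G i g u)) + ennreal (norm (f u - G j g u))"
          by (simp flip: ennreal_plus)
      qed
      also have "\<dots> = e i + e j" unfolding e_def by (rule nn_integral_add[OF mfG' mfG'])
      finally show ?thesis .
    qed
    \<comment> \<open>The L1 errors \<open>e\<close> bound the distance between two approximating
      integrals, so completeness of the space supplies the limit.\<close>
    have "Cauchy (\<lambda>i. Bochner_Integration.simple_bochner_integral \<mu> (G i g))"
    proof (rule metric_CauchyI)
      fix \<epsilon> :: real assume "\<epsilon> > 0"
      then have "ennreal (\<epsilon> / 2) > 0" by simp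
      with e0 have "\<forall>\<^sub>F i in sequentially. e i < ennreal (\<epsilon> / 2)" by (rule order_tendstoD)
      then obtain N where N: "\<And>i. i \<ge> N \<Longrightarrow> e i < ennreal (\<epsilon> / 2)" unfolding eventually_sequentially by auto
      show "\<exists>M. \<forall>i\<ge>M. \<forall>j\<ge>M. dist (Bochner_Integration.simple_bochner_integral \<mu> (G i g)) (Bochner_Integration.simple_bochner_integral \<mu> (G j g)) < \<epsilon>"
      proof (intro exI allI impI)
        fix i j assume "i \<ge> N" "j \<ge> N"
        then have "e i + e j < ennreal (\<epsilon> / 2) + ennreal (\<epsilon> / 2)" by (intro add_strict_mono N)
        also have "\<dots> = ennreal \<epsilon>" using \<open>\<epsilon> > 0\<close> by (simp flip: ennreal_plus)
        finally have "ennreal (norm (Bochner_Integration.simple_bochner_integral \<mu> (G i g) - Bochner_Integration.simple_bochner_integral \<mu> (G j g))) < ennreal \<epsilon>"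
          using dist[of i j] by (rule order_le_less_trans[rotated])
        then show "dist (Bochner_Integration.simple_bochner_integral \<mu> (G i g)) (Bochner_Integration.simple_bochner_integral \<mu> (G j g)) < \<epsilon>"
          by (simp add: dist_norm ennreal_less_iff)
      qed
    qed
    then obtain v where v: "(\<lambda>i. Bochner_Integration.simple_bochner_integral \<mu> (G i g)) \<longlonglongrightarrow> v"
      using Cauchy_convergent unfolding convergent_def by blast
    have "has_vector_integral \<mu> f v"
      unfolding has_vector_integral_def using fm G e v by (intro conjI exI[of _ "\<lambda>i. G i g"]) auto
    with v show ?thesis by (auto simp: f_def[abs_def] sG)
  qed
  moreover have "\<tau> i k \<ge> 0" if "k \<in> J i" for i k
    using that by (auto simp: J_def \<tau>_def m_def)
  ultimately show ?thesis by (intro that[of J \<tau> c]) auto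
qed

section \<open>Orbit integrals\<close>

text \<open>The value of \<open>hille_phillips\<close> with its measure made explicit and the orbit
  replaced by any function g, so that orbits run at speed t, shifted orbits and the integral for the
  resolvent are instances of one object.\<close>

definition orbit_integral :: "real measure \<Rightarrow> (real \<Rightarrow> complex) \<Rightarrow> (real \<Rightarrow> 'a) \<Rightarrow> 'a::complex_hilbert" where
  "orbit_integral \<mu> h g = (THE v. has_vector_integral \<mu> (\<lambda>u. if u < 0 then 0 else h u *\<^sub>C g u) v)"

lemma orbit_integral_eqI:
  "has_vector_integral \<mu> (\<lambda>u. if u < 0 then 0 else h u *\<^sub>C g u) v \<Longrightarrow> orbit_integral \<mu> h g = v"
  unfolding orbit_integral_def by (rule the_equality) (auto intro: has_vector_integral_unique)

context
  fixes \<mu> :: "real measure" and h :: "real \<Rightarrow> complex" and g :: "real \<Rightarrow> 'a::complex_hilbert" and K :: real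
  assumes \<mu>: "bounded_borel_measure (\<mu>, h)"
    and g: "continuous_on {0..} g" "\<And>u. u \<ge> 0 \<Longrightarrow> norm (g u) \<le> K"
begin

lemma orbit_integral_cinner:
  "has_bochner_integral \<mu> (\<lambda>u. if u < 0 then 0 else h u * cinner (g u) w) (cinner (orbit_integral \<mu> h g) w)"
proof -
  obtain v where "has_vector_integral \<mu> (\<lambda>u. if u < 0 then 0 else h u *\<^sub>C g u) v"
    using orbit_integral_approximation[OF \<mu>] g by metis
  from has_vector_integral_cinner[OF this, of w] orbit_integral_eqI[OF this]
  show ?thesis by (simp add: if_distrib[of "\<lambda>x. cinner x w"] cinner_scaleC_left cong: if_cong)
qed

text \<open>The finite sums of \<open>orbit_integral_approximation\<close> lie in X and commute with
  B, which is linear on X only; both properties survive the limit, since X is closed and B is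
  continuous there.\<close>

lemma orbit_integral_bounded_clinear:
  assumes X: "closed_csubspace X" and B: "bounded_clinear_on X B" and gX: "\<And>u. u \<ge> 0 \<Longrightarrow> g u \<in> X"
  shows "orbit_integral \<mu> h g \<in> X" "orbit_integral \<mu> h (\<lambda>u. B (g u)) = B (orbit_integral \<mu> h g)"
proof -
  note X' = closed_csubspaceD[OF X]
  note B' = bounded_clinear_onD[OF X B]
  obtain J :: "nat \<Rightarrow> (complex \<times> int) set" and c t
    where t: "\<And>i k. k \<in> J i \<Longrightarrow> t i k \<ge> 0" and
    approx: "\<forall>(g :: real \<Rightarrow> 'a) K. continuous_on {0..} g \<and> (\<forall>u\<ge>0. norm (g u) \<le> K) \<longrightarrow>
       (\<exists>v. has_vector_integral \<mu> (\<lambda>u. if u < 0 then 0 else h u *\<^sub>C g u) v \<and>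
         (\<lambda>i. \<Sum>k\<in>J i. c i k *\<^sub>C g (t i k)) \<longlonglongrightarrow> v)"
    by (rule orbit_integral_approximation[OF \<mu>, where 'a = 'a]) (rule that, assumption+)
  have *: "(\<lambda>i. \<Sum>k\<in>J i. c i k *\<^sub>C g (t i k)) \<longlonglongrightarrow> orbit_integral \<mu> h g"
    if "continuous_on {0..} g" "\<And>u. u \<ge> 0 \<Longrightarrow> norm (g u) \<le> K" for g :: "real \<Rightarrow> 'a" and K
    using approx that orbit_integral_eqI by blast
  have lim: "(\<lambda>i. \<Sum>k\<in>J i. c i k *\<^sub>C g (t i k)) \<longlonglongrightarrow> orbit_integral \<mu> h g"
    using *[OF g] .
  have inX: "(\<Sum>k\<in>J i. c i k *\<^sub>C g (t i k)) \<in> X" for i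
    by (intro X' gX t)
  show V: "orbit_integral \<mu> h g \<in> X"
    by (rule closed_sequentially[OF X'(1) _ lim]) (rule inX)
  obtain L where L: "\<And>x. x \<in> X \<Longrightarrow> norm (B x) \<le> L * norm x"
    using B unfolding bounded_clinear_on_def by metis
  have "continuous_on {0..} (\<lambda>u. B (g u))"
    by (rule continuous_on_compose2[OF B'(7) g(1)]) (use gX in auto)
  moreover have "norm (B (g u)) \<le> \<bar>L\<bar> * K" if "u \<ge> 0" for u
  proof -
    have "norm (B (g u)) \<le> L * norm (g u)" using L[OF gX[OF that]] .
    also have "\<dots> \<le> \<bar>L\<bar> * norm (g u)" by (intro mult_right_mono) auto
    also have "\<dots> \<le> \<bar>L\<bar> * K" using g(2)[OF that] by (intro mult_left_mono) auto
    finally show ?thesis .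
  qed
  ultimately have "(\<lambda>i. \<Sum>k\<in>J i. c i k *\<^sub>C B (g (t i k))) \<longlonglongrightarrow> orbit_integral \<mu> h (\<lambda>u. B (g u))"
    by (rule *)
  moreover have "(\<Sum>k\<in>J i. c i k *\<^sub>C B (g (t i k))) = B (\<Sum>k\<in>J i. c i k *\<^sub>C g (t i k))" for i
    by (subst B'(6)) (auto intro!: X' gX t sum.cong simp: B'(3) gX t)
  moreover have "(\<lambda>i. B (\<Sum>k\<in>J i. c i k *\<^sub>C g (t i k))) \<longlonglongrightarrow> B (orbit_integral \<mu> h g)"
    by (rule continuous_on_tendsto_compose[OF B'(7) lim V]) (simp add: inX)
  ultimately show "orbit_integral \<mu> h (\<lambda>u. B (g u)) = B (orbit_integral \<mu> h g)"
    using LIMSEQ_unique by simp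
qed

end

section \<open>Spectral inclusion for bounded semigroups\<close>

lemma bounded_borel_measure_AE_nonneg:
  assumes "bounded_borel_measure (\<mu>, h)"
  shows "AE u in \<mu>. u \<ge> 0"
proof (rule AE_I[of _ _ "{..<0}"])
  show "{u \<in> space \<mu>. \<not> 0 \<le> u} \<subseteq> {..<0}" by auto
qed (use assms in \<open>auto simp: bounded_borel_measure_def\<close>)

text \<open>A norm estimate drawn from scalar integrals alone: pair the difference v with itself, so
  that the square of \<open>norm v\<close> becomes an integral bounded by a multiple of
  \<open>norm v\<close>. With e = 0 it bounds the operator; with e an oscillating exponential it
  measures how far the operator is from multiplication by a number.\<close>

lemma orbit_integral_diff_bound:
  fixes g :: "real \<Rightarrow> 'a::complex_hilbert"
  assumes \<mu>: "bounded_borel_measure (\<mu>, h)"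
    and g: "continuous_on {0..} g" "\<And>u. u \<ge> 0 \<Longrightarrow> norm (g u) \<le> K"
    and he: "integrable \<mu> (\<lambda>u. h u * e u)"
    and k: "integrable \<mu> (\<lambda>u. cmod (h u) * k u)" "\<And>u. u \<ge> 0 \<Longrightarrow> norm (g u - e u *\<^sub>C x) \<le> k u"
  shows "norm (orbit_integral \<mu> h g - (\<integral>u. h u * e u \<partial>\<mu>) *\<^sub>C x) \<le> (\<integral>u. cmod (h u) * k u \<partial>\<mu>)"
proof -
  define v where "v = orbit_integral \<mu> h g - (\<integral>u. h u * e u \<partial>\<mu>) *\<^sub>C x"
  let ?I = "\<integral>u. cmod (h u) * k u \<partial>\<mu>"
  have hb: "has_bochner_integral \<mu> (\<lambda>u. (if u < 0 then 0 else h u * cinner (g u) v) - h u * e u * cinner x v)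
      (cinner (orbit_integral \<mu> h g) v - (\<integral>u. h u * e u \<partial>\<mu>) * cinner x v)"
    using has_bochner_integral_integrable[OF he]
    by (intro has_bochner_integral_diff orbit_integral_cinner[OF \<mu> g] has_bochner_integral_mult_left) auto
  have "cinner v v = cinner (orbit_integral \<mu> h g) v - (\<integral>u. h u * e u \<partial>\<mu>) * cinner x v"
    unfolding v_def by (simp add: cinner_diff_left cinner_scaleC_left)
  also have "\<dots> = (\<integral>u. (if u < 0 then 0 else h u * cinner (g u) v) - h u * e u * cinner x v \<partial>\<mu>)"
    using has_bochner_integral_integral_eq[OF hb] by simp
  also have "cmod \<dots> \<le> (\<integral>u. cmod (h u) * k u * norm v \<partial>\<mu>)"
  proof (rule order_trans[OF integral_norm_bound integral_mono_AE])
    show "integrable \<mu> (\<lambda>u. cmod (h u) * k u * norm v)" using k(1) by simp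
    show "integrable \<mu> (\<lambda>u. cmod ((if u < 0 then 0 else h u * cinner (g u) v) - h u * e u * cinner x v))"
      using hb by (intro integrable_norm integrable.intros)
    show "AE u in \<mu>. cmod ((if u < 0 then 0 else h u * cinner (g u) v) - h u * e u * cinner x v)
        \<le> cmod (h u) * k u * norm v"
      using bounded_borel_measure_AE_nonneg[OF \<mu>]
    proof eventually_elim
      case (elim u)
      have "(if u < 0 then 0 else h u * cinner (g u) v) - h u * e u * cinner x v =
          h u * cinner (g u - e u *\<^sub>C x) v"
        using elim by (simp add: cinner_diff_left cinner_scaleC_left algebra_simps)
      also have "cmod \<dots> \<le> cmod (h u) * (norm (g u - e u *\<^sub>C x) * norm v)"
        unfolding norm_mult by (intro mult_left_mono cinner_Cauchy_Schwarz) simp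
      also have "\<dots> \<le> cmod (h u) * (k u * norm v)"
        using k(2)[OF elim] by (intro mult_left_mono mult_right_mono) auto
      finally show ?case by (simp add: mult_ac)
    qed
  qed
  also have "\<dots> = ?I * norm v" by simp
  finally have "(norm v)\<^sup>2 \<le> ?I * norm v" by (simp add: cinner_self norm_power)
  moreover have "?I \<ge> 0"
  proof (rule integral_nonneg_AE)
    show "AE u in \<mu>. 0 \<le> cmod (h u) * k u"
      using bounded_borel_measure_AE_nonneg[OF \<mu>]
      by eventually_elim (metis k(2) mult_nonneg_nonneg norm_ge_zero order_trans)
  qed
  ultimately have "norm v \<le> ?I" by (cases "norm v = 0") (auto simp: power2_eq_square)
  then show ?thesis by (simp add: v_def)
qed

lemma orbit_integral_cong:
  "(\<And>u. u \<ge> 0 \<Longrightarrow> g u = g' u) \<Longrightarrow> orbit_integral \<mu> h g = orbit_integral \<mu> h g'"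
proof -
  assume "\<And>u. u \<ge> 0 \<Longrightarrow> g u = g' u"
  then have "(\<lambda>u. if u < 0 then 0 else h u *\<^sub>C g u) = (\<lambda>u. if u < 0 then 0 else h u *\<^sub>C g' u)" by auto
  then show ?thesis by (simp add: orbit_integral_def)
qed

lemma has_bochner_integral_exp_minus:
  fixes a c :: real
  assumes a: "a > 0"
  shows "has_bochner_integral lborel (\<lambda>u. indicator {c..} u * exp (- (a * u))) (exp (- (a * c)) / a)"
proof (rule has_bochner_integral_nn_integral)
  have "(\<integral>\<^sup>+u. ennreal (exp (- (a * u))) * indicator {c..} u \<partial>lborel) =
      0 - (- exp (- (a * c)) / a)"
  proof (rule nn_integral_FTC_atLeast)
    show "((\<lambda>u. - exp (- (a * u)) / a) \<longlongrightarrow> 0) at_top" using a by real_asymp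
    show "((\<lambda>u. - exp (- (a * u)) / a) has_real_derivative exp (- (a * u))) (at u)" for u
      using a by (auto intro!: derivative_eq_intros)
  qed auto
  then show "(\<integral>\<^sup>+u. ennreal (indicator {c..} u * exp (- (a * u))) \<partial>lborel) = ennreal (exp (- (a * c)) / a)"
    by (simp add: ennreal_mult' mult.commute ennreal_indicator)
qed (use a in auto)

lemma exp_difference_quotient:
  "((\<lambda>s. (exp (p * of_real s) - 1) / of_real s) \<longlongrightarrow> (p::complex)) (at_right 0)"
proof -
  have "((\<lambda>z. exp (p * z)) has_field_derivative p) (at 0)"
    by (auto intro!: derivative_eq_intros)
  then have "((\<lambda>z. (exp (p * z) - 1) / z) \<longlongrightarrow> p) (at 0)"
    by (simp add: has_field_derivative_iff)
  moreover have "filterlim (\<lambda>s. complex_of_real s) (at 0) (at_right 0)"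
    unfolding filterlim_at
  proof
    show "\<forall>\<^sub>F s in at_right 0. complex_of_real s \<in> UNIV \<and> complex_of_real s \<noteq> 0"
      using eventually_at_right_less[of 0] by eventually_elim simp
  qed (auto intro!: tendsto_eq_intros)
  ultimately show ?thesis by (rule filterlim_compose)
qed

section \<open>Generator, resolvent and approximate eigenvectors\<close>

locale bounded_semigroup =
  fixes X D :: "'a::complex_hilbert set" and A :: "'a \<Rightarrow> 'a" and T :: "real \<Rightarrow> 'a \<Rightarrow> 'a"
  assumes X: "closed_csubspace X" and T: "bounded_C0_semigroup X T" and DA: "neg_generates X D A T"
begin

lemmas Xs = closed_csubspaceD[OF X]

lemma T_clinear: "t \<ge> 0 \<Longrightarrow> bounded_clinear_on X (T t)"
  using T unfolding bounded_C0_semigroup_def by auto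

lemmas Ts = bounded_clinear_onD[OF X T_clinear]

lemma T_0: "x \<in> X \<Longrightarrow> T 0 x = x"
  and T_add: "t \<ge> 0 \<Longrightarrow> u \<ge> 0 \<Longrightarrow> x \<in> X \<Longrightarrow> T (t + u) x = T t (T u x)"
  and T_lim: "x \<in> X \<Longrightarrow> ((\<lambda>t. T t x) \<longlongrightarrow> x) (at_right 0)"
  using T unfolding bounded_C0_semigroup_def by auto

definition M :: real where "M = (SOME M. M \<ge> 0 \<and> (\<forall>t\<ge>0. \<forall>x\<in>X. norm (T t x) \<le> M * norm x))"

lemma M: "M \<ge> 0" "t \<ge> 0 \<Longrightarrow> x \<in> X \<Longrightarrow> norm (T t x) \<le> M * norm x"
proof -
  obtain L where L: "\<forall>t\<ge>0. \<forall>x\<in>X. norm (T t x) \<le> L * norm x"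
    using T unfolding bounded_C0_semigroup_def by auto
  have "\<forall>t\<ge>0. \<forall>x\<in>X. norm (T t x) \<le> \<bar>L\<bar> * norm x"
    using L by (meson abs_ge_self mult_right_mono norm_ge_zero order_trans)
  then have "\<exists>M. M \<ge> 0 \<and> (\<forall>t\<ge>0. \<forall>x\<in>X. norm (T t x) \<le> M * norm x)"
    by (intro exI[of _ "\<bar>L\<bar>"]) auto
  from someI_ex[OF this] show "M \<ge> 0" "t \<ge> 0 \<Longrightarrow> x \<in> X \<Longrightarrow> norm (T t x) \<le> M * norm x"
    unfolding M_def by auto
qed

text \<open>For u \<le> v, T u x - T v x = T u (x - T (v - u) x), and the uniform bound
  \<open>M\<close> turns right continuity at 0 into continuity from both sides at every u.\<close>

lemma orbit_continuous:
  assumes x: "x \<in> X"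
  shows "continuous_on {0..} (\<lambda>u. T u x)"
proof -
  have le: "dist (T u x) (T v x) \<le> M * norm (T (v - u) x - x)" if "0 \<le> u" "u \<le> v" for u v
  proof -
    have "T u x - T v x = T u (x - T (v - u) x)"
      using T_add[of u "v - u" x] Ts(5)[of u x "T (v - u) x"] Ts(1)[of "v - u" x] that x by simp
    then show ?thesis
      using M(2)[of u "x - T (v - u) x"] Ts(1)[of "v - u" x] that x Xs(6)
      by (simp add: dist_norm norm_minus_commute)
  qed
  show ?thesis unfolding continuous_on_iff
  proof (intro ballI allI impI)
    fix u \<epsilon> :: real assume u: "u \<in> {0..}" and \<epsilon>: "\<epsilon> > 0"
    have "((\<lambda>h. M * norm (T h x - x)) \<longlongrightarrow> M * norm (x - x)) (at_right 0)"
      by (intro tendsto_intros T_lim x)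
    then have "\<forall>\<^sub>F h in at_right 0. M * norm (T h x - x) < \<epsilon>"
      using \<epsilon> by (intro order_tendstoD(2)) auto
    then obtain d where d: "d > 0" "\<And>h. 0 < h \<Longrightarrow> h < d \<Longrightarrow> M * norm (T h x - x) < \<epsilon>"
      unfolding eventually_at_right_field by auto
    have d': "M * norm (T h x - x) < \<epsilon>" if "0 \<le> h" "h < d" for h
      using d(2)[of h] that \<epsilon> T_0[OF x] by (cases "h = 0") auto
    show "\<exists>d>0. \<forall>v\<in>{0..}. dist v u < d \<longrightarrow> dist (T v x) (T u x) < \<epsilon>"
    proof (intro exI[of _ d] conjI ballI impI)
      fix v :: real assume v: "v \<in> {0..}" "dist v u < d"
      show "dist (T v x) (T u x) < \<epsilon>"
      proof (cases "u \<le> v")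
        case True
        then show ?thesis using le[of u v] d'[of "v - u"] u v by (simp add: dist_norm norm_minus_commute)
      next
        case False
        then show ?thesis using le[of v u] d'[of "u - v"] u v by (simp add: dist_norm)
      qed
    qed (rule d(1))
  qed
qed

lemma D_sub: "x \<in> D \<Longrightarrow> x \<in> X"
  and A_lim: "x \<in> D \<Longrightarrow> ((\<lambda>h. (T h x - x) /\<^sub>R h) \<longlongrightarrow> - A x) (at_right 0)"
  using DA unfolding neg_generates_def by auto

lemma D_I:
  assumes "x \<in> X" "((\<lambda>h. (T h x - x) /\<^sub>R h) \<longlongrightarrow> - y) (at_right 0)"
  shows "x \<in> D" "A x = y"
proof -
  show x: "x \<in> D" using assms DA unfolding neg_generates_def by auto
  have "- A x = - y" using tendsto_unique[OF _ A_lim[OF x] assms(2)] by simp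
  then show "A x = y" by simp
qed

lemma A_in: "x \<in> D \<Longrightarrow> A x \<in> X"
proof -
  assume x: "x \<in> D"
  have "\<forall>\<^sub>F h in at_right 0. (T h x - x) /\<^sub>R h \<in> X"
    using eventually_at_right_less[of 0]
    by eventually_elim (use x D_sub Ts(1) Xs(4,6) in \<open>auto simp: scaleR_scaleC\<close>)
  then have "- A x \<in> X" by (rule Lim_in_closed_set[OF Xs(1) _ _ A_lim[OF x]]) simp
  from Xs(5)[OF this] show ?thesis by simp
qed

lemma
  assumes "x \<in> D" "y \<in> D"
  shows D_diff: "x - y \<in> D" and A_diff: "A (x - y) = A x - A y"
proof -
  have "((\<lambda>h. (T h x - x) /\<^sub>R h - (T h y - y) /\<^sub>R h) \<longlongrightarrow> - A x - - A y) (at_right 0)"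
    using assms by (intro tendsto_diff A_lim)
  moreover have "\<forall>\<^sub>F h in at_right 0. (T h x - x) /\<^sub>R h - (T h y - y) /\<^sub>R h = (T h (x - y) - (x - y)) /\<^sub>R h"
    using eventually_at_right_less[of 0]
    by eventually_elim (use assms D_sub in \<open>simp add: Ts(5) scaleR_diff_right\<close>)
  ultimately have "((\<lambda>h. (T h (x - y) - (x - y)) /\<^sub>R h) \<longlongrightarrow> - (A x - A y)) (at_right 0)"
    by (simp add: Lim_transform_eventually)
  note D_I[OF Xs(6)[OF D_sub[OF assms(1)] D_sub[OF assms(2)]] this]
  then show "x - y \<in> D" "A (x - y) = A x - A y" .
qed

text \<open>The Laplace transform of the orbit, w = integral of exp(-p u) T(u) b, is the solution.
  Shifting the integral by s shows that w - exp(-p s) T(s) w is its part over [0,s), whose quotient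
  by s tends to b; solving for T(s) w exhibits the right derivative at 0 of the orbit of w.\<close>

lemma resolvent_surj:
  assumes p: "Re p > 0" and b: "b \<in> X"
  obtains w where "w \<in> D" "p *\<^sub>C w + A w = b"
proof -
  \<comment> \<open>exp(-p u) is split into its modulus, the density \<open>dn\<close> of the finite
    measure \<open>\<mu>\<close>, and its phase \<open>h\<close>.\<close>
  define dn where "dn u = indicator {0..} u * exp (- (Re p * u))" for u :: real
  define \<mu> where "\<mu> = density lborel (\<lambda>u. ennreal (dn u))"
  define h where "h u = exp (- (\<i> * of_real (Im p * u)))" for u :: real
  have dn_meas [measurable]: "dn \<in> borel_measurable borel" unfolding dn_def by measurable
  have h_meas: "h \<in> borel_measurable borel"
    unfolding h_def by (intro borel_measurable_continuous_onI continuous_intros)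
  have dn0: "dn u \<ge> 0" for u by (simp add: dn_def)
  have dn_int: "integrable lborel dn"
    using has_bochner_integral_exp_minus[OF p, of 0] unfolding dn_def by (rule integrable.intros)
  have \<mu>: "bounded_borel_measure (\<mu>, h)"
    unfolding bounded_borel_measure_def prod.case
  proof (intro conjI)
    have "emeasure \<mu> (space \<mu>) = (\<integral>\<^sup>+u. ennreal (dn u) \<partial>lborel)"
      by (simp add: \<mu>_def emeasure_density)
    also have "\<dots> = ennreal (\<integral>u. dn u \<partial>lborel)"
      by (rule nn_integral_eq_integral) (use dn_int dn0 in auto)
    finally show fm: "finite_measure \<mu>" by (intro finite_measureI) simp
    show "sets \<mu> = sets borel" by (simp add: \<mu>_def)
    show "emeasure \<mu> {..<0} = 0"
      by (simp add: \<mu>_def emeasure_density nn_integral_0_iff_AE dn_def indicator_def)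
    show "integrable \<mu> h"
      by (rule finite_measure.integrable_const_bound[OF fm, of _ 1]) (use h_meas in \<open>auto simp: \<mu>_def h_def\<close>)
  qed
  define w where "w = orbit_integral \<mu> h (\<lambda>u. T u b)"
  have Tb: "continuous_on {0..} (\<lambda>u. T u b)" "\<And>u. u \<ge> 0 \<Longrightarrow> norm (T u b) \<le> M * norm b"
    using orbit_continuous[OF b] M(2) b by auto
  have TbX: "T u b \<in> X" if "u \<ge> 0" for u using Ts(1) b that by auto
  have wX: "w \<in> X"
    unfolding w_def by (rule orbit_integral_bounded_clinear(1)[OF \<mu> Tb X T_clinear[of 0] TbX]) auto
  define \<phi> where "\<phi> s y u = exp (- (p * of_real u)) * cinner (T (u + s) b) y" for s y u
  \<comment> \<open>T s is moved inside the integral and absorbed into the orbit; the pairing with y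
    is then rewritten over Lebesgue measure, where the shift in \<open>diff\<close> can be carried
    out.\<close>
  have weak: "has_bochner_integral lborel (\<lambda>u. indicator {0..} u *\<^sub>R \<phi> s y u) (cinner (T s w) y)"
    if s: "s \<ge> 0" for s y
  proof -
    have "orbit_integral \<mu> h (\<lambda>u. T (u + s) b) = orbit_integral \<mu> h (\<lambda>u. T s (T u b))"
      by (rule orbit_integral_cong) (use T_add[of s _ b] s b in \<open>simp add: add.commute\<close>)
    also have "\<dots> = T s w"
      unfolding w_def by (rule orbit_integral_bounded_clinear(2)[OF \<mu> Tb X T_clinear TbX]) (use s in auto)
    finally have 1: "orbit_integral \<mu> h (\<lambda>u. T (u + s) b) = T s w" .
    define f where "f u = (if u < 0 then 0 else h u * cinner (T (u + s) b) y)" for u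
    have "continuous_on {0..} (\<lambda>u. T (u + s) b)"
      by (rule continuous_on_compose2[OF Tb(1)]) (use s in \<open>auto intro!: continuous_intros\<close>)
    then have hb: "has_bochner_integral \<mu> f (cinner (T s w) y)"
      unfolding 1[symmetric] f_def by (rule orbit_integral_cinner[OF \<mu>, where K = "M * norm b"]) (simp_all add: Tb(2) s)
    have fm: "f \<in> borel_measurable lborel"
      using borel_measurable_has_bochner_integral[OF hb] by (simp add: \<mu>_def)
    have "integrable lborel (\<lambda>u. dn u *\<^sub>R f u)" "(\<integral>u. dn u *\<^sub>R f u \<partial>lborel) = cinner (T s w) y"
      using hb integrable_density[OF fm, of dn] integral_density[OF fm, of dn] dn0
      unfolding has_bochner_integral_iff \<mu>_def by auto
    moreover have "dn u *\<^sub>R f u = indicator {0..} u *\<^sub>R \<phi> s y u" for u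
    proof -
      have "of_real (exp (- (Re p * u))) * h u = exp (- (p * of_real u))"
        unfolding h_def exp_of_real[symmetric] mult_exp_exp
        by (intro arg_cong[of _ _ exp]) (simp add: complex_eq_iff)
      then show ?thesis
        by (auto simp: f_def dn_def \<phi>_def indicator_def scaleR_conv_of_real simp flip: mult.assoc)
    qed
    ultimately show ?thesis by (simp add: has_bochner_integral_iff)
  qed
  have diff: "has_bochner_integral lborel (\<lambda>u. indicator {0..<s} u *\<^sub>R \<phi> 0 y u)
      (cinner (w - exp (- (p * of_real s)) *\<^sub>C T s w) y)" if s: "s > 0" for s y
  proof -
    have "has_bochner_integral lborel (\<lambda>u. exp (- (p * of_real s)) * (indicator {0..} u *\<^sub>R \<phi> s y u))
        (exp (- (p * of_real s)) * cinner (T s w) y)"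
      using weak[of s y] s by (intro has_bochner_integral_mult_right) auto
    also have "(\<lambda>u. exp (- (p * of_real s)) * (indicator {0..} u *\<^sub>R \<phi> s y u)) =
        (\<lambda>u. indicator {s..} (s + 1 * u) *\<^sub>R \<phi> 0 y (s + 1 * u))"
      by (auto simp: \<phi>_def indicator_def algebra_simps simp flip: exp_add)
    finally have "has_bochner_integral lborel (\<lambda>u. indicator {s..} (s + 1 * u) *\<^sub>R \<phi> 0 y (s + 1 * u))
        (exp (- (p * of_real s)) * cinner (T s w) y /\<^sub>R \<bar>1\<bar>)" by simp
    then have "has_bochner_integral lborel (\<lambda>u. indicator {s..} u *\<^sub>R \<phi> 0 y u)
        (exp (- (p * of_real s)) * cinner (T s w) y)"
      by (subst lborel_has_bochner_integral_real_affine_iff[of 1 _ _ s]) simp_all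
    from has_bochner_integral_diff[OF weak[of 0 y] this] wX
    have "has_bochner_integral lborel (\<lambda>u. indicator {0..} u *\<^sub>R \<phi> 0 y u - indicator {s..} u *\<^sub>R \<phi> 0 y u)
        (cinner (w - exp (- (p * of_real s)) *\<^sub>C T s w) y)"
      by (simp add: T_0 cinner_diff_left cinner_scaleC_left)
    also have "(\<lambda>u. indicator {0..} u *\<^sub>R \<phi> 0 y u - indicator {s..} u *\<^sub>R \<phi> 0 y u) =
        (\<lambda>u. indicator {0..<s} u *\<^sub>R \<phi> 0 y u)"
      using s by (auto simp: indicator_def)
    finally show ?thesis .
  qed
  \<comment> \<open>As in \<open>orbit_integral_diff_bound\<close>, the vector is paired with itself
    and its norm divided out.\<close>
  have est: "norm (w - exp (- (p * of_real s)) *\<^sub>C T s w - s *\<^sub>R b) \<le> \<eta> * s"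
    if s: "s > 0" and \<eta>: "\<And>u. 0 \<le> u \<Longrightarrow> u < s \<Longrightarrow> norm (exp (- (p * of_real u)) *\<^sub>C T u b - b) \<le> \<eta>" for s \<eta>
  proof -
    define v where "v = w - exp (- (p * of_real s)) *\<^sub>C T s w - s *\<^sub>R b"
    have \<eta>0: "\<eta> \<ge> 0" using \<eta>[of 0] s norm_ge_zero order_trans by blast
    have ind: "has_bochner_integral lborel (indicator {0..<s} :: real \<Rightarrow> real) s"
      using has_bochner_integral_real_indicator[of "{0..<s}" lborel] s by simp
    have "has_bochner_integral lborel (\<lambda>u. indicator {0..<s} u *\<^sub>R cinner b v) (s *\<^sub>R cinner b v)"
      using ind by (intro has_bochner_integral_scaleR_left) auto
    note D = has_bochner_integral_diff[OF diff[OF s, of v] this]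
    have v1: "cinner (w - exp (- (p * of_real s)) *\<^sub>C T s w) z - s *\<^sub>R cinner b z = cinner v z" for z
      by (simp add: v_def cinner_diff_left cinner_scaleC_left scaleR_scaleC scaleR_conv_of_real)
    have v2: "indicator {0..<s} u *\<^sub>R \<phi> 0 v u - indicator {0..<s} u *\<^sub>R cinner b v =
        indicator {0..<s} u *\<^sub>R cinner (exp (- (p * of_real u)) *\<^sub>C T u b - b) v" for u :: real
      by (simp add: \<phi>_def cinner_diff_left cinner_scaleC_left scaleR_diff_right)
    have hb: "has_bochner_integral lborel (\<lambda>u. indicator {0..<s} u *\<^sub>R cinner (exp (- (p * of_real u)) *\<^sub>C T u b - b) v)
        (cinner v v)"
      using D unfolding v1 v2 .
    then have int: "integrable lborel (\<lambda>u. indicator {0..<s} u *\<^sub>R cinner (exp (- (p * of_real u)) *\<^sub>C T u b - b) v)"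
      by (rule integrable.intros)
    have "cmod (cinner v v) \<le> (\<integral>u. indicator {0..<s} u * (\<eta> * norm v) \<partial>lborel)"
      unfolding has_bochner_integral_integral_eq[OF hb, symmetric]
    proof (rule order_trans[OF integral_norm_bound integral_mono_AE])
      show "AE u in lborel. norm (indicator {0..<s} u *\<^sub>R cinner (exp (- (p * of_real u)) *\<^sub>C T u b - b) v)
         \<le> indicator {0..<s} u * (\<eta> * norm v)"
      proof (intro AE_I2)
        fix u :: real
        show "norm (indicator {0..<s} u *\<^sub>R cinner (exp (- (p * of_real u)) *\<^sub>C T u b - b) v)
         \<le> indicator {0..<s} u * (\<eta> * norm v)"
        proof (cases "u \<in> {0..<s}")
          case True
          have "cmod (cinner (exp (- (p * of_real u)) *\<^sub>C T u b - b) v) \<le>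
              norm (exp (- (p * of_real u)) *\<^sub>C T u b - b) * norm v" by (rule cinner_Cauchy_Schwarz)
          also have "\<dots> \<le> \<eta> * norm v" using \<eta>[of u] True by (intro mult_right_mono) auto
          finally show ?thesis using True by simp
        qed simp
      qed
      show "integrable lborel (\<lambda>u. indicator {0..<s} u * (\<eta> * norm v))"
        using ind by (intro integrable_mult_left) (auto intro: integrable.intros)
    qed (rule integrable_norm[OF int])
    also have "\<dots> = s * (\<eta> * norm v)"
      using has_bochner_integral_integral_eq[OF ind] by simp
    finally have "(norm v)\<^sup>2 \<le> \<eta> * s * norm v" by (simp add: cinner_self norm_power mult_ac)
    then have "norm v \<le> \<eta> * s" using \<eta>0 s by (cases "norm v = 0") (auto simp: power2_eq_square)
    then show ?thesis by (simp add: v_def)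
  qed
  have G: "((\<lambda>u. exp (- (p * of_real u)) *\<^sub>C T u b) \<longlongrightarrow> exp (- (p * of_real 0)) *\<^sub>C b) (at_right 0)"
    by (intro tendsto_intros T_lim b)
  have L: "((\<lambda>s. (w - exp (- (p * of_real s)) *\<^sub>C T s w) /\<^sub>R s) \<longlongrightarrow> b) (at_right 0)"
  proof (rule tendstoI)
    fix \<epsilon> :: real assume \<epsilon>: "\<epsilon> > 0"
    have "\<forall>\<^sub>F u in at_right 0. dist (exp (- (p * of_real u)) *\<^sub>C T u b) b < \<epsilon> / 2"
      using tendstoD[OF G, of "\<epsilon> / 2"] \<epsilon> by simp
    then obtain d where d: "d > 0" "\<And>u. 0 < u \<Longrightarrow> u < d \<Longrightarrow> norm (exp (- (p * of_real u)) *\<^sub>C T u b - b) < \<epsilon> / 2"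
      unfolding eventually_at_right_field dist_norm by auto
    have "dist ((w - exp (- (p * of_real s)) *\<^sub>C T s w) /\<^sub>R s) b < \<epsilon>" if s: "0 < s" "s < d" for s
    proof -
      have "norm (w - exp (- (p * of_real s)) *\<^sub>C T s w - s *\<^sub>R b) \<le> \<epsilon> / 2 * s"
      proof (rule est[OF s(1)])
        fix u assume "0 \<le> u" "u < s"
        then show "norm (exp (- (p * of_real u)) *\<^sub>C T u b - b) \<le> \<epsilon> / 2"
          using d(2)[of u] s T_0[OF b] \<epsilon> by (cases "u = 0") auto
      qed
      moreover have ns: "norm (x /\<^sub>R s) = norm x / s" for x :: 'a
        using s by (simp add: divide_inverse mult.commute)
      ultimately have "norm ((w - exp (- (p * of_real s)) *\<^sub>C T s w - s *\<^sub>R b) /\<^sub>R s) \<le> \<epsilon> / 2"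
        using s by (simp only: ns pos_divide_le_eq)
      moreover have "(w - exp (- (p * of_real s)) *\<^sub>C T s w - s *\<^sub>R b) /\<^sub>R s =
          (w - exp (- (p * of_real s)) *\<^sub>C T s w) /\<^sub>R s - b"
        using s by (simp add: scaleR_diff_right)
      ultimately show ?thesis using \<epsilon> by (simp add: dist_norm)
    qed
    then show "\<forall>\<^sub>F s in at_right 0. dist ((w - exp (- (p * of_real s)) *\<^sub>C T s w) /\<^sub>R s) b < \<epsilon>"
      unfolding eventually_at_right_field using d(1) by blast
  qed
  \<comment> \<open>This combination equals (T(s) w - w)/s, because exp(p s) (w - exp(-p s) T(s) w)
    = exp(p s) w - T(s) w; both of its terms have known limits, by the derivative of exp and by
    \<open>L\<close>.\<close>
  have "((\<lambda>s. ((exp (p * of_real s) - 1) / of_real s) *\<^sub>C w -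
      exp (p * of_real s) *\<^sub>C ((w - exp (- (p * of_real s)) *\<^sub>C T s w) /\<^sub>R s)) \<longlongrightarrow>
      p *\<^sub>C w - exp (p * of_real 0) *\<^sub>C b) (at_right 0)"
    by (intro tendsto_intros exp_difference_quotient L)
  moreover have "\<forall>\<^sub>F s in at_right 0. ((exp (p * of_real s) - 1) / of_real s) *\<^sub>C w -
      exp (p * of_real s) *\<^sub>C ((w - exp (- (p * of_real s)) *\<^sub>C T s w) /\<^sub>R s) = (T s w - w) /\<^sub>R s"
    using eventually_at_right_less[of 0]
  proof eventually_elim
    case (elim s)
    have "exp (p * of_real s) *\<^sub>C ((w - exp (- (p * of_real s)) *\<^sub>C T s w) /\<^sub>R s) =
        (exp (p * of_real s) / of_real s) *\<^sub>C w - (1 / of_real s) *\<^sub>C T s w"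
      by (simp add: scaleR_scaleC scaleC_scaleC scaleC_diff_right field_simps flip: exp_add)
    moreover have "((exp (p * of_real s) - 1) / of_real s) *\<^sub>C w =
        (exp (p * of_real s) / of_real s) *\<^sub>C w - (1 / of_real s) *\<^sub>C w"
      by (simp add: diff_divide_distrib scaleC_diff_left)
    ultimately show ?case
      by (simp add: scaleR_scaleC scaleC_diff_right divide_inverse)
  qed
  ultimately have "((\<lambda>s. (T s w - w) /\<^sub>R s) \<longlongrightarrow> - (b - p *\<^sub>C w)) (at_right 0)"
    by (simp add: Lim_transform_eventually)
  from D_I[OF wX this] show ?thesis by (intro that[of w]) auto
qed

text \<open>Otherwise iy - A is bounded below. Just to the left, at z = iy - e, the operator z - A
  is onto by \<open>resolvent_surj\<close>, and the lower bound makes its inverse R Lipschitz. The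
  equation (iy - A) x = b then reads x = R (b - e x), a contraction, which puts iy into the
  resolvent set.\<close>

lemma spectrum_approximate_eigenvector:
  assumes spec: "\<i> * of_real y \<in> spectrum_on X D A" and \<delta>: "\<delta> > 0"
  obtains x where "x \<in> D" "norm ((\<i> * of_real y) *\<^sub>C x - A x) < \<delta> * norm x"
proof (rule ccontr)
  let ?z = "\<i> * of_real y :: complex"
  note [simp] = scaleC_diff_right
  assume "\<not> thesis"
  with that have lb: "\<delta> * norm x \<le> norm (?z *\<^sub>C x - A x)" if "x \<in> D" for x
    using that by force
  \<comment> \<open>A quarter: moving from iy to z costs e and leaves the lower bound 3 e at z, so
    the fixed point map contracts by e / (3 e) = 1/3.\<close>
  define e where "e = \<delta> / 4"
  have e: "e > 0" using \<delta> by (simp add: e_def)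
  define z where "z = ?z - of_real e"
  have "\<exists>x. x \<in> D \<and> z *\<^sub>C x - A x = b" if bX: "b \<in> X" for b
  proof -
    have "Re (- z) > 0" using e by (simp add: z_def)
    then obtain w where "w \<in> D" "(- z) *\<^sub>C w + A w = - b"
      using resolvent_surj[OF _ Xs(5)[OF bX]] by blast
    moreover have "(- z) *\<^sub>C w = - (z *\<^sub>C w)" using scaleC_diff_left[of 0 z w] by simp
    ultimately have "z *\<^sub>C w - A w = b" by (simp add: algebra_simps add_eq_0_iff neg_eq_iff_add_eq_0)
    then show ?thesis using \<open>w \<in> D\<close> by blast
  qed
  then obtain R where R: "\<And>b. b \<in> X \<Longrightarrow> R b \<in> D" "\<And>b. b \<in> X \<Longrightarrow> z *\<^sub>C R b - A (R b) = b"
    by metis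
  have lbz: "3 * e * norm x \<le> norm (z *\<^sub>C x - A x)" if "x \<in> D" for x
  proof -
    have eq: "?z *\<^sub>C x - A x = (z *\<^sub>C x - A x) + of_real e *\<^sub>C x"
      by (simp add: z_def scaleC_diff_left)
    have "norm (?z *\<^sub>C x - A x) \<le> norm (z *\<^sub>C x - A x) + e * norm x"
      unfolding eq
      using norm_triangle_ineq[of "z *\<^sub>C x - A x" "of_real e *\<^sub>C x"] e by simp
    with lb[OF that] show ?thesis by (simp add: e_def)
  qed
  have Rdist: "3 * e * dist (R b) (R c) \<le> dist b c" if "b \<in> X" "c \<in> X" for b c
  proof -
    have "z *\<^sub>C (R b - R c) - A (R b - R c) = (z *\<^sub>C R b - A (R b)) - (z *\<^sub>C R c - A (R c))"
      using R(1) that by (simp add: A_diff)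
    also have "\<dots> = b - c" using R(2) that by simp
    finally have "z *\<^sub>C (R b - R c) - A (R b - R c) = b - c" .
    with lbz[of "R b - R c"] show ?thesis using R(1) that D_diff by (simp add: dist_norm)
  qed
  have "?z \<in> resolvent_set X D A"
    unfolding resolvent_set_def mem_Collect_eq
  proof (intro conjI exI ballI)
    show "norm x \<le> 1 / \<delta> * norm (?z *\<^sub>C x - A x)" if "x \<in> D" for x
      using lb[OF that] \<delta> by (simp add: field_simps)
    show "bij_betw (\<lambda>x. ?z *\<^sub>C x - A x) D X"
      unfolding bij_betw_def
    proof (intro conjI subset_antisym subsetI)
      show "inj_on (\<lambda>x. ?z *\<^sub>C x - A x) D"
      proof (rule inj_onI)
        fix x x' assume x: "x \<in> D" "x' \<in> D" "?z *\<^sub>C x - A x = ?z *\<^sub>C x' - A x'"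
        then have "?z *\<^sub>C (x - x') - A (x - x') = 0" by (simp add: A_diff algebra_simps)
        with lb[of "x - x'"] \<delta> D_diff[OF x(1,2)] show "x = x'" by (simp add: mult_le_0_iff)
      qed
      show "b \<in> X" if "b \<in> (\<lambda>x. ?z *\<^sub>C x - A x) ` D" for b
        using that D_sub A_in Xs(4,6) by auto
      show "b \<in> (\<lambda>x. ?z *\<^sub>C x - A x) ` D" if b: "b \<in> X" for b
      proof -
        have bx: "b - of_real e *\<^sub>C x \<in> X" if "x \<in> X" for x using Xs(4,6) b that by blast
        have "\<exists>!x\<in>X. R (b - of_real e *\<^sub>C x) = x"
        proof (rule Banach_fix[of X "1 / 3"])
          show "complete X" using Xs(1) by (simp add: complete_eq_closed)
          show "X \<noteq> {}" using Xs(2) by blast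
          show "(\<lambda>x. R (b - of_real e *\<^sub>C x)) ` X \<subseteq> X" using R(1) bx D_sub by blast
          show "dist (R (b - of_real e *\<^sub>C x)) (R (b - of_real e *\<^sub>C x')) \<le> 1 / 3 * dist x x'"
            if "x \<in> X" "x' \<in> X" for x x'
          proof -
            have "dist (b - of_real e *\<^sub>C x) (b - of_real e *\<^sub>C x') = norm (of_real e *\<^sub>C (x' - x))"
              unfolding dist_norm by simp
            also have "\<dots> = e * dist x x'" unfolding norm_scaleC using e by (simp add: dist_norm norm_minus_commute)
            finally show ?thesis using Rdist[OF bx[OF that(1)] bx[OF that(2)]] e by simp
          qed
        qed auto
        then obtain x where x: "x \<in> X" "R (b - of_real e *\<^sub>C x) = x" by blast
        have "z *\<^sub>C x - A x = b - of_real e *\<^sub>C x" "x \<in> D"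
          using R[OF bx[OF x(1)]] x(2) by simp_all
        then have "?z *\<^sub>C x - A x = b" by (simp add: z_def scaleC_diff_left algebra_simps)
        with \<open>x \<in> D\<close> show ?thesis by blast
      qed
    qed
  qed
  with spec show False by (simp add: spectrum_on_def)
qed

text \<open>The orbit is compared with exp(-i y u) x by telescoping over steps h = u/(N+1). One step
  has the defect T h x - exp(-i y h) x, which is carried along with norm at most \<open>M\<close>
  and, divided by h, tends to (iy - A) x. Thus the orbit is differentiated only at 0, as in the
  definition of the generator.\<close>

lemma orbit_approximate_eigenvector:
  assumes x: "x \<in> D" and u: "u \<ge> 0"
  shows "norm (T u x - exp (- (\<i> * of_real y * of_real u)) *\<^sub>C x) \<le> M * u * norm ((\<i> * of_real y) *\<^sub>C x - A x)"
proof (cases "u = 0")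
  case True
  then show ?thesis using T_0 D_sub x by simp
next
  case False
  with u have u: "u > 0" by simp
  define E where "E h = exp (- (\<i> * of_real y * of_real h))" for h :: real
  have xX: "x \<in> X" using D_sub x .
  \<comment> \<open>Each further step adds one defect propagated by T (k h), while multiplication by
    E h, of modulus 1, leaves the size of the earlier error unchanged.\<close>
  have step: "norm (T (real k * h) x - E h ^ k *\<^sub>C x) \<le> real k * M * norm (T h x - E h *\<^sub>C x)" if h: "h \<ge> 0" for h k
  proof (induction k)
    case 0
    then show ?case using T_0[OF xX] by simp
  next
    case (Suc k)
    have kh: "real k * h \<ge> 0" using h by simp
    have eX: "T h x - E h *\<^sub>C x \<in> X" using Ts(1)[OF h xX] xX Xs(4,6) by blast
    have "T (real (Suc k) * h) x = T (real k * h) (T h x)"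
      using T_add[OF kh h xX] by (simp add: algebra_simps)
    also have "\<dots> - E h ^ Suc k *\<^sub>C x =
        T (real k * h) (T h x - E h *\<^sub>C x) + E h *\<^sub>C (T (real k * h) x - E h ^ k *\<^sub>C x)"
      using Ts(3)[OF kh xX] Ts(5)[OF kh Ts(1)[OF h xX] Xs(4)[OF xX]]
      by (simp add: scaleC_diff_right scaleC_scaleC)
    also have "norm \<dots> \<le> M * norm (T h x - E h *\<^sub>C x) + norm (T (real k * h) x - E h ^ k *\<^sub>C x)"
    proof (rule order_trans[OF norm_triangle_ineq add_mono])
      show "norm (T (real k * h) (T h x - E h *\<^sub>C x)) \<le> M * norm (T h x - E h *\<^sub>C x)"
        by (rule M(2)[OF kh eX])
      show "norm (E h *\<^sub>C (T (real k * h) x - E h ^ k *\<^sub>C x)) \<le> norm (T (real k * h) x - E h ^ k *\<^sub>C x)"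
        by (simp add: E_def)
    qed
    also have "\<dots> \<le> real (Suc k) * M * norm (T h x - E h *\<^sub>C x)"
      using Suc.IH by (simp add: algebra_simps)
    finally show ?case .
  qed
  define hN where "hN N = u / real (Suc N)" for N
  have hN: "filterlim hN (at_right 0) sequentially"
    unfolding hN_def using u by real_asymp
  have lim: "((\<lambda>h. (T h x - x) /\<^sub>R h - ((E h - 1) / of_real h) *\<^sub>C x) \<longlongrightarrow> - A x - (- (\<i> * of_real y)) *\<^sub>C x) (at_right 0)"
    using exp_difference_quotient[of "- (\<i> * of_real y)"] unfolding E_def
    by (intro tendsto_intros A_lim x) simp
  have "((\<lambda>N. norm ((T (hN N) x - x) /\<^sub>R hN N - ((E (hN N) - 1) / of_real (hN N)) *\<^sub>C x)) \<longlonglongrightarrow>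
     norm (- A x - (- (\<i> * of_real y)) *\<^sub>C x))"
    by (intro tendsto_norm filterlim_compose[OF lim hN])
  also have "- A x - (- (\<i> * of_real y)) *\<^sub>C x = (\<i> * of_real y) *\<^sub>C x - A x"
    using scaleC_diff_left[of 0 "\<i> * of_real y" x] by simp
  finally have L: "(\<lambda>N. M * u * norm ((T (hN N) x - x) /\<^sub>R hN N - ((E (hN N) - 1) / of_real (hN N)) *\<^sub>C x)) \<longlonglongrightarrow>
     M * u * norm ((\<i> * of_real y) *\<^sub>C x - A x)"
    by (intro tendsto_mult_left)
  have le: "norm (T u x - E u *\<^sub>C x) \<le>
      M * u * norm ((T (hN N) x - x) /\<^sub>R hN N - ((E (hN N) - 1) / of_real (hN N)) *\<^sub>C x)" for N
  proof -
    have h: "hN N > 0" and uN: "real (Suc N) * hN N = u" using u by (auto simp: hN_def)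
    have EN: "E (hN N) ^ Suc N = E u"
      unfolding E_def exp_of_nat_mult[symmetric] uN[symmetric] by (simp add: algebra_simps)
    have "(T (hN N) x - x) /\<^sub>R hN N - ((E (hN N) - 1) / of_real (hN N)) *\<^sub>C x = (T (hN N) x - E (hN N) *\<^sub>C x) /\<^sub>R hN N"
    proof -
      have "((E (hN N) - 1) / of_real (hN N)) *\<^sub>C x = ((E (hN N) - 1) *\<^sub>C x) /\<^sub>R hN N"
        by (simp add: scaleR_scaleC scaleC_scaleC divide_inverse mult.commute)
      then show ?thesis by (simp add: scaleC_diff_left flip: scaleR_diff_right)
    qed
    then have "norm ((T (hN N) x - x) /\<^sub>R hN N - ((E (hN N) - 1) / of_real (hN N)) *\<^sub>C x) =
        norm (T (hN N) x - E (hN N) *\<^sub>C x) / hN N"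
      using h by (simp add: divide_inverse mult.commute)
    moreover have "M * u * (norm (T (hN N) x - E (hN N) *\<^sub>C x) / hN N) =
        real (Suc N) * M * norm (T (hN N) x - E (hN N) *\<^sub>C x)"
      unfolding uN[symmetric] using h by simp
    ultimately show ?thesis using step[of "hN N" "Suc N"] h unfolding uN EN by simp
  qed
  have "norm (T u x - E u *\<^sub>C x) \<le> M * u * norm ((\<i> * of_real y) *\<^sub>C x - A x)"
    by (rule Lim_bounded2[OF L, of 0]) (intro allI impI le)
  then show ?thesis by (simp only: E_def)
qed

text \<open>On approximate eigenvectors with relative defect 1/(n+1) the operator is multiplication
  by the integral \<open>I\<close> up to a relative error that vanishes as n grows. The frequency is
  y * t because the orbit is run at speed t.\<close>

lemma spectral_inclusion:
  assumes \<mu>: "bounded_borel_measure (\<mu>, h)" and t: "t > 0"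
    and spec: "\<i> * of_real y \<in> spectrum_on X D A"
  shows "cmod (\<integral>u. exp (- (\<i> * of_real (y * t) * of_real u)) * h u \<partial>\<mu>)
      \<le> onorm_on X (\<lambda>x. orbit_integral \<mu> h (\<lambda>u. T (u * t) x))"
proof -
  have int: "integrable \<mu> h" and sets: "sets \<mu> = sets borel"
    using \<mu> unfolding bounded_borel_measure_def by auto
  define e where "e u = exp (- (\<i> * of_real (y * t) * of_real u))" for u :: real
  have e_meas: "e \<in> borel_measurable \<mu>"
    unfolding measurable_cong_sets[OF sets refl] e_def
    by (intro borel_measurable_continuous_onI continuous_intros)
  have ne: "cmod (e u) = 1" for u by (simp add: e_def)
  have he: "integrable \<mu> (\<lambda>u. h u * e u)"
    by (rule Bochner_Integration.integrable_bound[OF int])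
       (use e_meas int ne in \<open>auto simp: norm_mult\<close>)
  define V where "V x = orbit_integral \<mu> h (\<lambda>u. T (u * t) x)" for x
  define I where "I = (\<integral>u. h u * e u \<partial>\<mu>)"
  have ct: "continuous_on {0..} (\<lambda>u. T (u * t) x)" if "x \<in> X" for x
    by (rule continuous_on_compose2[OF orbit_continuous[OF that]]) (use t in \<open>auto intro!: continuous_intros\<close>)
  have bt: "norm (T (u * t) x) \<le> M * norm x" if "x \<in> X" "u \<ge> 0" for x u
    using M(2)[of "u * t" x] that t by simp
  \<comment> \<open>The estimate with e = 0, reference vector 0 and a constant majorant.\<close>
  have Vb: "norm (V x) \<le> (\<integral>u. cmod (h u) \<partial>\<mu>) * M * norm x" if x: "x \<in> X" for x
    using orbit_integral_diff_bound[OF \<mu> ct[OF x] bt[OF x], of "\<lambda>_. 0" "\<lambda>_. M * norm x" 0] int bt[OF x]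
    by (simp add: V_def mult.assoc)
  \<comment> \<open>A real supremum is informative only for sets that are bounded above; at x = 0
    the quotient is 0/0 = 0.\<close>
  have bdd: "bdd_above ((\<lambda>x. norm (V x) / norm x) ` X)"
  proof (rule bdd_aboveI2)
    fix x assume x: "x \<in> X"
    show "norm (V x) / norm x \<le> (\<integral>u. cmod (h u) \<partial>\<mu>) * M"
    proof (cases "x = 0")
      case True
      then show ?thesis using M(1) by (simp add: integral_nonneg_AE)
    next
      case False
      then show ?thesis using Vb[OF x] by (simp add: divide_le_eq)
    qed
  qed
  have on: "norm (V x) \<le> onorm_on X V * norm x" if x: "x \<in> X" for x
  proof (cases "x = 0")
    case True
    then show ?thesis using Vb[OF x] by simp
  next
    case False
    then show ?thesis using cSUP_upper[OF x bdd] by (simp add: onorm_on_def divide_le_eq)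
  qed
  \<comment> \<open>Two bounds for the deviation of the orbit per unit norm of x. The second tends
    to 0 pointwise, but u may fail to be integrable against \<open>h\<close>; the first, a constant,
    supplies the dominating function.\<close>
  define k where "k n u = min (M + 1) (M * t * u / real (Suc n))" for n :: nat and u :: real
  have kb: "\<bar>k n u\<bar> \<le> M + 1" if "u \<ge> 0" for n u
    using that M(1) t by (auto simp: k_def min_def)
  have k_meas: "(\<lambda>u. cmod (h u) * k n u) \<in> borel_measurable \<mu>" for n
  proof -
    have "k n \<in> borel_measurable \<mu>"
      unfolding measurable_cong_sets[OF sets refl] k_def by measurable
    then show ?thesis using int by measurable
  qed
  have kAE: "AE u in \<mu>. norm (cmod (h u) * k n u) \<le> (M + 1) * cmod (h u)" for n
    using bounded_borel_measure_AE_nonneg[OF \<mu>]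
  proof eventually_elim
    case (elim u)
    then show ?case using mult_left_mono[OF kb[OF elim, of n], of "cmod (h u)"] by (simp add: abs_mult mult.commute)
  qed
  have dom: "integrable \<mu> (\<lambda>u. (M + 1) * cmod (h u))" using int by simp
  have kint: "integrable \<mu> (\<lambda>u. cmod (h u) * k n u)" for n
    by (rule Bochner_Integration.integrable_bound[OF dom k_meas])
       (use kAE[of n] M(1) in \<open>auto elim!: eventually_mono\<close>)
  have klim: "(\<lambda>n. \<integral>u. cmod (h u) * k n u \<partial>\<mu>) \<longlonglongrightarrow> (\<integral>u. 0 \<partial>\<mu>)"
  proof (rule integral_dominated_convergence[OF _ k_meas dom _ kAE])
    show "AE u in \<mu>. (\<lambda>n. cmod (h u) * k n u) \<longlonglongrightarrow> 0"
    proof (intro AE_I2)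
      fix u
      have "(\<lambda>n. M * t * u / real (Suc n)) \<longlonglongrightarrow> 0"
        using tendsto_mult_right_zero[OF LIMSEQ_inverse_real_of_nat, of "M * t * u"]
        by (simp only: divide_inverse)
      then have "(\<lambda>n. cmod (h u) * k n u) \<longlonglongrightarrow> cmod (h u) * min (M + 1) 0"
        unfolding k_def by (intro tendsto_intros)
      then show "(\<lambda>n. cmod (h u) * k n u) \<longlonglongrightarrow> 0" using M(1) by simp
    qed
  qed simp
  have Ile: "cmod I \<le> onorm_on X V + (\<integral>u. cmod (h u) * k n u \<partial>\<mu>)" for n
  proof -
    obtain x where x: "x \<in> D" "norm ((\<i> * of_real y) *\<^sub>C x - A x) < 1 / real (Suc n) * norm x"
      using spectrum_approximate_eigenvector[OF spec, of "1 / real (Suc n)"] by auto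
    have xX: "x \<in> X" using x D_sub by blast
    have x0: "norm x > 0"
    proof (rule ccontr)
      assume "\<not> norm x > 0"
      then have "x = 0" by simp
      with x(2) show False by simp
    qed
    have "norm (T (u * t) x - e u *\<^sub>C x) \<le> k n u * norm x" if u: "u \<ge> 0" for u
    proof -
      have "norm (T (u * t) x - e u *\<^sub>C x) \<le> norm (T (u * t) x) + norm (e u *\<^sub>C x)" by (rule norm_triangle_ineq4)
      also have "\<dots> \<le> (M + 1) * norm x" using bt[OF xX u] ne[of u] by (simp add: algebra_simps)
      finally have 1: "norm (T (u * t) x - e u *\<^sub>C x) \<le> (M + 1) * norm x" .
      have "norm (T (u * t) x - e u *\<^sub>C x) \<le> M * (u * t) * norm ((\<i> * of_real y) *\<^sub>C x - A x)"
        using orbit_approximate_eigenvector[OF x(1), of "u * t" y] u t by (simp add: e_def mult_ac)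
      also have "\<dots> \<le> M * (u * t) * (1 / real (Suc n) * norm x)"
        using M(1) u t x(2) by (intro mult_left_mono) auto
      also have "\<dots> = M * t * u / real (Suc n) * norm x" by simp
      finally show ?thesis using 1 by (simp add: k_def min_def)
    qed
    then have "norm (V x - I *\<^sub>C x) \<le> (\<integral>u. cmod (h u) * (k n u * norm x) \<partial>\<mu>)"
      unfolding V_def I_def using kint[of n]
      by (intro orbit_integral_diff_bound[OF \<mu> ct[OF xX] bt[OF xX] he]) (auto simp flip: mult.assoc)
    then have "norm (V x - I *\<^sub>C x) \<le> (\<integral>u. cmod (h u) * k n u \<partial>\<mu>) * norm x"
      by (simp flip: mult.assoc)
    moreover have "cmod I * norm x \<le> norm (V x) + norm (V x - I *\<^sub>C x)"
      using norm_triangle_ineq3[of "V x" "V x - I *\<^sub>C x"] norm_triangle_sub[of "I *\<^sub>C x" "V x"]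
      by (simp add: norm_minus_commute)
    ultimately have "cmod I * norm x \<le> (onorm_on X V + (\<integral>u. cmod (h u) * k n u \<partial>\<mu>)) * norm x"
      using on[OF xX] by (simp add: algebra_simps)
    with x0 show ?thesis by simp
  qed
  have "(\<lambda>n. onorm_on X V + (\<integral>u. cmod (h u) * k n u \<partial>\<mu>)) \<longlonglongrightarrow> onorm_on X V + 0"
    using klim by (intro tendsto_intros) simp
  then have "cmod I \<le> onorm_on X V + 0" by (rule Lim_bounded2[of _ _ 0]) (intro allI impI Ile)
  then show ?thesis by (simp add: I_def e_def V_def[abs_def] mult.commute)
qed

end

section \<open>Existence of the representing measure\<close>

lemma has_bochner_integral_complex_exp_minus:
  fixes w :: complex
  assumes w: "Re w > 0"
  shows "has_bochner_integral lborel (\<lambda>u. indicator {c..} u *\<^sub>R exp (- (w * of_real u))) (exp (- (w * of_real c)) / w)"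
proof -
  let ?f = "\<lambda>u. exp (- (w * complex_of_real u))"
  let ?F = "\<lambda>u. - exp (- (w * complex_of_real u)) / w"
  have w0: "w \<noteq> 0" using w by auto
  have cont: "continuous_on S ?f" for S by (intro continuous_intros)
  have meas: "?f \<in> borel_measurable borel" by (intro borel_measurable_continuous_onI cont)
  have dom: "integrable lborel (\<lambda>u. indicator {c..} u * exp (- (Re w * u)))"
    using has_bochner_integral_exp_minus[OF w, of c] by (rule integrable.intros)
  have int: "integrable lborel (\<lambda>u. indicator {c..} u *\<^sub>R ?f u)"
    by (rule Bochner_Integration.integrable_bound[OF dom]) (use meas in \<open>auto simp: indicator_def\<close>)
  have "(\<lambda>n. \<integral>u. indicator {c..c + real n} u *\<^sub>R ?f u \<partial>lborel) \<longlonglongrightarrow> (\<integral>u. indicator {c..} u *\<^sub>R ?f u \<partial>lborel)"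
  proof (rule integral_dominated_convergence[OF _ _ dom])
    show "AE u in lborel. (\<lambda>n. indicator {c..c + real n} u *\<^sub>R ?f u) \<longlonglongrightarrow> indicator {c..} u *\<^sub>R ?f u"
    proof (intro AE_I2 tendsto_eventually)
      fix u
      have "\<forall>\<^sub>F n in sequentially. real n \<ge> u - c"
        using filterlim_real_sequentially unfolding filterlim_at_top by blast
      then show "\<forall>\<^sub>F n in sequentially. indicator {c..c + real n} u *\<^sub>R ?f u = indicator {c..} u *\<^sub>R ?f u"
        by eventually_elim (auto simp: indicator_def)
    qed
    show "AE u in lborel. norm (indicator {c..c + real n} u *\<^sub>R ?f u) \<le> indicator {c..} u * exp (- (Re w * u))" for n
      by (auto simp: indicator_def)
  qed (use meas in auto)
  moreover have "(\<integral>u. indicator {c..c + real n} u *\<^sub>R ?f u \<partial>lborel) = ?F (c + real n) - ?F c" for n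
  proof (rule integral_FTC_Icc[where F = ?F and f = ?f])
    show "(?F has_vector_derivative ?f u) (at u within {c..c + real n})" for u
    proof (rule has_vector_derivative_real_field)
      show "((\<lambda>z. - exp (- (w * z)) / w) has_field_derivative ?f u) (at (of_real u))"
        using w0 by (auto intro!: derivative_eq_intros)
    qed
  qed (use cont in auto)
  moreover have "(\<lambda>n. ?F (c + real n) - ?F c) \<longlonglongrightarrow> 0 - ?F c"
  proof (intro tendsto_diff tendsto_const)
    have "(\<lambda>n. exp (- (Re w * (c + real n))) / cmod w) \<longlonglongrightarrow> 0" using w w0 by real_asymp
    then show "(\<lambda>n. ?F (c + real n)) \<longlonglongrightarrow> 0"
      by (rule Lim_null_comparison[rotated]) (simp add: norm_divide)
  qed
  ultimately have "(\<integral>u. indicator {c..} u *\<^sub>R ?f u \<partial>lborel) = 0 - ?F c"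
    using LIMSEQ_unique by simp
  with int show ?thesis by (simp add: has_bochner_integral_iff)
qed

text \<open>Fubini for densities \<open>\<Phi> v\<close> mixed with weights \<open>\<phi> v\<close>.
  Their L1 norms are bounded by B and not by a constant, since B will grow exponentially and be
  compensated by \<open>\<phi>\<close>. The test function g stands for a Laplace kernel, bounded by
  1 on the half-line.\<close>

lemma integral_kernel:
  fixes \<phi> :: "real \<Rightarrow> complex" and \<Phi> :: "real \<Rightarrow> real \<Rightarrow> complex" and g :: "real \<Rightarrow> real"
  assumes \<Phi>: "case_prod \<Phi> \<in> borel_measurable (borel \<Otimes>\<^sub>M borel)"
    and \<phi>: "\<phi> \<in> borel_measurable borel" "\<And>v. v < 0 \<Longrightarrow> \<phi> v = 0"
    and int: "\<And>v. v \<ge> 0 \<Longrightarrow> integrable lborel (\<Phi> v)"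
    and B: "\<And>v. v \<ge> 0 \<Longrightarrow> (\<integral>u. cmod (\<Phi> v u) \<partial>lborel) \<le> B v"
    and \<phi>B: "integrable lborel (\<lambda>v. B v *\<^sub>R \<phi> v)"
    and g: "g \<in> borel_measurable borel" "\<And>u. \<bar>g u\<bar> \<le> 1"
  shows "integrable lborel (\<lambda>u. \<integral>v. \<phi> v * \<Phi> v u \<partial>lborel)"
    "(\<integral>u. g u *\<^sub>R (\<integral>v. \<phi> v * \<Phi> v u \<partial>lborel) \<partial>lborel) = (\<integral>v. \<phi> v * (\<integral>u. g u *\<^sub>R \<Phi> v u \<partial>lborel) \<partial>lborel)"
    "integrable lborel (\<lambda>v. \<phi> v * (\<integral>u. g u *\<^sub>R \<Phi> v u \<partial>lborel))"
proof -
  note [measurable] = \<Phi> \<phi>(1) g(1)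
  have main: "integrable (lborel \<Otimes>\<^sub>M lborel) (\<lambda>(v, u). \<phi> v * (w u *\<^sub>R \<Phi> v u))"
    if w: "w \<in> borel_measurable borel" "\<And>u. \<bar>w u\<bar> \<le> 1" for w
  proof (rule lborel_pair.Fubini_integrable)
    note [measurable] = w(1)
    show "(\<lambda>(v, u). \<phi> v * (w u *\<^sub>R \<Phi> v u)) \<in> borel_measurable (lborel \<Otimes>\<^sub>M lborel)"
      by measurable
    have iw: "integrable lborel (\<lambda>u. w u *\<^sub>R \<Phi> v u)" if v: "v \<ge> 0" for v
      by (rule Bochner_Integration.integrable_bound[OF int[OF v]])
         (use w(2) in \<open>auto intro!: AE_I2 mult_left_le_one_le\<close>)
    show "AE v in lborel. integrable lborel (\<lambda>u. (\<lambda>(v, u). \<phi> v * (w u *\<^sub>R \<Phi> v u)) (v, u))"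
    proof (intro AE_I2)
      fix v :: real
      show "integrable lborel (\<lambda>u. (\<lambda>(v, u). \<phi> v * (w u *\<^sub>R \<Phi> v u)) (v, u))"
        using integrable_mult_right[OF iw[of v], of "\<phi> v"] \<phi>(2)[of v] by (cases "v \<ge> 0") auto
    qed
    show "integrable lborel (\<lambda>v. \<integral>u. norm ((\<lambda>(v, u). \<phi> v * (w u *\<^sub>R \<Phi> v u)) (v, u)) \<partial>lborel)"
    proof (rule Bochner_Integration.integrable_bound[OF \<phi>B])
      show "AE v in lborel. norm (\<integral>u. norm ((\<lambda>(v, u). \<phi> v * (w u *\<^sub>R \<Phi> v u)) (v, u)) \<partial>lborel) \<le> norm (B v *\<^sub>R \<phi> v)"
      proof (intro AE_I2)
        fix v :: real
        show "norm (\<integral>u. norm ((\<lambda>(v, u). \<phi> v * (w u *\<^sub>R \<Phi> v u)) (v, u)) \<partial>lborel) \<le> norm (B v *\<^sub>R \<phi> v)"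
        proof (cases "v \<ge> 0")
          case True
          have "(\<integral>u. norm (w u *\<^sub>R \<Phi> v u) \<partial>lborel) \<le> (\<integral>u. cmod (\<Phi> v u) \<partial>lborel)"
            by (intro integral_mono integrable_norm iw[OF True] int[OF True])
               (use w(2) in \<open>auto intro!: mult_left_le_one_le\<close>)
          also have "\<dots> \<le> B v" by (rule B[OF True])
          finally have 1: "(\<integral>u. norm (w u *\<^sub>R \<Phi> v u) \<partial>lborel) \<le> B v" .
          have 0: "0 \<le> (\<integral>u. norm (w u *\<^sub>R \<Phi> v u) \<partial>lborel)" by (intro integral_nonneg_AE) auto
          have eq: "(\<lambda>u. norm ((\<lambda>(v, u). \<phi> v * (w u *\<^sub>R \<Phi> v u)) (v, u))) =
              (\<lambda>u. cmod (\<phi> v) * norm (w u *\<^sub>R \<Phi> v u))"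
            by (auto simp: norm_mult)
          have "norm (\<integral>u. norm ((\<lambda>(v, u). \<phi> v * (w u *\<^sub>R \<Phi> v u)) (v, u)) \<partial>lborel) =
              cmod (\<phi> v) * (\<integral>u. norm (w u *\<^sub>R \<Phi> v u) \<partial>lborel)"
            unfolding eq integral_mult_right_zero using 0 by (simp only: real_norm_def abs_mult abs_norm_cancel abs_of_nonneg)
          also have "\<dots> \<le> cmod (\<phi> v) * \<bar>B v\<bar>" using 1 0 by (intro mult_left_mono) auto
          finally show ?thesis by (simp add: mult.commute)
        qed (use \<phi>(2) in auto)
      qed
    qed measurable
  qed
  from lborel_pair.integrable_snd[OF main[of "\<lambda>_. 1"]]
  show "integrable lborel (\<lambda>u. \<integral>v. \<phi> v * \<Phi> v u \<partial>lborel)" by simp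
  from lborel_pair.integrable_fst[OF main[OF g]]
  show "integrable lborel (\<lambda>v. \<phi> v * (\<integral>u. g u *\<^sub>R \<Phi> v u \<partial>lborel))"
    unfolding integral_mult_right_zero .
  have inner: "(\<integral>v. \<phi> v * (g u *\<^sub>R \<Phi> v u) \<partial>lborel) = g u *\<^sub>R (\<integral>v. \<phi> v * \<Phi> v u \<partial>lborel)" for u
    by simp
  from lborel_pair.Fubini_integral[OF main[OF g]]
  show "(\<integral>u. g u *\<^sub>R (\<integral>v. \<phi> v * \<Phi> v u \<partial>lborel) \<partial>lborel) = (\<integral>v. \<phi> v * (\<integral>u. g u *\<^sub>R \<Phi> v u \<partial>lborel) \<partial>lborel)"
    unfolding inner integral_mult_right_zero .
qed

text \<open>The Laplace transforms, on the positive half-line, of the measures \<open>c0 \<delta>\<^sub>0 + c1 \<delta>\<^sub>1 + \<phi> du\<close> for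
  which \<open>e\<^sup>\<epsilon>\<^sup>u \<phi>(u)\<close> is integrable.\<close>

definition laplace_data :: "(real \<Rightarrow> complex) \<Rightarrow> real \<Rightarrow> complex \<Rightarrow> complex \<Rightarrow> (real \<Rightarrow> complex) \<Rightarrow> bool" where
  "laplace_data f \<epsilon> c0 c1 \<phi> \<longleftrightarrow> \<phi> \<in> borel_measurable borel \<and> (\<forall>u<0. \<phi> u = 0) \<and>
     integrable lborel (\<lambda>u. exp (\<epsilon> * u) *\<^sub>R \<phi> u) \<and>
     (\<forall>x>0. f x = c0 + c1 * of_real (exp (- x)) + (\<integral>u. exp (- (x * u)) *\<^sub>R \<phi> u \<partial>lborel))"

definition exp_laplace :: "(real \<Rightarrow> complex) \<Rightarrow> bool" where
  "exp_laplace f \<longleftrightarrow> (\<exists>\<epsilon>>0. \<exists>c0 c1 \<phi>. laplace_data f \<epsilon> c0 c1 \<phi>)"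

lemma integrable_exp_weight_mono:
  fixes \<phi> :: "real \<Rightarrow> complex"
  assumes "\<phi> \<in> borel_measurable borel" "\<And>u. u < 0 \<Longrightarrow> \<phi> u = 0"
    and "integrable lborel (\<lambda>u. exp (\<epsilon> * u) *\<^sub>R \<phi> u)" "\<delta> \<le> \<epsilon>"
  shows "integrable lborel (\<lambda>u. exp (\<delta> * u) *\<^sub>R \<phi> u)"
proof (rule Bochner_Integration.integrable_bound[OF assms(3)])
  show "AE u in lborel. norm (exp (\<delta> * u) *\<^sub>R \<phi> u) \<le> norm (exp (\<epsilon> * u) *\<^sub>R \<phi> u)"
  proof (intro AE_I2)
    fix u show "norm (exp (\<delta> * u) *\<^sub>R \<phi> u) \<le> norm (exp (\<epsilon> * u) *\<^sub>R \<phi> u)"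
      using assms(2)[of u] assms(4) by (cases "u < 0") (auto intro!: mult_right_mono)
  qed
qed (use assms(1) in measurable)

text \<open>Replacing the point mass at every v by the density \<open>\<Phi> v\<close> turns the
  measure of f into a density F, with E x v in place of exp(-x v) in the transform. Each division
  below is a choice of \<open>\<Phi>\<close>. Growth like exp(\<epsilon> v) is what the measure of f
  can absorb, and \<delta> is the exponential weight that survives.\<close>

lemma laplace_data_kernel:
  assumes f: "laplace_data f \<epsilon> c0 c1 \<phi>" and \<delta>: "\<delta> \<ge> 0"
    and \<Phi>: "case_prod \<Phi> \<in> borel_measurable (borel \<Otimes>\<^sub>M borel)"
    and \<Phi>0: "\<And>v u. v \<ge> 0 \<Longrightarrow> u < 0 \<Longrightarrow> \<Phi> v u = 0"
    and int: "\<And>v. v \<ge> 0 \<Longrightarrow> integrable lborel (\<lambda>u. exp (\<delta> * u) *\<^sub>R \<Phi> v u)"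
    and C: "\<And>v. v \<ge> 0 \<Longrightarrow> (\<integral>u. exp (\<delta> * u) * cmod (\<Phi> v u) \<partial>lborel) \<le> C * exp (\<epsilon> * v)"
    and E: "\<And>x v. x > 0 \<Longrightarrow> v \<ge> 0 \<Longrightarrow> (\<integral>u. exp (- (x * u)) *\<^sub>R \<Phi> v u \<partial>lborel) = E x v"
  obtains F where "F \<in> borel_measurable borel" "\<And>u. u < 0 \<Longrightarrow> F u = 0"
    "integrable lborel (\<lambda>u. exp (\<delta> * u) *\<^sub>R F u)"
    "\<And>x. x > 0 \<Longrightarrow> (\<integral>u. exp (- (x * u)) *\<^sub>R F u \<partial>lborel) = c0 * E x 0 + c1 * E x 1 + (\<integral>v. \<phi> v * E x v \<partial>lborel)"
    "\<And>x. x > 0 \<Longrightarrow> integrable lborel (\<lambda>v. \<phi> v * E x v)"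
proof -
  from f have \<phi>: "\<phi> \<in> borel_measurable borel" "\<And>u. u < 0 \<Longrightarrow> \<phi> u = 0"
    "integrable lborel (\<lambda>u. exp (\<epsilon> * u) *\<^sub>R \<phi> u)"
    unfolding laplace_data_def by auto
  note [measurable] = \<Phi> \<phi>(1)
  \<comment> \<open>The weight exp(\<delta> u) is put into the kernel; the Laplace kernel
    \<open>g\<close> below removes it again through exp(-(x + \<delta>) u) and stays bounded by
    1.\<close>
  define \<Psi> where "\<Psi> v u = exp (\<delta> * u) *\<^sub>R \<Phi> v u" for v u
  define F where "F u = c0 * \<Phi> 0 u + c1 * \<Phi> 1 u + (\<integral>v. \<phi> v * \<Phi> v u \<partial>lborel)" for u
  have \<Psi>m [measurable]: "case_prod \<Psi> \<in> borel_measurable (borel \<Otimes>\<^sub>M borel)"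
    unfolding \<Psi>_def by measurable
  have Fm: "F \<in> borel_measurable borel"
    unfolding F_def by measurable
  have F0: "F u = 0" if "u < 0" for u
  proof -
    have *: "\<phi> v * \<Phi> v u = 0" for v using \<phi>(2)[of v] \<Phi>0[of v u] that by (cases "v < 0") auto
    show ?thesis unfolding F_def * using \<Phi>0[of 0 u] \<Phi>0[of 1 u] that by simp
  qed
  have B: "(\<integral>u. cmod (\<Psi> v u) \<partial>lborel) \<le> C * exp (\<epsilon> * v)" if "v \<ge> 0" for v
    using C[OF that] by (simp add: \<Psi>_def)
  have \<phi>B: "integrable lborel (\<lambda>v. (C * exp (\<epsilon> * v)) *\<^sub>R \<phi> v)"
    using integrable_scaleR_right[OF \<phi>(3), of C] by simp
  have \<Psi>i: "integrable lborel (\<Psi> v)" if "v \<ge> 0" for v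
    using int[OF that] by (simp add: \<Psi>_def[abs_def])
  have eF: "exp (\<delta> * u) *\<^sub>R F u = c0 * \<Psi> 0 u + c1 * \<Psi> 1 u + (\<integral>v. \<phi> v * \<Psi> v u \<partial>lborel)" for u
    unfolding F_def \<Psi>_def by (simp add: scaleR_add_right)
  define g where "g x u = indicator {0..} u * exp (- ((x + \<delta>) * u))" for x u :: real
  have gm: "g x \<in> borel_measurable borel" for x unfolding g_def by measurable
  have g1: "\<bar>g x u\<bar> \<le> 1" if "x > 0" for x u
    using that \<delta> by (auto simp: g_def indicator_def abs_mult)
  have K: "integrable lborel (\<lambda>u. \<integral>v. \<phi> v * \<Psi> v u \<partial>lborel)"
    "(\<integral>u. w u *\<^sub>R (\<integral>v. \<phi> v * \<Psi> v u \<partial>lborel) \<partial>lborel) = (\<integral>v. \<phi> v * (\<integral>u. w u *\<^sub>R \<Psi> v u \<partial>lborel) \<partial>lborel)"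
    "integrable lborel (\<lambda>v. \<phi> v * (\<integral>u. w u *\<^sub>R \<Psi> v u \<partial>lborel))"
    if "w \<in> borel_measurable borel" "\<And>u. \<bar>w u\<bar> \<le> 1" for w :: "real \<Rightarrow> real"
    by (rule integral_kernel[OF \<Psi>m \<phi>(1,2) \<Psi>i B \<phi>B that]; assumption)+
  have K1: "integrable lborel (\<lambda>u. \<integral>v. \<phi> v * \<Psi> v u \<partial>lborel)"
    using K(1)[of "\<lambda>_. 1"] by simp
  have g\<Psi>: "g x u *\<^sub>R \<Psi> v u = exp (- (x * u)) *\<^sub>R \<Phi> v u" if "v \<ge> 0" for x u v
    using \<Phi>0[OF that, of u]
    by (cases "u < 0") (auto simp: g_def \<Psi>_def indicator_def algebra_simps simp flip: exp_add)
  have gE: "(\<integral>u. g x u *\<^sub>R \<Psi> v u \<partial>lborel) = E x v" if "x > 0" "v \<ge> 0" for x v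
    unfolding g\<Psi>[OF that(2)] by (rule E[OF that])
  have \<phi>E: "\<phi> v * (\<integral>u. g x u *\<^sub>R \<Psi> v u \<partial>lborel) = \<phi> v * E x v" if "x > 0" for x v
    using gE[OF that, of v] \<phi>(2)[of v] by (cases "v < 0") auto
  have ig: "integrable lborel (\<lambda>u. g x u *\<^sub>R h u)" if "integrable lborel h" "x > 0" for x and h :: "real \<Rightarrow> complex"
    by (rule Bochner_Integration.integrable_bound[OF that(1)])
       (use g1[OF that(2)] gm that(1) in \<open>auto intro!: AE_I2 mult_left_le_one_le\<close>)
  show ?thesis
  proof (rule that[OF Fm F0])
    show "integrable lborel (\<lambda>u. exp (\<delta> * u) *\<^sub>R F u)"
      unfolding eF using \<Psi>i K1 by auto
    fix x :: real assume x: "x > 0"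
    show "integrable lborel (\<lambda>v. \<phi> v * E x v)"
      using K(3)[OF gm g1[OF x]] unfolding \<phi>E[OF x] .
    have "exp (- (x * u)) *\<^sub>R F u = g x u *\<^sub>R (exp (\<delta> * u) *\<^sub>R F u)" for u
      using F0[of u]
      by (cases "u < 0") (auto simp: g_def indicator_def algebra_simps simp flip: exp_add)
    then have "(\<integral>u. exp (- (x * u)) *\<^sub>R F u \<partial>lborel) =
        (\<integral>u. c0 * (g x u *\<^sub>R \<Psi> 0 u) + c1 * (g x u *\<^sub>R \<Psi> 1 u) + g x u *\<^sub>R (\<integral>v. \<phi> v * \<Psi> v u \<partial>lborel) \<partial>lborel)"
      unfolding eF by (simp add: scaleR_add_right)
    also have "\<dots> = c0 * E x 0 + c1 * E x 1 + (\<integral>v. \<phi> v * E x v \<partial>lborel)"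
    proof (intro has_bochner_integral_integral_eq has_bochner_integral_add has_bochner_integral_mult_right)
      show "has_bochner_integral lborel (\<lambda>u. g x u *\<^sub>R \<Psi> 0 u) (E x 0)"
        using ig[OF \<Psi>i[of 0] x] gE[OF x, of 0] by (simp add: has_bochner_integral_iff)
      show "has_bochner_integral lborel (\<lambda>u. g x u *\<^sub>R \<Psi> 1 u) (E x 1)"
        using ig[OF \<Psi>i[of 1] x] gE[OF x, of 1] by (simp add: has_bochner_integral_iff)
      show "has_bochner_integral lborel (\<lambda>u. g x u *\<^sub>R (\<integral>v. \<phi> v * \<Psi> v u \<partial>lborel)) (\<integral>v. \<phi> v * E x v \<partial>lborel)"
        using ig[OF K1 x] K(2)[OF gm g1[OF x]] unfolding \<phi>E[OF x] by (simp only: has_bochner_integral_iff)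
    qed
    finally show "(\<integral>u. exp (- (x * u)) *\<^sub>R F u \<partial>lborel) = c0 * E x 0 + c1 * E x 1 + (\<integral>v. \<phi> v * E x v \<partial>lborel)" .
  qed
qed

section \<open>Closure properties and rational functions\<close>

lemma exp_laplaceI:
  assumes "\<epsilon> > 0" "\<phi> \<in> borel_measurable borel" "\<And>u. u < 0 \<Longrightarrow> \<phi> u = 0"
    "integrable lborel (\<lambda>u. exp (\<epsilon> * u) *\<^sub>R \<phi> u)"
    "\<And>x. x > 0 \<Longrightarrow> f x = c0 + c1 * of_real (exp (- x)) + (\<integral>u. exp (- (x * u)) *\<^sub>R \<phi> u \<partial>lborel)"
  shows "exp_laplace f"
  unfolding exp_laplace_def laplace_data_def using assms by blast

lemma exp_laplace_const: "exp_laplace (\<lambda>x. c)"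
  by (rule exp_laplaceI[of 1 "\<lambda>_. 0" _ c 0]) auto

lemma exp_laplace_exp: "exp_laplace (\<lambda>x. of_real (exp (- x)))"
  by (rule exp_laplaceI[of 1 "\<lambda>_. 0" _ 0 1]) auto

lemma exp_laplace_cong:
  assumes "exp_laplace f" "\<And>x. x > 0 \<Longrightarrow> f x = g x"
  shows "exp_laplace g"
  using assms unfolding exp_laplace_def laplace_data_def by auto

lemma laplace_integrable:
  assumes "laplace_data f \<epsilon> c0 c1 \<phi>" "\<epsilon> > 0" "x \<ge> 0"
  shows "integrable lborel (\<lambda>u. exp (- (x * u)) *\<^sub>R \<phi> u)"
  using integrable_exp_weight_mono[of \<phi> \<epsilon> "- x"] assms unfolding laplace_data_def by simp

lemma exp_laplace_add:
  assumes "exp_laplace f" "exp_laplace g"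
  shows "exp_laplace (\<lambda>x. f x + g x)"
proof -
  from assms obtain \<epsilon> c0 c1 \<phi> \<epsilon>' c0' c1' \<phi>' where e: "\<epsilon> > 0" "\<epsilon>' > 0"
    and d: "laplace_data f \<epsilon> c0 c1 \<phi>" "laplace_data g \<epsilon>' c0' c1' \<phi>'"
    unfolding exp_laplace_def by auto
  show ?thesis
  proof (rule exp_laplaceI)
    show "min \<epsilon> \<epsilon>' > 0" using e by simp
    show "(\<lambda>u. \<phi> u + \<phi>' u) \<in> borel_measurable borel"
      using d unfolding laplace_data_def by auto
    show "\<phi> u + \<phi>' u = 0" if "u < 0" for u using d that unfolding laplace_data_def by auto
    show "integrable lborel (\<lambda>u. exp (min \<epsilon> \<epsilon>' * u) *\<^sub>R (\<phi> u + \<phi>' u))"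
      unfolding scaleR_add_right
    proof (rule Bochner_Integration.integrable_add)
      show "integrable lborel (\<lambda>u. exp (min \<epsilon> \<epsilon>' * u) *\<^sub>R \<phi> u)"
        by (rule integrable_exp_weight_mono[of \<phi> \<epsilon>]) (use d in \<open>auto simp: laplace_data_def\<close>)
      show "integrable lborel (\<lambda>u. exp (min \<epsilon> \<epsilon>' * u) *\<^sub>R \<phi>' u)"
        by (rule integrable_exp_weight_mono[of \<phi>' \<epsilon>']) (use d in \<open>auto simp: laplace_data_def\<close>)
    qed
    show "f x + g x = (c0 + c0') + (c1 + c1') * of_real (exp (- x)) +
        (\<integral>u. exp (- (x * u)) *\<^sub>R (\<phi> u + \<phi>' u) \<partial>lborel)" if x: "x > 0" for x
    proof -
      have "f x = c0 + c1 * of_real (exp (- x)) + (\<integral>u. exp (- (x * u)) *\<^sub>R \<phi> u \<partial>lborel)"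
        "g x = c0' + c1' * of_real (exp (- x)) + (\<integral>u. exp (- (x * u)) *\<^sub>R \<phi>' u \<partial>lborel)"
        using d x unfolding laplace_data_def by auto
      then show ?thesis
        unfolding scaleR_add_right
        using laplace_integrable[OF d(1) e(1), of x] laplace_integrable[OF d(2) e(2), of x] x
        by (simp add: algebra_simps)
    qed
  qed
qed

lemma exp_laplace_cmult:
  assumes "exp_laplace f"
  shows "exp_laplace (\<lambda>x. c * f x)"
proof -
  from assms obtain \<epsilon> c0 c1 \<phi> where e: "\<epsilon> > 0" and d: "laplace_data f \<epsilon> c0 c1 \<phi>"
    unfolding exp_laplace_def by auto
  from d have d': "\<phi> \<in> borel_measurable borel" "\<And>u. u < 0 \<Longrightarrow> \<phi> u = 0"
    "integrable lborel (\<lambda>u. exp (\<epsilon> * u) *\<^sub>R \<phi> u)"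
    "\<And>x. x > 0 \<Longrightarrow> f x = c0 + c1 * of_real (exp (- x)) + (\<integral>u. exp (- (x * u)) *\<^sub>R \<phi> u \<partial>lborel)"
    unfolding laplace_data_def by auto
  note [measurable] = d'(1)
  show ?thesis
  proof (rule exp_laplaceI[OF e])
    show "(\<lambda>u. c * \<phi> u) \<in> borel_measurable borel" by measurable
    show "integrable lborel (\<lambda>u. exp (\<epsilon> * u) *\<^sub>R (c * \<phi> u))"
      using integrable_mult_right[OF d'(3), of c] by simp
    show "c * f x = (c * c0) + (c * c1) * of_real (exp (- x)) + (\<integral>u. exp (- (x * u)) *\<^sub>R (c * \<phi> u) \<partial>lborel)"
      if x: "x > 0" for x
    proof -
      have "(\<integral>u. exp (- (x * u)) *\<^sub>R (c * \<phi> u) \<partial>lborel) = c * (\<integral>u. exp (- (x * u)) *\<^sub>R \<phi> u \<partial>lborel)"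
        by (simp flip: integral_mult_right_zero)
      then show ?thesis by (simp add: d'(4)[OF x] algebra_simps)
    qed
  qed (use d'(2) in auto)
qed

text \<open>1/(x - a) is the transform of exp(a u) on the half-line, so the division is a
  convolution: a point mass at v becomes exp(a (u - v)) for u \<ge> v.\<close>

lemma exp_laplace_divide_linear:
  assumes f: "exp_laplace f" and a: "Re a < 0"
  shows "exp_laplace (\<lambda>x. f x / (of_real x - a))"
proof -
  from f obtain \<epsilon> c0 c1 \<phi> where e: "\<epsilon> > 0" and d: "laplace_data f \<epsilon> c0 c1 \<phi>"
    unfolding exp_laplace_def by auto
  \<comment> \<open>At least half of the decay rate -Re a is kept back, so that the weighted kernel
    is still integrable.\<close>
  define \<delta> where "\<delta> = min \<epsilon> (- Re a / 2)"
  have \<delta>: "\<delta> > 0" "\<delta> \<le> \<epsilon>" "- Re a - \<delta> > 0" using e a by (auto simp: \<delta>_def min_def)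
  define \<Phi> where "\<Phi> v u = indicator {0..} (u - v) *\<^sub>R exp (a * of_real (u - v))" for v u :: real
  have \<Phi>_meas: "case_prod \<Phi> \<in> borel_measurable (borel \<Otimes>\<^sub>M borel)"
  proof -
    have "(\<lambda>x. exp (a * complex_of_real x)) \<in> borel_measurable borel"
      by (intro borel_measurable_continuous_onI continuous_intros)
    note [measurable] = this
    show ?thesis unfolding \<Phi>_def by measurable
  qed
  note hb = has_bochner_integral_exp_minus[OF \<delta>(3)]
  have ab: "exp (\<delta> * u) * cmod (\<Phi> v u) = exp (- (Re a * v)) * (indicator {v..} u * exp (- ((- Re a - \<delta>) * u)))" for u v
    by (auto simp: \<Phi>_def indicator_def algebra_simps simp flip: exp_add)
  have ab': "exp (- (x * u)) *\<^sub>R \<Phi> v u = exp (- (a * of_real v)) * (indicator {v..} u *\<^sub>R exp (- ((of_real x - a) * of_real u)))" for x u v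
  proof (cases "u \<ge> v")
    case True
    have "exp (- (x * u)) *\<^sub>R \<Phi> v u = exp (of_real (- (x * u))) * exp (a * of_real (u - v))"
      using True unfolding exp_of_real by (simp add: \<Phi>_def scaleR_conv_of_real)
    also have "\<dots> = exp (- (a * of_real v)) * exp (- ((of_real x - a) * of_real u))"
      unfolding mult_exp_exp by (intro arg_cong[of _ _ exp]) (simp add: algebra_simps)
    finally show ?thesis using True by simp
  qed (simp add: \<Phi>_def)
  show ?thesis
  proof (rule laplace_data_kernel[OF d _ \<Phi>_meas])
    show "\<delta> \<ge> 0" using \<delta> by simp
    show "\<Phi> v u = 0" if "v \<ge> 0" "u < 0" for v u using that by (simp add: \<Phi>_def)
    show int: "integrable lborel (\<lambda>u. exp (\<delta> * u) *\<^sub>R \<Phi> v u)" for v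
    proof (rule Bochner_Integration.integrable_bound)
      show "integrable lborel (\<lambda>u. exp (\<delta> * u) * cmod (\<Phi> v u))"
        unfolding ab using hb[of v] by (intro integrable_mult_right) (auto intro: integrable.intros)
      have [measurable]: "\<Phi> v \<in> borel_measurable borel"
        by (rule measurable_Pair2[OF \<Phi>_meas, of v, simplified])
      show "(\<lambda>u. exp (\<delta> * u) *\<^sub>R \<Phi> v u) \<in> borel_measurable lborel" by measurable
    qed auto
    show "(\<integral>u. exp (\<delta> * u) * cmod (\<Phi> v u) \<partial>lborel) \<le> 1 / (- Re a - \<delta>) * exp (\<epsilon> * v)" if v: "v \<ge> 0" for v
    proof -
      have "(\<integral>u. exp (\<delta> * u) * cmod (\<Phi> v u) \<partial>lborel) =
          exp (- (Re a * v)) * (exp (- ((- Re a - \<delta>) * v)) / (- Re a - \<delta>))"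
        unfolding ab integral_mult_right_zero has_bochner_integral_integral_eq[OF hb] ..
      also have "\<dots> = 1 / (- Re a - \<delta>) * exp (\<delta> * v)"
        by (simp add: algebra_simps flip: exp_add)
      also have "\<dots> \<le> 1 / (- Re a - \<delta>) * exp (\<epsilon> * v)"
        using \<delta> v by (intro mult_left_mono) (auto intro: mult_right_mono)
      finally show ?thesis .
    qed
    show "(\<integral>u. exp (- (x * u)) *\<^sub>R \<Phi> v u \<partial>lborel) = (1 / (of_real x - a)) * of_real (exp (- (x * v)))"
      if "x > 0" "v \<ge> 0" for x v
    proof -
      have "Re (of_real x - a) > 0" using a that by simp
      then have "(\<integral>u. exp (- (x * u)) *\<^sub>R \<Phi> v u \<partial>lborel) =
          exp (- (a * of_real v)) * (exp (- ((of_real x - a) * of_real v)) / (of_real x - a))"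
        unfolding ab' integral_mult_right_zero
        by (simp add: has_bochner_integral_integral_eq[OF has_bochner_integral_complex_exp_minus])
      also have "\<dots> = (1 / (of_real x - a)) * (exp (- (a * of_real v)) * exp (- ((of_real x - a) * of_real v)))"
        by simp
      also have "exp (- (a * of_real v)) * exp (- ((of_real x - a) * of_real v)) = exp (of_real (- (x * v)))"
        unfolding mult_exp_exp by (intro arg_cong[of _ _ exp]) (simp add: algebra_simps)
      finally show ?thesis by (simp only: exp_of_real)
    qed
  next
    fix F :: "real \<Rightarrow> complex"
    assume F: "F \<in> borel_measurable borel" "\<And>u. u < 0 \<Longrightarrow> F u = 0"
      "integrable lborel (\<lambda>u. exp (\<delta> * u) *\<^sub>R F u)"
    assume F': "\<And>x. x > 0 \<Longrightarrow> (\<integral>u. exp (- (x * u)) *\<^sub>R F u \<partial>lborel) =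
       c0 * (1 / (of_real x - a) * of_real (exp (- (x * 0)))) +
       c1 * (1 / (of_real x - a) * of_real (exp (- (x * 1)))) +
       (\<integral>v. \<phi> v * (1 / (of_real x - a) * of_real (exp (- (x * v)))) \<partial>lborel)"
    show ?thesis
    proof (rule exp_laplaceI[OF \<delta>(1) F, of _ 0 0])
      fix x :: real assume x: "x > 0"
      have eq: "(\<integral>v. \<phi> v * (1 / (of_real x - a) * of_real (exp (- (x * v)))) \<partial>lborel) =
        1 / (of_real x - a) * (\<integral>v. exp (- (x * v)) *\<^sub>R \<phi> v \<partial>lborel)"
        unfolding integral_mult_right_zero[symmetric]
        by (intro Bochner_Integration.integral_cong) (auto simp: scaleR_conv_of_real)
      have "f x = c0 + c1 * of_real (exp (- x)) + (\<integral>u. exp (- (x * u)) *\<^sub>R \<phi> u \<partial>lborel)"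
        using d x unfolding laplace_data_def by auto
      then show "f x / (of_real x - a) = 0 + 0 * of_real (exp (- x)) + (\<integral>u. exp (- (x * u)) *\<^sub>R F u \<partial>lborel)"
        unfolding F'[OF x] eq by (simp add: add_divide_distrib)
    qed
  qed
qed

text \<open>Induction on the degree of d takes the place of partial fractions and treats multiple
  roots like simple ones: for a root a, with d = (X - a) d' and p = (X - a) p1 + p(a), one has p/d =
  p1/d' + p(a)/(d' (X - a)).\<close>

lemma exp_laplace_rational:
  assumes "degree p \<le> degree d" "\<And>z. poly d z = 0 \<Longrightarrow> Re z < 0" "d \<noteq> 0"
  shows "exp_laplace (\<lambda>x. poly p (of_real x) / poly d (of_real x))"
  using assms
proof (induction "degree d" arbitrary: p d)
  case 0
  then obtain a b where "p = [:a:]" "d = [:b:]" by (metis degree_eq_zeroE le_zero_eq)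
  then show ?case by (simp add: exp_laplace_const)
next
  case (Suc n)
  have "coeff d (degree d) \<noteq> 0" "degree d \<in> {1..degree d}" using Suc.hyps(2) Suc.prems(3) by auto
  then obtain a where "(\<Sum>i\<le>degree d. coeff d i * a ^ i) = 0"
    using fundamental_theorem_of_algebra[of "coeff d" "degree d"] by blast
  then have a: "poly d a = 0" by (simp add: poly_altdef)
  then obtain d' where d': "d = [:- a, 1:] * d'" using poly_eq_0_iff_dvd by blast
  then have "d' \<noteq> 0" using Suc.prems(3) by auto
  have "degree d = degree [:- a, 1:] + degree d'"
    unfolding d' using \<open>d' \<noteq> 0\<close> by (intro degree_mult_eq) auto
  then have deg: "degree d' = n" using Suc.hyps(2) by simp
  have roots: "\<And>z. poly d' z = 0 \<Longrightarrow> Re z < 0" using Suc.prems(2) d' by simp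
  define p1 where "p1 = synthetic_div p a"
  have p: "p = [:- a, 1:] * p1 + [:poly p a:]"
    unfolding p1_def by (metis synthetic_div_correct')
  have "degree p1 \<le> degree d'" using Suc deg by (simp add: p1_def degree_synthetic_div)
  then have 1: "exp_laplace (\<lambda>x. poly p1 (of_real x) / poly d' (of_real x))"
    using Suc.hyps(1)[of d' p1] deg roots \<open>d' \<noteq> 0\<close> by simp
  have "exp_laplace (\<lambda>x. poly 1 (of_real x) / poly d' (of_real x))"
    using Suc.hyps(1)[of d' 1] deg roots \<open>d' \<noteq> 0\<close> by simp
  then have "exp_laplace (\<lambda>x. poly p a * (poly 1 (of_real x) / poly d' (of_real x) / (of_real x - a)))"
    using Suc.prems(2)[OF a] by (intro exp_laplace_cmult exp_laplace_divide_linear)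
  from exp_laplace_add[OF 1 this] show ?case
  proof (rule exp_laplace_cong)
    fix x :: real assume "x > 0"
    then have "of_real x - a \<noteq> 0" using Suc.prems(2)[OF a] by auto
    moreover have "poly d' (of_real x) \<noteq> 0" using roots[of "of_real x"] \<open>x > 0\<close> by auto
    moreover have "poly p (of_real x) = (of_real x - a) * poly p1 (of_real x) + poly p a"
      using arg_cong[OF p, of "\<lambda>p. poly p (of_real x)"] by (simp add: algebra_simps)
    moreover have "poly d (of_real x) = (of_real x - a) * poly d' (of_real x)"
      by (simp add: d' algebra_simps)
    ultimately show "poly p1 (of_real x) / poly d' (of_real x) +
        poly p a * (poly 1 (of_real x) / poly d' (of_real x) / (of_real x - a)) =
        poly p (of_real x) / poly d (of_real x)"
      by (simp add: divide_simps)
  qed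
qed

section \<open>Division by integral and fractional powers\<close>

text \<open>The transform tends to the total mass as x tends to 0, by dominated convergence.
  Vanishing mass is what allows the kernels of the next two lemmas to be corrected by a term that
  does not depend on v.\<close>

lemma laplace_data_mass:
  assumes d: "laplace_data f \<epsilon> c0 c1 \<phi>" and e: "\<epsilon> > 0" and lim: "(f \<longlongrightarrow> 0) (at_right 0)"
  shows "c0 + c1 + (\<integral>u. \<phi> u \<partial>lborel) = 0"
proof -
  from d have \<phi>: "\<phi> \<in> borel_measurable borel" "\<And>u. u < 0 \<Longrightarrow> \<phi> u = 0"
    "\<And>x. x > 0 \<Longrightarrow> f x = c0 + c1 * of_real (exp (- x)) + (\<integral>u. exp (- (x * u)) *\<^sub>R \<phi> u \<partial>lborel)"
    unfolding laplace_data_def by auto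
  note [measurable] = \<phi>(1)
  have i: "integrable lborel \<phi>" using laplace_integrable[OF d e, of 0] by simp
  define X where "X n = 1 / real (Suc n)" for n
  have X0: "X n > 0" for n by (simp add: X_def)
  have X: "X \<longlonglongrightarrow> 0" unfolding X_def by real_asymp
  have "filterlim X (at_right 0) sequentially"
    unfolding filterlim_at using X X0 by (auto simp: less_imp_neq[THEN not_sym])
  from filterlim_compose[OF lim this] have 1: "(\<lambda>n. f (X n)) \<longlonglongrightarrow> 0" .
  have "(\<lambda>n. \<integral>u. exp (- (X n * u)) *\<^sub>R \<phi> u \<partial>lborel) \<longlonglongrightarrow> (\<integral>u. \<phi> u \<partial>lborel)"
  proof (rule integral_dominated_convergence[where w = "\<lambda>u. norm (\<phi> u)"])
    show "AE u in lborel. (\<lambda>n. exp (- (X n * u)) *\<^sub>R \<phi> u) \<longlonglongrightarrow> \<phi> u"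
    proof (intro AE_I2)
      fix u
      have "(\<lambda>n. exp (- (X n * u)) *\<^sub>R \<phi> u) \<longlonglongrightarrow> exp (- (0 * u)) *\<^sub>R \<phi> u"
        by (intro tendsto_intros X)
      then show "(\<lambda>n. exp (- (X n * u)) *\<^sub>R \<phi> u) \<longlonglongrightarrow> \<phi> u" by simp
    qed
    show "AE u in lborel. norm (exp (- (X n * u)) *\<^sub>R \<phi> u) \<le> norm (\<phi> u)" for n
    proof (intro AE_I2)
      fix u show "norm (exp (- (X n * u)) *\<^sub>R \<phi> u) \<le> norm (\<phi> u)"
        using X0[of n] \<phi>(2)[of u] by (cases "u < 0") (auto intro!: mult_left_le_one_le)
    qed
  qed (use i in auto)
  then have "(\<lambda>n. c0 + c1 * of_real (exp (- X n)) + (\<integral>u. exp (- (X n * u)) *\<^sub>R \<phi> u \<partial>lborel))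
      \<longlonglongrightarrow> c0 + c1 * of_real (exp (- 0)) + (\<integral>u. \<phi> u \<partial>lborel)"
    by (intro tendsto_intros X)
  then have "(\<lambda>n. f (X n)) \<longlonglongrightarrow> c0 + c1 * of_real (exp (- 0)) + (\<integral>u. \<phi> u \<partial>lborel)"
    using \<phi>(3)[OF X0] by simp
  from LIMSEQ_unique[OF this 1] show ?thesis by simp
qed

text \<open>1/x is the transform of the indicator of the half-line, which is not integrable. As the
  mass is zero, that indicator may be subtracted for every v; what remains is minus the indicator of
  [0,v), of compact support, so exponential moments are kept.\<close>

lemma exp_laplace_divide_id:
  assumes f: "exp_laplace f" and lim: "(f \<longlongrightarrow> 0) (at_right 0)"
  shows "exp_laplace (\<lambda>x. f x / of_real x)"
proof -
  from f obtain \<epsilon> c0 c1 \<phi> where e: "\<epsilon> > 0" and d: "laplace_data f \<epsilon> c0 c1 \<phi>"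
    unfolding exp_laplace_def by auto
  note mass = laplace_data_mass[OF d e lim]
  define \<Phi> where "\<Phi> v u = - complex_of_real (indicator {0..} u * indicator {0<..} (v - u))" for v u :: real
  have \<Phi>_meas: "case_prod \<Phi> \<in> borel_measurable (borel \<Otimes>\<^sub>M borel)"
    unfolding \<Phi>_def by measurable
  have FTC: "has_bochner_integral lborel (\<lambda>u. exp (a * u) * indicator {0..v} u) ((exp (a * v) - 1) / a)"
    if "a \<noteq> 0" "v \<ge> 0" for a v :: real
  proof -
    have "has_bochner_integral lborel (\<lambda>u. exp (a * u) * indicator {0..v} u) (exp (a * v) / a - exp (a * 0) / a)"
      by (rule has_bochner_integral_FTC_Icc_nonneg) (use that in \<open>auto intro!: derivative_eq_intros\<close>)
    then show ?thesis by (simp add: diff_divide_distrib)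
  qed
  \<comment> \<open>The kernel is half-open at v while \<open>FTC\<close> integrates over the closed
    interval; the single point is negligible.\<close>
  have AE: "AE u in lborel. exp (a * u) *\<^sub>R \<Phi> v u = - of_real (exp (a * u) * indicator {0..v} u)" for a v :: real
    using AE_lborel_singleton[of v] by eventually_elim (auto simp: \<Phi>_def indicator_def scaleR_conv_of_real)
  have [measurable]: "\<Phi> v \<in> borel_measurable borel" for v
    by (rule measurable_Pair2[OF \<Phi>_meas, of v, simplified])
  have hb: "has_bochner_integral lborel (\<lambda>u. exp (a * u) *\<^sub>R \<Phi> v u) (- of_real ((exp (a * v) - 1) / a))"
    if "a \<noteq> 0" "v \<ge> 0" for a v :: real
  proof -
    have "has_bochner_integral lborel (\<lambda>u. - complex_of_real (exp (a * u) * indicator {0..v} u)) (- of_real ((exp (a * v) - 1) / a))"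
      by (intro has_bochner_integral_minus has_bochner_integral_of_real FTC that)
    then show ?thesis
      by (subst has_bochner_integral_cong_AE[OF _ _ AE]) auto
  qed
  show ?thesis
  proof (rule laplace_data_kernel[OF d _ \<Phi>_meas])
    show "\<epsilon> \<ge> 0" using e by simp
    show "\<Phi> v u = 0" if "v \<ge> 0" "u < 0" for v u using that by (simp add: \<Phi>_def)
    show int: "integrable lborel (\<lambda>u. exp (\<epsilon> * u) *\<^sub>R \<Phi> v u)" if "v \<ge> 0" for v
      using hb[OF _ that, of \<epsilon>] e by (auto intro: integrable.intros)
    show "(\<integral>u. exp (\<epsilon> * u) * cmod (\<Phi> v u) \<partial>lborel) \<le> 1 / \<epsilon> * exp (\<epsilon> * v)" if v: "v \<ge> 0" for v
    proof -
      have "(\<integral>u. exp (\<epsilon> * u) * cmod (\<Phi> v u) \<partial>lborel) = (\<integral>u. exp (\<epsilon> * u) * indicator {0..v} u \<partial>lborel)"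
      proof (rule integral_cong_AE)
        show "AE u in lborel. exp (\<epsilon> * u) * cmod (\<Phi> v u) = exp (\<epsilon> * u) * indicator {0..v} u"
          using AE_lborel_singleton[of v] by eventually_elim (auto simp: \<Phi>_def indicator_def)
      qed measurable
      also have "\<dots> = (exp (\<epsilon> * v) - 1) / \<epsilon>"
        using has_bochner_integral_integral_eq[OF FTC[OF _ v, of \<epsilon>]] e by simp
      also have "\<dots> \<le> 1 / \<epsilon> * exp (\<epsilon> * v)" using e by (simp add: divide_right_mono)
      finally show ?thesis .
    qed
    show "(\<integral>u. exp (- (x * u)) *\<^sub>R \<Phi> v u \<partial>lborel) = of_real ((exp (- (x * v)) - 1) / x)"
      if "x > 0" "v \<ge> 0" for x v
      using has_bochner_integral_integral_eq[OF hb[OF _ that(2), of "- x"]] that(1) by (simp flip: of_real_minus)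
  next
    fix F :: "real \<Rightarrow> complex"
    assume F: "F \<in> borel_measurable borel" "\<And>u. u < 0 \<Longrightarrow> F u = 0"
      "integrable lborel (\<lambda>u. exp (\<epsilon> * u) *\<^sub>R F u)"
    assume F': "\<And>x. x > 0 \<Longrightarrow> (\<integral>u. exp (- (x * u)) *\<^sub>R F u \<partial>lborel) =
       c0 * of_real ((exp (- (x * 0)) - 1) / x) + c1 * of_real ((exp (- (x * 1)) - 1) / x) +
       (\<integral>v. \<phi> v * of_real ((exp (- (x * v)) - 1) / x) \<partial>lborel)"
    show ?thesis
    proof (rule exp_laplaceI[OF e F, of _ 0 0])
      fix x :: real assume x: "x > 0"
      have "(\<integral>v. \<phi> v * of_real ((exp (- (x * v)) - 1) / x) \<partial>lborel) =
          (\<integral>v. (exp (- (x * v)) *\<^sub>R \<phi> v - exp (- (0 * v)) *\<^sub>R \<phi> v) / of_real x \<partial>lborel)"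
        by (intro Bochner_Integration.integral_cong) (auto simp: scaleR_conv_of_real algebra_simps diff_divide_distrib)
      also have "\<dots> = ((\<integral>v. exp (- (x * v)) *\<^sub>R \<phi> v \<partial>lborel) - (\<integral>v. \<phi> v \<partial>lborel)) / of_real x"
        using laplace_integrable[OF d e, of x] laplace_integrable[OF d e, of 0] x by simp
      finally have eq: "(\<integral>v. \<phi> v * of_real ((exp (- (x * v)) - 1) / x) \<partial>lborel) =
          ((\<integral>v. exp (- (x * v)) *\<^sub>R \<phi> v \<partial>lborel) - (\<integral>v. \<phi> v \<partial>lborel)) / of_real x" .
      have fx: "f x = c0 + c1 * of_real (exp (- x)) + (\<integral>u. exp (- (x * u)) *\<^sub>R \<phi> u \<partial>lborel)"
        using d x unfolding laplace_data_def by auto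
      have m: "(\<integral>v. \<phi> v \<partial>lborel) = - (c0 + c1)" using mass by (simp only: add_eq_0_iff)
      show "f x / of_real x = 0 + 0 * of_real (exp (- x)) + (\<integral>u. exp (- (x * u)) *\<^sub>R F u \<partial>lborel)"
        unfolding F'[OF x] eq fx m using x by (simp add: field_simps)
    qed
  qed
qed

text \<open>The \<open>L\<^sup>1\<close> norm of the kernel is read off from its Laplace transform: away from \<open>u = v\<close>, its modulus
  differs from it by \<open>2 k\<close> restricted to \<open>u < v\<close>, as \<open>k\<close> is decreasing. The limit \<open>x \<rightarrow> 0\<close> is monotone.\<close>

lemma exp_laplace_fractional:
  assumes f: "exp_laplace f" and lim: "(f \<longlongrightarrow> 0) (at_right 0)" and \<theta>: "0 < \<theta>" "\<theta> \<le> 1"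
  obtains F :: "real \<Rightarrow> complex" where "integrable lborel F" "\<And>u. u < 0 \<Longrightarrow> F u = 0"
    "\<And>x. x > 0 \<Longrightarrow> (\<integral>u. exp (- (x * u)) *\<^sub>R F u \<partial>lborel) = of_real (x powr - \<theta>) * f x"
proof -
  from f obtain \<epsilon> c0 c1 \<phi> where e: "\<epsilon> > 0" and d: "laplace_data f \<epsilon> c0 c1 \<phi>"
    unfolding exp_laplace_def by auto
  note mass = laplace_data_mass[OF d e lim]
  \<comment> \<open>x^(-\<theta>) is the transform of u^(\<theta>-1)/Gamma(\<theta>). Since 0 powr
    anything is 0, \<open>k\<close> vanishes at 0 even for \<theta> = 1; so \<open>dec\<close> holds
    from positive a on only.\<close>
  define k where "k u = indicator {0..} u * (u powr (\<theta> - 1)) / Gamma \<theta>" for u :: real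
  have k_meas [measurable]: "k \<in> borel_measurable borel" unfolding k_def by measurable
  have G: "Gamma \<theta> > 0" using \<theta> by (simp add: Gamma_real_pos)
  have k0: "k u \<ge> 0" for u using G by (simp add: k_def)
  have k_lap: "has_bochner_integral lborel (\<lambda>u. exp (- (x * u)) * k u) (x powr - \<theta>)" if x: "x > 0" for x
  proof -
    define f1 where "f1 u = indicator {0..} u * (u powr (\<theta> - 1) / exp u)" for u :: real
    have f1m [measurable]: "f1 \<in> borel_measurable borel" unfolding f1_def by measurable
    have "has_bochner_integral lborel f1 (Gamma \<theta>)"
    proof (rule has_bochner_integral_nn_integral)
      have "(\<integral>\<^sup>+u. ennreal (indicator {0..} u * (u powr (\<theta> - 1) / exp u)) \<partial>lborel) = ennreal (Gamma \<theta>)"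
        by (rule nn_integral_has_integral_lebesgue[OF _ Gamma_integral_real[OF \<theta>(1)]]) auto
      then show "(\<integral>\<^sup>+u. ennreal (f1 u) \<partial>lborel) = ennreal (Gamma \<theta>)" by (simp add: f1_def)
    qed (use G in \<open>auto simp: f1_def\<close>)
    then have "has_bochner_integral lborel (\<lambda>u. f1 (0 + x * u)) (Gamma \<theta> /\<^sub>R \<bar>x\<bar>)"
      using lborel_has_bochner_integral_real_affine_iff[of x f1 "Gamma \<theta>" 0] x by simp
    then have "has_bochner_integral lborel (\<lambda>u. (x powr (1 - \<theta>) / Gamma \<theta>) * f1 (0 + x * u)) ((x powr (1 - \<theta>) / Gamma \<theta>) * (Gamma \<theta> /\<^sub>R \<bar>x\<bar>))"
      by (intro has_bochner_integral_mult_right) auto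
    moreover have "(x powr (1 - \<theta>) / Gamma \<theta>) * f1 (0 + x * u) = exp (- (x * u)) * k u" for u
    proof (cases "u > 0")
      case True
      have "x powr (1 - \<theta>) * x powr (\<theta> - 1) = 1" using x by (simp flip: powr_add)
      then show ?thesis using True x
        by (simp add: f1_def k_def powr_mult exp_minus field_simps)
    next
      case False
      then show ?thesis using x by (cases "u = 0") (auto simp: f1_def k_def indicator_def zero_le_mult_iff)
    qed
    moreover have "(x powr (1 - \<theta>) / Gamma \<theta>) * (Gamma \<theta> /\<^sub>R \<bar>x\<bar>) = x powr - \<theta>"
      using x G by (simp add: powr_diff powr_minus field_simps)
    ultimately show ?thesis by simp
  qed
  \<comment> \<open>Zero mass allows \<open>k\<close> itself to be subtracted from each translate;
    the non-integrable tails then cancel to an integrable order.\<close>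
  define \<psi> where "\<psi> v u = k (u - v) - k u" for v u
  have \<psi>_meas [measurable]: "\<psi> v \<in> borel_measurable borel" for v unfolding \<psi>_def by measurable
  have \<psi>_lap: "has_bochner_integral lborel (\<lambda>u. exp (- (x * u)) * \<psi> v u) (x powr - \<theta> * (exp (- (x * v)) - 1))" if x: "x > 0" for x v
  proof -
    have "has_bochner_integral lborel (\<lambda>u. exp (- (x * (- v + 1 * u))) * k (- v + 1 * u)) (x powr - \<theta> /\<^sub>R \<bar>1\<bar>)"
      using lborel_has_bochner_integral_real_affine_iff[of 1 "\<lambda>u. exp (- (x * u)) * k u" "x powr - \<theta>" "- v"] k_lap[OF x] by simp
    then have "has_bochner_integral lborel (\<lambda>u. exp (- (x * v)) * (exp (- (x * (- v + 1 * u))) * k (- v + 1 * u)))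
        (exp (- (x * v)) * (x powr - \<theta> /\<^sub>R \<bar>1\<bar>))"
      by (intro has_bochner_integral_mult_right) auto
    from has_bochner_integral_diff[OF this k_lap[OF x]]
    have "has_bochner_integral lborel (\<lambda>u. exp (- (x * v)) * (exp (- (x * (- v + 1 * u))) * k (- v + 1 * u)) - exp (- (x * u)) * k u)
      (exp (- (x * v)) * (x powr - \<theta> /\<^sub>R \<bar>1\<bar>) - x powr - \<theta>)" .
    moreover have "exp (- (x * v)) * (exp (- (x * (- v + 1 * u))) * k (- v + 1 * u)) - exp (- (x * u)) * k u = exp (- (x * u)) * \<psi> v u" for u
    proof -
      have "exp (- (x * v)) * exp (- (x * (- v + 1 * u))) = exp (- (x * u))"
        by (simp add: algebra_simps flip: exp_add)
      then show ?thesis by (simp add: \<psi>_def algebra_simps flip: mult.assoc)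
    qed
    ultimately show ?thesis by (simp add: algebra_simps)
  qed
  have dec: "k b \<le> k a" if "0 < a" "a \<le> b" for a b
    using that \<theta> G by (auto simp: k_def intro!: divide_right_mono powr_mono2')
  \<comment> \<open>The transform of the signed kernel is at most 0 and is dropped. What remains is
    2 k on u < v, where 1 \<le> exp(\<epsilon> (v - u)), and the integral of exp(-\<epsilon> u) k u
    is \<epsilon>^(-\<theta>).\<close>
  define C where "C = 2 * \<epsilon> powr - \<theta>"
  have \<psi>_nn: "(\<integral>\<^sup>+u. ennreal \<bar>\<psi> v u\<bar> \<partial>lborel) \<le> ennreal (C * exp (\<epsilon> * v))" if v: "v \<ge> 0" for v
  proof -
    define X where "X n = 1 / real (Suc n)" for n
    have X0: "X n > 0" for n by (simp add: X_def)
    have Xd: "X m \<le> X n" if "n \<le> m" for m n using that by (simp add: X_def frac_le)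
    have X: "X \<longlonglongrightarrow> 0" unfolding X_def by real_asymp
    have \<psi>neg: "\<psi> v u = 0" if "u < 0" for u using that v by (simp add: \<psi>_def k_def)
    define w where "w n u = exp (- (X n * u)) * \<bar>\<psi> v u\<bar>" for n u
    have L: "(\<lambda>n. \<integral>\<^sup>+u. ennreal (w n u) \<partial>lborel) \<longlonglongrightarrow> (\<integral>\<^sup>+u. ennreal \<bar>\<psi> v u\<bar> \<partial>lborel)"
    proof (rule nn_integral_LIMSEQ)
      show "incseq (\<lambda>n u. ennreal (w n u))"
      proof (intro incseq_SucI le_funI ennreal_leI)
        fix n u
        show "w n u \<le> w (Suc n) u"
          using Xd[of n "Suc n"] \<psi>neg[of u]
          by (cases "u < 0") (auto simp: w_def intro!: mult_right_mono)
      qed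
      show "(\<lambda>n. ennreal (w n u)) \<longlonglongrightarrow> ennreal \<bar>\<psi> v u\<bar>" for u
      proof -
        have "(\<lambda>n. w n u) \<longlonglongrightarrow> exp (- (0 * u)) * \<bar>\<psi> v u\<bar>"
          unfolding w_def by (intro tendsto_intros X)
        then show ?thesis by (intro tendsto_ennrealI) simp
      qed
    qed (auto simp: w_def)
    have W: "(\<integral>\<^sup>+u. ennreal (w n u) \<partial>lborel) \<le> ennreal (C * exp (\<epsilon> * v))" for n
    proof -
      define p where "p u = exp (- (X n * u)) * (indicator {..<v} u * k u)" for u
      have w_meas: "w n \<in> borel_measurable borel" unfolding w_def by measurable
      have p_meas: "p \<in> borel_measurable borel" unfolding p_def by measurable
      have pb: "p u \<le> exp (\<epsilon> * v) * (exp (- (\<epsilon> * u)) * k u)" for u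
      proof (cases "0 \<le> u \<and> u < v")
        case True
        have "exp (- (X n * u)) \<le> exp (\<epsilon> * v) * exp (- (\<epsilon> * u))"
          unfolding mult_exp_exp using True X0[of n] e by (simp add: mult_left_mono add_increasing2 order_trans[of _ 0])
        then have "exp (- (X n * u)) * k u \<le> exp (\<epsilon> * v) * exp (- (\<epsilon> * u)) * k u"
          using k0 by (rule mult_right_mono)
        then show ?thesis using True by (simp add: p_def mult.assoc)
      next
        case False
        then have "p u = 0" by (auto simp: p_def k_def indicator_def)
        then show ?thesis using k0[of u] by simp
      qed
      have pi: "integrable lborel p"
      proof (rule Bochner_Integration.integrable_bound)
        show "integrable lborel (\<lambda>u. exp (\<epsilon> * v) * (exp (- (\<epsilon> * u)) * k u))"
          using k_lap[OF e] by (intro integrable_mult_right) (auto intro: integrable.intros)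
        show "p \<in> borel_measurable lborel" using p_meas by simp
        show "AE u in lborel. norm (p u) \<le> norm (exp (\<epsilon> * v) * (exp (- (\<epsilon> * u)) * k u))"
          using pb k0 by (intro AE_I2) (simp add: p_def abs_mult)
      qed
      have "AE u in lborel. w n u = exp (- (X n * u)) * \<psi> v u + 2 * p u"
        using AE_lborel_singleton[of v]
      proof eventually_elim
        case (elim u)
        show ?case
        proof (cases "u < v")
          case True
          then have "\<psi> v u = - k u" by (simp add: \<psi>_def k_def)
          then show ?thesis using True k0[of u] by (simp add: w_def p_def)
        next
          case False
          with elim have "u > v" by simp
          then have "\<psi> v u \<ge> 0" using dec[of "u - v" u] v by (simp add: \<psi>_def)
          then show ?thesis using False by (simp add: w_def p_def)
        qed
      qed
      moreover have "has_bochner_integral lborel (\<lambda>u. exp (- (X n * u)) * \<psi> v u + 2 * p u)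
          (X n powr - \<theta> * (exp (- (X n * v)) - 1) + 2 * (\<integral>u. p u \<partial>lborel))"
        by (intro has_bochner_integral_add \<psi>_lap X0 has_bochner_integral_mult_right has_bochner_integral_integrable pi)
      ultimately have hb: "has_bochner_integral lborel (w n)
          (X n powr - \<theta> * (exp (- (X n * v)) - 1) + 2 * (\<integral>u. p u \<partial>lborel))"
        by (subst has_bochner_integral_cong_AE) (auto simp: w_meas p_meas)
      have "(\<integral>\<^sup>+u. ennreal (w n u) \<partial>lborel) = ennreal (X n powr - \<theta> * (exp (- (X n * v)) - 1) + 2 * (\<integral>u. p u \<partial>lborel))"
        using nn_integral_eq_integral[of lborel "w n"] hb by (simp add: has_bochner_integral_iff w_def)
      also have "\<dots> \<le> ennreal (C * exp (\<epsilon> * v))"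
      proof (rule ennreal_leI)
        have "X n powr - \<theta> * (exp (- (X n * v)) - 1) \<le> 0"
          using X0[of n] v by (intro mult_nonneg_nonpos) auto
        moreover have "(\<integral>u. p u \<partial>lborel) \<le> (\<integral>u. exp (\<epsilon> * v) * (exp (- (\<epsilon> * u)) * k u) \<partial>lborel)"
          using k_lap[OF e] pi pb by (intro integral_mono integrable_mult_right) (auto intro: integrable.intros)
        moreover have "(\<integral>u. exp (\<epsilon> * v) * (exp (- (\<epsilon> * u)) * k u) \<partial>lborel) = exp (\<epsilon> * v) * \<epsilon> powr - \<theta>"
          using has_bochner_integral_integral_eq[OF k_lap[OF e]] by simp
        ultimately show "X n powr - \<theta> * (exp (- (X n * v)) - 1) + 2 * (\<integral>u. p u \<partial>lborel) \<le> C * exp (\<epsilon> * v)"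
          by (simp add: C_def mult.commute)
      qed
      finally show ?thesis .
    qed
    show ?thesis by (rule LIMSEQ_le_const2[OF L]) (use W in auto)
  qed
  define \<Phi> where "\<Phi> v u = complex_of_real (\<psi> v u)" for v u
  have \<Phi>_meas: "case_prod \<Phi> \<in> borel_measurable (borel \<Otimes>\<^sub>M borel)"
    unfolding \<Phi>_def \<psi>_def by measurable
  have \<psi>_int: "integrable lborel (\<psi> v)" if v: "v \<ge> 0" for v
    by (rule integrableI_bounded) (use \<psi>_nn[OF v] in \<open>auto simp: less_top[symmetric] top_unique intro: le_less_trans\<close>)
  show ?thesis
  \<comment> \<open>\<open>order_refl\<close> sets the surviving weight \<delta> to 0: for \<theta>
    < 1 and v > 0 the kernel decays only like u^(\<theta>-2), so no further division of this kind
    can follow.\<close>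
  proof (rule laplace_data_kernel[OF d order_refl \<Phi>_meas])
    show "\<Phi> v u = 0" if "v \<ge> 0" "u < 0" for v u using that by (simp add: \<Phi>_def \<psi>_def k_def)
    show int: "integrable lborel (\<lambda>u. exp (0 * u) *\<^sub>R \<Phi> v u)" if "v \<ge> 0" for v
      using \<psi>_int[OF that] by (simp add: \<Phi>_def)
    show "(\<integral>u. exp (0 * u) * cmod (\<Phi> v u) \<partial>lborel) \<le> C * exp (\<epsilon> * v)" if v: "v \<ge> 0" for v
    proof -
      have "ennreal (\<integral>u. \<bar>\<psi> v u\<bar> \<partial>lborel) = (\<integral>\<^sup>+u. ennreal \<bar>\<psi> v u\<bar> \<partial>lborel)"
        using \<psi>_int[OF v] by (intro nn_integral_eq_integral[symmetric]) auto
      with \<psi>_nn[OF v] have "ennreal (\<integral>u. \<bar>\<psi> v u\<bar> \<partial>lborel) \<le> ennreal (C * exp (\<epsilon> * v))" by simp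
      then show ?thesis by (simp add: \<Phi>_def C_def)
    qed
    show "(\<integral>u. exp (- (x * u)) *\<^sub>R \<Phi> v u \<partial>lborel) = of_real (x powr - \<theta> * (exp (- (x * v)) - 1))"
      if "x > 0" "v \<ge> 0" for x v
      using has_bochner_integral_integral_eq[OF has_bochner_integral_of_real[OF \<psi>_lap[OF that(1), of v], where 'a = complex]]
      by (simp add: \<Phi>_def scaleR_conv_of_real)
  next
    fix F :: "real \<Rightarrow> complex"
    assume F: "F \<in> borel_measurable borel" "\<And>u. u < 0 \<Longrightarrow> F u = 0"
      "integrable lborel (\<lambda>u. exp (0 * u) *\<^sub>R F u)"
    assume F': "\<And>x. x > 0 \<Longrightarrow> (\<integral>u. exp (- (x * u)) *\<^sub>R F u \<partial>lborel) =
       c0 * of_real (x powr - \<theta> * (exp (- (x * 0)) - 1)) + c1 * of_real (x powr - \<theta> * (exp (- (x * 1)) - 1)) +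
       (\<integral>v. \<phi> v * of_real (x powr - \<theta> * (exp (- (x * v)) - 1)) \<partial>lborel)"
    show ?thesis
    proof (rule that[of F])
      show "integrable lborel F" using F(3) by simp
      show "F u = 0" if "u < 0" for u using F(2) that .
      fix x :: real assume x: "x > 0"
      have "(\<integral>v. \<phi> v * of_real (x powr - \<theta> * (exp (- (x * v)) - 1)) \<partial>lborel) =
          (\<integral>v. of_real (x powr - \<theta>) * (exp (- (x * v)) *\<^sub>R \<phi> v - exp (- (0 * v)) *\<^sub>R \<phi> v) \<partial>lborel)"
        by (intro Bochner_Integration.integral_cong) (auto simp: scaleR_conv_of_real algebra_simps)
      also have "\<dots> = of_real (x powr - \<theta>) * ((\<integral>v. exp (- (x * v)) *\<^sub>R \<phi> v \<partial>lborel) - (\<integral>v. \<phi> v \<partial>lborel))"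
        using laplace_integrable[OF d e, of x] laplace_integrable[OF d e, of 0] x by simp
      finally have eq: "(\<integral>v. \<phi> v * of_real (x powr - \<theta> * (exp (- (x * v)) - 1)) \<partial>lborel) =
          of_real (x powr - \<theta>) * ((\<integral>v. exp (- (x * v)) *\<^sub>R \<phi> v \<partial>lborel) - (\<integral>v. \<phi> v \<partial>lborel))" .
      have fx: "f x = c0 + c1 * of_real (exp (- x)) + (\<integral>u. exp (- (x * u)) *\<^sub>R \<phi> u \<partial>lborel)"
        using d x unfolding laplace_data_def by auto
      have m: "(\<integral>v. \<phi> v \<partial>lborel) = - (c0 + c1)" using mass by (simp only: add_eq_0_iff)
      show "(\<integral>u. exp (- (x * u)) *\<^sub>R F u \<partial>lborel) = of_real (x powr - \<theta>) * f x"
        unfolding F'[OF x] eq fx m by (simp add: algebra_simps)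
    qed
  qed
qed

section \<open>From densities to representing measures\<close>

text \<open>Differentiation under the integral. F may lack a first moment; on the ball of radius
  \<rho> = Re z / 2 the factor u from the derivative is absorbed by the exponential, as u
  exp(-\<rho> u) \<le> 1/\<rho>.\<close>

lemma laplace_holomorphic:
  fixes F :: "real \<Rightarrow> complex"
  assumes F: "integrable lborel F" "\<And>u. u < 0 \<Longrightarrow> F u = 0"
  shows "(\<lambda>z. \<integral>u. exp (- (z * of_real u)) * F u \<partial>lborel) holomorphic_on {z. Re z > 0}"
    (is "?L holomorphic_on _")
proof -
  have Fm [measurable]: "F \<in> borel_measurable borel" using F(1) by auto
  have em [measurable]: "(\<lambda>u. exp (- (z * complex_of_real u))) \<in> borel_measurable borel" for z
    by (intro borel_measurable_continuous_onI continuous_intros)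
  have int: "integrable lborel (\<lambda>u. exp (- (z * of_real u)) * F u)" if "Re z > 0" for z
  proof (rule Bochner_Integration.integrable_bound[OF F(1)])
    show "AE u in lborel. norm (exp (- (z * of_real u)) * F u) \<le> norm (F u)"
    proof (intro AE_I2)
      fix u show "norm (exp (- (z * of_real u)) * F u) \<le> norm (F u)"
        using F(2)[of u] that by (cases "u < 0") (auto simp: norm_mult intro!: mult_left_le_one_le)
    qed
  qed measurable
  have deriv: "(?L has_field_derivative (\<integral>u. - of_real u * exp (- (z * of_real u)) * F u \<partial>lborel)) (at z)"
    if z: "Re z > 0" for z
  proof -
    define \<rho> where "\<rho> = Re z / 2"
    have \<rho>: "\<rho> > 0" using z by (simp add: \<rho>_def)
    have Re: "Re w \<ge> \<rho>" if "w \<in> ball z \<rho>" for w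
      using that abs_Re_le_cmod[of "z - w"] by (simp add: dist_norm \<rho>_def)
    have "(?L has_field_derivative (\<integral>u. - of_real u * exp (- (z * of_real u)) * F u \<partial>lborel)) (at z within ball z \<rho>)"
      unfolding has_field_derivative_iff tendsto_at_iff_sequentially
    proof (intro allI impI)
      fix X assume X: "\<forall>i. X i \<in> ball z \<rho> - {z}" "X \<longlonglongrightarrow> z"
      have Xz: "X i \<in> ball z \<rho>" "X i \<noteq> z" for i using X(1) by auto
      define D where "D w u = (exp (- (w * complex_of_real u)) - exp (- (z * of_real u))) / (w - z)" for w u
      have quot: "((\<lambda>w. (?L w - ?L z) / (w - z)) \<circ> X) = (\<lambda>i. \<integral>u. D (X i) u * F u \<partial>lborel)"
      proof
        fix i
        have "?L (X i) - ?L z = (\<integral>u. exp (- (X i * of_real u)) * F u - exp (- (z * of_real u)) * F u \<partial>lborel)"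
          using int[OF z] int[of "X i"] Re[OF Xz(1)[of i]] \<rho> by simp
        then have "(?L (X i) - ?L z) / (X i - z) =
            (\<integral>u. (exp (- (X i * of_real u)) * F u - exp (- (z * of_real u)) * F u) / (X i - z) \<partial>lborel)"
          by simp
        also have "\<dots> = (\<integral>u. D (X i) u * F u \<partial>lborel)"
          by (intro Bochner_Integration.integral_cong) (auto simp: D_def left_diff_distrib diff_divide_distrib)
        finally show "((\<lambda>w. (?L w - ?L z) / (w - z)) \<circ> X) i = (\<integral>u. D (X i) u * F u \<partial>lborel)" by simp
      qed
      have "(\<lambda>i. \<integral>u. D (X i) u * F u \<partial>lborel) \<longlonglongrightarrow> (\<integral>u. - of_real u * exp (- (z * of_real u)) * F u \<partial>lborel)"
      proof (rule integral_dominated_convergence[where w = "\<lambda>u. 1 / \<rho> * norm (F u)"])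
        show "AE u in lborel. (\<lambda>i. D (X i) u * F u) \<longlonglongrightarrow> - of_real u * exp (- (z * of_real u)) * F u"
        proof (intro AE_I2 tendsto_mult tendsto_const)
          fix u :: real
          have "((\<lambda>w. exp (- (w * complex_of_real u))) has_field_derivative - of_real u * exp (- (z * of_real u))) (at z)"
            by (auto intro!: derivative_eq_intros)
          then have "((\<lambda>w. D w u) \<longlongrightarrow> - of_real u * exp (- (z * of_real u))) (at z)"
            by (simp add: has_field_derivative_iff D_def)
          moreover have "filterlim X (at z) sequentially"
            unfolding filterlim_at using X(2) Xz(2) by simp
          ultimately show "(\<lambda>i. D (X i) u) \<longlonglongrightarrow> - of_real u * exp (- (z * of_real u))"
            by (rule filterlim_compose)
        qed
        show "AE u in lborel. norm (D (X i) u * F u) \<le> 1 / \<rho> * norm (F u)" for i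
        proof (intro AE_I2)
          fix u
          show "norm (D (X i) u * F u) \<le> 1 / \<rho> * norm (F u)"
          proof (cases "u < 0")
            case False
            have "norm (exp (- (X i * complex_of_real u)) - exp (- (z * of_real u))) \<le> (u * exp (- (\<rho> * u))) * norm (X i - z)"
            proof (rule field_differentiable_bound[of "ball z \<rho>"])
              fix w assume w: "w \<in> ball z \<rho>"
              show "((\<lambda>w. exp (- (w * complex_of_real u))) has_field_derivative - of_real u * exp (- (w * of_real u))) (at w within ball z \<rho>)"
                by (auto intro!: derivative_eq_intros)
              show "norm (- of_real u * exp (- (w * of_real u))) \<le> u * exp (- (\<rho> * u))"
                using Re[OF w] False by (auto simp: norm_mult intro!: mult_left_mono mult_right_mono)
            qed (use Xz(1)[of i] \<rho> in auto)
            moreover have "u * exp (- (\<rho> * u)) \<le> 1 / \<rho>"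
            proof -
              have "\<rho> * u \<le> exp (\<rho> * u)" using exp_ge_add_one_self[of "\<rho> * u"] by linarith
              then show ?thesis using \<rho> by (simp add: exp_minus field_simps)
            qed
            ultimately have "norm (exp (- (X i * complex_of_real u)) - exp (- (z * of_real u))) \<le> (1 / \<rho>) * norm (X i - z)"
              by (meson mult_right_mono norm_ge_zero order_trans)
            then have "norm (D (X i) u) \<le> 1 / \<rho>"
              using Xz(2)[of i] by (simp add: D_def norm_divide pos_divide_le_eq)
            then show ?thesis unfolding norm_mult by (intro mult_right_mono) auto
          qed (use F(2) in auto)
        qed
        show "integrable lborel (\<lambda>u. 1 / \<rho> * norm (F u))" using F(1) by simp
      qed (unfold D_def, measurable)
      then show "((\<lambda>w. (?L w - ?L z) / (w - z)) \<circ> X) \<longlonglongrightarrow> (\<integral>u. - of_real u * exp (- (z * of_real u)) * F u \<partial>lborel)"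
        unfolding quot .
    qed
    moreover have "at z within ball z \<rho> = at z" using \<rho> by (intro at_within_open) auto
    ultimately show ?thesis by (simp only:)
  qed
  show ?thesis
  proof (rule holomorphic_onI)
    fix z assume "z \<in> {z. Re z > 0}"
    then have "Re z > 0" by simp
    show "?L field_differentiable (at z within {z. Re z > 0})"
      unfolding field_differentiable_def
      by (rule exI, rule has_field_derivative_at_within[OF deriv[OF \<open>Re z > 0\<close>]])
  qed
qed

text \<open>Polar decomposition F = |F| * (F / |F|) puts the density into the required form. The
  identity with f is known on the positive axis, where the divisions were made, and extends to the
  half-plane because both sides are holomorphic.\<close>

lemma laplace_transform_exists:
  fixes F :: "real \<Rightarrow> complex"
  assumes F: "integrable lborel F" "\<And>u. u < 0 \<Longrightarrow> F u = 0"
    and f: "f holomorphic_on {z. Re z > 0}"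
    and eq: "\<And>x. x > 0 \<Longrightarrow> f (of_real x) = (\<integral>u. exp (- (x * u)) *\<^sub>R F u \<partial>lborel)"
  shows "\<exists>\<nu>. bounded_borel_measure \<nu> \<and> is_laplace_transform_of f \<nu>"
proof -
  have Fm [measurable]: "F \<in> borel_measurable borel" using F(1) by auto
  have em [measurable]: "(\<lambda>u. exp (- z * complex_of_real u)) \<in> borel_measurable borel" for z
    by (intro borel_measurable_continuous_onI continuous_intros)
  define L where "L z = (\<integral>u. exp (- (z * of_real u)) * F u \<partial>lborel)" for z
  have hol: "(\<lambda>z. f z - L z) holomorphic_on {z. Re z > 0}"
    unfolding L_def by (intro holomorphic_intros f laplace_holomorphic F)
  have fL: "f z = L z" if "Re z > 0" for z
  proof -
    have "f z - L z = 0"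
    proof (rule analytic_continuation[OF hol, of "complex_of_real ` {0<..}" 1])
      show "open {z. Re z > 0}" by (rule open_halfspace_Re_gt)
      show "connected {z. Re z > 0}" by (intro convex_connected convex_halfspace_Re_gt)
      show "1 islimpt complex_of_real ` {0<..}"
        unfolding islimpt_sequential
      proof (intro exI conjI allI)
        fix n show "complex_of_real (1 + 1 / real (Suc n)) \<in> complex_of_real ` {0<..} - {1}"
          by (auto simp: add_pos_pos image_iff complex_eq_iff intro!: exI[of _ "1 + 1 / (1 + real n)"])
      next
        have "(\<lambda>n. 1 + 1 / real (Suc n)) \<longlonglongrightarrow> 1" by real_asymp
        from tendsto_of_real[OF this, where 'a = complex]
        show "(\<lambda>n. complex_of_real (1 + 1 / real (Suc n))) \<longlonglongrightarrow> 1" by simp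
      qed
      show "f w - L w = 0" if "w \<in> complex_of_real ` {0<..}" for w
      proof -
        from that obtain x where x: "x > 0" "w = of_real x" by auto
        have "exp (- (complex_of_real x * of_real u)) * F u = exp (- (x * u)) *\<^sub>R F u" for u
          by (simp add: scaleR_conv_of_real exp_of_real[symmetric])
        then show ?thesis using eq[OF x(1)] x(2) by (simp add: L_def)
      qed
    qed (use that in auto)
    then show ?thesis by simp
  qed
  define \<mu> where "\<mu> = density lborel (\<lambda>u. ennreal (norm (F u)))"
  define h where "h u = F u /\<^sub>R norm (F u)" for u
  have hm [measurable]: "h \<in> borel_measurable borel" unfolding h_def by measurable
  have "bounded_borel_measure (\<mu>, h)"
    unfolding bounded_borel_measure_def prod.case
  proof (intro conjI)
    have "emeasure \<mu> (space \<mu>) = (\<integral>\<^sup>+u. ennreal (norm (F u)) \<partial>lborel)"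
      by (simp add: \<mu>_def emeasure_density)
    also have "\<dots> = ennreal (\<integral>u. norm (F u) \<partial>lborel)"
      by (rule nn_integral_eq_integral) (use F(1) in auto)
    finally show fm: "finite_measure \<mu>" by (intro finite_measureI) simp
    show "sets \<mu> = sets borel" by (simp add: \<mu>_def)
    show "emeasure \<mu> {..<0} = 0"
      using F(2) by (auto simp: \<mu>_def emeasure_density nn_integral_0_iff_AE indicator_def intro!: AE_I2)
    show "integrable \<mu> h"
    proof (rule finite_measure.integrable_const_bound[OF fm, of _ 1])
      show "AE u in \<mu>. norm (h u) \<le> 1"
      proof (intro AE_I2)
        fix u show "norm (h u) \<le> 1" by (cases "F u = 0") (auto simp: h_def)
      qed
      show "h \<in> borel_measurable \<mu>" by (simp add: \<mu>_def)
    qed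
  qed
  moreover have "is_laplace_transform_of f (\<mu>, h)"
    unfolding is_laplace_transform_of_def prod.case
  proof (intro allI impI)
    fix z :: complex assume z: "Re z > 0"
    have "(\<integral>u. exp (- z * of_real u) * h u \<partial>\<mu>) = (\<integral>u. norm (F u) *\<^sub>R (exp (- z * of_real u) * h u) \<partial>lborel)"
      unfolding \<mu>_def by (rule integral_density) auto
    also have "\<dots> = L z"
      unfolding L_def
    proof (intro Bochner_Integration.integral_cong refl)
      fix u show "norm (F u) *\<^sub>R (exp (- z * of_real u) * h u) = exp (- (z * of_real u)) * F u"
        by (cases "F u = 0") (auto simp: h_def)
    qed
    finally show "f z = (\<integral>u. exp (- z * of_real u) * h u \<partial>\<mu>)" using fL[OF z] by simp
  qed
  ultimately show ?thesis by blast
qed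

text \<open>This guarantees that the choice in \<open>representing_measure\<close> succeeds. For j
  \<le> q the error divided by x^j still tends to 0 at 0, so one more division is possible: by x
  while j < q, and finally by x^\<theta>.\<close>

lemma Delta_laplace_transform:
  assumes r: "A_stable r" "rational_approximation_of_order q r" and n: "n \<ge> 1"
    and s: "0 < s" "s \<le> real q + 1"
  shows "\<exists>\<nu>. bounded_borel_measure \<nu> \<and> is_laplace_transform_of (Delta r n s) \<nu>"
proof -
  have rat: "rational_function r"
    and O: "(\<lambda>z. cmod (exp (- z) - r z)) \<in> O[at 0](\<lambda>z. cmod z ^ (q + 1))"
    using r(2) unfolding rational_approximation_of_order_def by auto
  obtain p d where rpd: "r = (\<lambda>z. poly p z / poly d z)" and nz: "\<And>z. Re z \<ge> 0 \<Longrightarrow> poly d z \<noteq> 0"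
    and deg: "degree p \<le> degree d" and r1: "\<And>z. Re z \<ge> 0 \<Longrightarrow> cmod (r z) \<le> 1"
    using A_stable_rational_functionE[OF r(1) rat] by metis
  define P where "P = (pcompose p [:0, 1 / of_nat n:]) ^ n"
  define Q where "Q = (pcompose d [:0, 1 / of_nat n:]) ^ n"
  have PQ: "poly P z = poly p (z / of_nat n) ^ n" "poly Q z = poly d (z / of_nat n) ^ n" for z
    by (simp_all add: P_def Q_def poly_power poly_pcompose)
  have rn: "r (z / of_nat n) ^ n = poly P z / poly Q z" for z
    by (simp add: PQ rpd power_divide)
  have d0: "d \<noteq> 0" using nz[of 0] by auto
  define g where "g j x = (of_real (exp (- x)) - r (of_real x / of_nat n) ^ n) / of_real x ^ j" for j :: nat and x :: real
  have exp_lap: "exp_laplace (g 0)"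
  proof -
    have "exp_laplace (\<lambda>x. poly P (of_real x) / poly Q (of_real x))"
    proof (rule exp_laplace_rational)
      show "degree P \<le> degree Q"
        using deg n by (simp add: P_def Q_def degree_power_eq degree_pcompose pcompose_eq_0_iff d0
            order_trans[OF degree_power_le])
      show "Re z < 0" if "poly Q z = 0" for z
      proof (rule ccontr)
        assume "\<not> Re z < 0"
        then have "poly d (z / of_nat n) \<noteq> 0" by (intro nz) (simp add: Re_divide_of_nat)
        with that n show False by (simp add: PQ)
      qed
      show "Q \<noteq> 0" using PQ(2)[of 0] nz[of 0] n by auto
    qed
    from exp_laplace_add[OF exp_laplace_exp exp_laplace_cmult[OF this, of "- 1"]]
    show ?thesis by (rule exp_laplace_cong) (simp add: g_def rn)
  qed
  obtain K where K: "\<forall>\<^sub>F z in at 0. cmod (exp (- z) - r z) \<le> K * cmod z ^ (q + 1)"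
    using landau_o.bigE[OF O] by auto
  \<comment> \<open>As exp(-z) and r z have modulus at most 1, the n-th powers differ by at most n
    times the error of one step. Stability thus hands the order q + 1 at 0 on from one step to n
    steps.\<close>
  have near: "\<forall>\<^sub>F x in at_right 0. cmod (of_real (exp (- x)) - r (of_real x / of_nat n) ^ n)
      \<le> real n * (K * (x / real n) ^ (q + 1))"
  proof -
    have "filterlim (\<lambda>x. complex_of_real (x / real n)) (at 0) (at_right 0)"
      unfolding filterlim_at
    proof
      show "\<forall>\<^sub>F x in at_right 0. complex_of_real (x / real n) \<in> UNIV \<and> complex_of_real (x / real n) \<noteq> 0"
        using eventually_at_right_less[of 0] by eventually_elim (use n in simp)
    qed (use n in \<open>auto intro!: tendsto_eq_intros\<close>)
    from eventually_compose_filterlim[OF K this] eventually_at_right_less[of 0]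
    show ?thesis
    proof eventually_elim
      case (elim x)
      define z where "z = complex_of_real (x / real n)"
      have rz: "Re z \<ge> 0" using elim by (simp add: z_def)
      have "cmod (exp (- z) ^ n - r z ^ n) \<le> real n * cmod (exp (- z) - r z)"
        by (rule norm_power_diff) (use rz r1 in auto)
      also have "\<dots> \<le> real n * (K * (x / real n) ^ (q + 1))"
        using elim by (intro mult_left_mono) (auto simp: z_def norm_divide)
      also have "exp (- z) ^ n = of_real (exp (- x))"
        using n by (simp add: z_def exp_of_nat_mult[symmetric] exp_of_real[symmetric])
      finally show ?case by (simp add: z_def)
    qed
  qed
  have g_lim: "(g j \<longlongrightarrow> 0) (at_right 0)" if j: "j \<le> q" for j
  proof (rule Lim_null_comparison)
    show "\<forall>\<^sub>F x in at_right 0. norm (g j x) \<le> real n * K / real n ^ (q + 1) * x ^ (q + 1 - j)"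
      using near eventually_at_right_less[of 0]
    proof eventually_elim
      case (elim x)
      have "norm (g j x) \<le> real n * (K * (x / real n) ^ (q + 1)) / x ^ j"
        using elim by (simp add: g_def norm_divide norm_power divide_right_mono)
      also have "\<dots> = real n * K / real n ^ (q + 1) * x ^ (q + 1 - j)"
        using elim j power_diff[of x j "q + 1"] by (simp add: power_divide)
      finally show ?case .
    qed
    have "((\<lambda>x. real n * K / real n ^ (q + 1) * x ^ (q + 1 - j)) \<longlongrightarrow>
        real n * K / real n ^ (q + 1) * 0 ^ (q + 1 - j)) (at_right 0)"
      by (intro tendsto_intros)
    then show "((\<lambda>x. real n * K / real n ^ (q + 1) * x ^ (q + 1 - j)) \<longlongrightarrow> 0) (at_right 0)"
      using j by (simp add: power_0_left)
  qed
  have g_lap: "exp_laplace (g j)" if "j \<le> q" for j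
    using that
  proof (induction j)
    case (Suc j)
    then have "exp_laplace (\<lambda>x. g j x / of_real x)"
      by (intro exp_laplace_divide_id g_lim) auto
    then show ?case by (rule exp_laplace_cong) (simp add: g_def)
  qed (rule exp_lap)
  \<comment> \<open>The ceiling, and not the floor, puts \<theta> into (0,1] and gives j = q for s =
    q + 1, the last index that \<open>g_lim\<close> covers.\<close>
  define j where "j = nat (\<lceil>s\<rceil> - 1)"
  define \<theta> where "\<theta> = s - real j"
  have "\<lceil>s\<rceil> \<ge> 1" "\<lceil>s\<rceil> \<le> int q + 1" using s by linarith+
  then have j: "j \<le> q" and rj: "real j = of_int \<lceil>s\<rceil> - 1" by (auto simp: j_def)
  have \<theta>: "0 < \<theta>" "\<theta> \<le> 1" unfolding \<theta>_def rj by linarith+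
  obtain F where F: "integrable lborel F" "\<And>u. u < 0 \<Longrightarrow> F u = 0"
    "\<And>x. x > 0 \<Longrightarrow> (\<integral>u. exp (- (x * u)) *\<^sub>R F u \<partial>lborel) = of_real (x powr - \<theta>) * g j x"
    using exp_laplace_fractional[OF g_lap[OF j] g_lim[OF j] \<theta>] by blast
  show ?thesis
  proof (rule laplace_transform_exists[OF F(1,2)])
    have "poly d (z / of_nat n) \<noteq> 0" if "Re z > 0" for z
      by (rule nz) (use that in \<open>simp add: Re_divide_of_nat\<close>)
    then show "Delta r n s holomorphic_on {z. Re z > 0}"
      unfolding Delta_def rpd using n
      by (intro holomorphic_intros) (auto simp: complex_nonpos_Reals_iff)
    fix x :: real assume x: "x > 0"
    have "complex_of_real x powr - of_real s = of_real (x powr - s)"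
      using x powr_of_real[of x "- s"] by simp
    also have "x powr - s = x powr - \<theta> / x ^ j"
      using x by (simp add: \<theta>_def powr_diff powr_realpow powr_add powr_minus divide_inverse flip: powr_realpow)
    finally have "complex_of_real x powr - of_real s = of_real (x powr - \<theta>) / of_real x ^ j" by simp
    then show "Delta r n s (of_real x) = (\<integral>u. exp (- (x * u)) *\<^sub>R F u \<partial>lborel)"
      unfolding F(3)[OF x] by (simp add: Delta_def g_def exp_of_real[symmetric])
  qed
qed

section \<open>Boundary values on the imaginary axis\<close>

text \<open>\<open>is_laplace_transform_of\<close> speaks of the open half-plane only. As |exp(-z
  u)| \<le> 1 there for u \<ge> 0, dominated convergence along 1/(m+1) + i \<tau> carries the
  formula to the boundary.\<close>

lemma laplace_transform_boundary:
  assumes \<nu>: "bounded_borel_measure (\<mu>, h)" "is_laplace_transform_of f (\<mu>, h)"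
    and f: "(f \<longlongrightarrow> l) (at (\<i> * of_real \<tau>) within {z. Re z > 0})"
  shows "(\<integral>u. exp (- (\<i> * of_real \<tau> * of_real u)) * h u \<partial>\<mu>) = l"
proof -
  define z where "z m = complex_of_real (1 / real (Suc m)) + \<i> * of_real \<tau>" for m
  have zR: "Re (z m) > 0" for m by (simp add: z_def)
  have "(\<lambda>m. 1 / real (Suc m)) \<longlonglongrightarrow> 0" by real_asymp
  then have "(\<lambda>m. z m) \<longlonglongrightarrow> of_real 0 + \<i> * of_real \<tau>" unfolding z_def by (intro tendsto_intros)
  then have zlim: "z \<longlonglongrightarrow> \<i> * of_real \<tau>" by simp
  have "z m \<noteq> \<i> * of_real \<tau>" for m using zR[of m] by (auto simp: complex_eq_iff)
  then have "filterlim z (at (\<i> * of_real \<tau>) within {z. Re z > 0}) sequentially"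
    unfolding filterlim_at using zlim zR by simp
  from filterlim_compose[OF f this] have 1: "(\<lambda>m. f (z m)) \<longlonglongrightarrow> l" .
  from \<nu>(1) have int: "integrable \<mu> h" and sets [measurable_cong]: "sets \<mu> = sets borel"
    unfolding bounded_borel_measure_def by auto
  have hm [measurable]: "h \<in> borel_measurable \<mu>" using int by simp
  have em: "(\<lambda>u. exp (- (w * complex_of_real u))) \<in> borel_measurable \<mu>" for w
    unfolding measurable_cong_sets[OF sets refl]
    by (intro borel_measurable_continuous_onI continuous_intros)
  have "(\<lambda>m. \<integral>u. exp (- (z m * of_real u)) * h u \<partial>\<mu>) \<longlonglongrightarrow> (\<integral>u. exp (- (\<i> * of_real \<tau> * of_real u)) * h u \<partial>\<mu>)"
  proof (rule integral_dominated_convergence[where w = "\<lambda>u. norm (h u)"])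
    show "AE u in \<mu>. (\<lambda>m. exp (- (z m * of_real u)) * h u) \<longlonglongrightarrow> exp (- (\<i> * of_real \<tau> * of_real u)) * h u"
      by (intro AE_I2 tendsto_intros zlim)
    show "AE u in \<mu>. norm (exp (- (z m * of_real u)) * h u) \<le> norm (h u)" for m
      using bounded_borel_measure_AE_nonneg[OF \<nu>(1)]
    proof eventually_elim
      case (elim u)
      then show ?case using zR[of m] by (auto simp: norm_mult intro!: mult_left_le_one_le)
    qed
  qed (use em int in auto)
  moreover have "(\<integral>u. exp (- (z m * of_real u)) * h u \<partial>\<mu>) = f (z m)" for m
    using \<nu>(2) zR[of m] unfolding is_laplace_transform_of_def by simp
  ultimately show ?thesis using LIMSEQ_unique[OF 1] by simp
qed

text \<open>At i \<tau> with \<tau> > 0 the principal power is continuous, its cut being the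
  nonpositive real axis, and r has no pole on the imaginary axis.\<close>

lemma Delta_boundary:
  assumes r: "A_stable r" "rational_function r" and n: "n \<ge> 1" and \<tau>: "\<tau> > 0"
  shows "(Delta r n s \<longlongrightarrow> Delta r n s (\<i> * of_real \<tau>)) (at (\<i> * of_real \<tau>) within S)"
proof -
  obtain p d where rpd: "r = (\<lambda>z. poly p z / poly d z)" and nz: "\<And>z. Re z \<ge> 0 \<Longrightarrow> poly d z \<noteq> 0"
    using A_stable_rational_functionE[OF r] by metis
  have "poly d (\<i> * of_real \<tau> / of_nat n) \<noteq> 0" by (rule nz) (simp add: Re_divide_of_nat)
  moreover have "\<i> * of_real \<tau> \<notin> \<real>\<^sub>\<le>\<^sub>0" using \<tau> by (auto simp: complex_nonpos_Reals_iff)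
  ultimately show ?thesis
    unfolding Delta_def rpd using n by (intro tendsto_intros) auto
qed

section \<open>The lower bound\<close>

theorem theorem3p8:
  fixes r :: "complex \<Rightarrow> complex" and q :: nat
  assumes "q \<ge> 1"
    and "A_stable r"
    and "rational_approximation_of_order q r"
    and "(deriv ^^ (q + 1)) r 0 \<noteq> (- 1) ^ (q + 1)"
  shows "\<exists>C::real. \<exists>n0::nat. C > 0 \<and> n0 \<ge> 1 \<and>
    (\<forall>(X :: 'a::complex_hilbert set) D A T.
       closed_csubspace X \<and> bounded_C0_semigroup X T \<and> neg_generates X D A T \<and>
       {\<i> * of_real y | y::real. y \<ge> 0} \<subseteq> spectrum_on X D A \<longrightarrow>
       (\<forall>s::real. 0 < s \<and> s \<le> real q + 1 \<longrightarrow>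
         (\<forall>n\<ge>n0. \<forall>t\<ge>0.
            t powr s * onorm_on X (hille_phillips (Delta r n s) T t)
              \<ge> C * t powr s / real n powr (s * real q / (real q + 1)))))"
proof -
  have rat: "rational_function r"
    using assms(3) unfolding rational_approximation_of_order_def by simp
  obtain a C :: real and n0 :: nat where a: "0 < a" "a \<le> 1" and C: "C > 0" and n0: "n0 \<ge> 1"
    and err: "\<And>n \<tau>. n \<ge> n0 \<Longrightarrow> \<tau> = a * real n powr (real q / (real q + 1)) \<Longrightarrow>
       cmod (exp (- (\<i> * of_real \<tau>)) - r (\<i> * of_real \<tau> / of_nat n) ^ n) \<ge> C"
    using accumulated_error_lower_bound[OF assms(2-4)] by metis
  have main: "t powr s * onorm_on X (hille_phillips (Delta r n s) T t)
      \<ge> C * t powr s / real n powr (s * real q / (real q + 1))"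
    if X: "closed_csubspace X" and T: "bounded_C0_semigroup X T" and DA: "neg_generates X D A T"
      and spec: "{\<i> * of_real y | y::real. y \<ge> 0} \<subseteq> spectrum_on X D A"
      and s: "0 < s" "s \<le> real q + 1" and n: "n \<ge> n0" and t: "t \<ge> 0"
    for X D :: "'a set" and A T s n t
  proof (cases "t = 0")
    \<comment> \<open>Both sides vanish, as 0 powr s = 0; the point i \<tau> / t used below exists
      for t > 0 only.\<close>
    case True
    then show ?thesis using s by simp
  next
    case False
    with t have t: "t > 0" by simp
    have n1: "n \<ge> 1" using n n0 by simp
    interpret bounded_semigroup X D A T by unfold_locales (rule X T DA)+
    obtain \<mu> h where rep: "representing_measure (Delta r n s) = (\<mu>, h)"
      by (cases "representing_measure (Delta r n s)")
    have \<nu>: "bounded_borel_measure (\<mu>, h)" "is_laplace_transform_of (Delta r n s) (\<mu>, h)"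
      using someI_ex[OF Delta_laplace_transform[OF assms(2,3) n1 s]]
      unfolding rep[symmetric] representing_measure_def by simp_all
    have hp: "hille_phillips (Delta r n s) T t = (\<lambda>x. orbit_integral \<mu> h (\<lambda>u. T (u * t) x))"
      by (simp add: hille_phillips_def orbit_integral_def rep fun_eq_iff)
    define \<tau> where "\<tau> = a * real n powr (real q / (real q + 1))"
    have \<tau>: "\<tau> > 0" using a n1 by (simp add: \<tau>_def)
    \<comment> \<open>Speed t turns this spectral point of A into the frequency \<tau> at which the
      accumulated error is known to be large.\<close>
    have "\<i> * of_real (\<tau> / t) \<in> spectrum_on X D A"
      using spec \<tau> t by (force intro: exI[of _ "\<tau> / t"])
    from spectral_inclusion[OF \<nu>(1) t this]
    have "cmod (\<integral>u. exp (- (\<i> * of_real \<tau> * of_real u)) * h u \<partial>\<mu>)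
        \<le> onorm_on X (hille_phillips (Delta r n s) T t)"
      using t by (simp add: hp)
    also have "(\<integral>u. exp (- (\<i> * of_real \<tau> * of_real u)) * h u \<partial>\<mu>) = Delta r n s (\<i> * of_real \<tau>)"
      by (rule laplace_transform_boundary[OF \<nu> Delta_boundary[OF assms(2) rat n1 \<tau>]])
    finally have le: "cmod (Delta r n s (\<i> * of_real \<tau>)) \<le> onorm_on X (hille_phillips (Delta r n s) T t)" .
    \<comment> \<open>Here a \<le> 1 and s > 0 give a^s \<le> 1, which frees the constant from
      s.\<close>
    have "1 / real n powr (s * real q / (real q + 1)) \<le> \<tau> powr (- s)"
    proof -
      have "\<tau> powr s = a powr s * real n powr (s * real q / (real q + 1))"
        using a n1 by (simp add: \<tau>_def powr_mult powr_powr mult.commute)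
      also have "\<dots> \<le> 1 * real n powr (s * real q / (real q + 1))"
        using a s by (intro mult_right_mono powr_le1) auto
      finally show ?thesis using \<tau> n1 by (simp add: powr_minus field_simps)
    qed
    then have "C * (1 / real n powr (s * real q / (real q + 1))) \<le> C * \<tau> powr (- s)"
      using C by (intro mult_left_mono) auto
    also have "\<dots> \<le> cmod (Delta r n s (\<i> * of_real \<tau>))"
    proof -
      \<comment> \<open>For a real exponent the modulus of the power depends only on the modulus of
        the base.\<close>
      have "cmod ((\<i> * of_real \<tau>) powr (- of_real s)) = \<tau> powr (- s)"
        using \<tau> by (subst norm_powr_real_powr') (auto simp: norm_mult)
      then show ?thesis
        using mult_right_mono[OF err[OF n \<tau>_def], of "\<tau> powr (- s)"]
        by (simp add: Delta_def norm_mult mult.commute)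
    qed
    finally have "C / real n powr (s * real q / (real q + 1)) \<le> onorm_on X (hille_phillips (Delta r n s) T t)"
      using le by simp
    from mult_left_mono[OF this, of "t powr s"] show ?thesis by (simp add: mult.commute)
  qed
  show ?thesis
    by (intro exI[of _ C] exI[of _ n0] conjI C n0 allI impI) (elim conjE, rule main)
qed

end
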